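(* Let $\alpha,\beta>-1$, let $\xi\in(-1,1)$, let $g$ be analytic in a neighborhood of $[-1,1]$, and let $f(x)=(x-\xi)_+^{\sigma}g(x)$. Let $\{a_k^{(\alpha,\beta)}\}_{k\ge0}$ be the Jacobi coefficients of $f$ and, for a nonnegative integer $m$, let $\mathcal{R}_n^m(x)=\frac{\mathrm{d}^m}{\mathrm{d}x^m}\big(f(x)-S_n^{(\alpha,\beta)}(x)\big)$ be the remainder of Jacobi spectral differentiation of order $m$. Then the following hold. (i) For $\sigma>-1$, as $k\to\infty$, $$a_k^{(\alpha,\beta)} = \mathcal{T}_{\sigma,\xi}^{\alpha,\beta}\, \frac{\cos(k\arccos(\xi)-\phi_{\alpha,\beta}(\xi))}{k^{\sigma+1/2}} + O\left(\frac{1}{k^{\sigma+3/2}}\right),$$ where $\phi_{\alpha,\beta}(x) = \left(\frac{\sigma+\alpha}{2} + \frac34\right)\pi - (\alpha+\beta+1)\arccos(x)/2$ and $$\mathcal{T}_{\sigma,\xi}^{\alpha,\beta} = \frac{\Gamma(\sigma+1) (1-\xi)^{\frac{\sigma+\alpha}{2}+\frac{1}{4}} (1+\xi)^{\frac{\sigma+\beta}{2}+\frac{1}{4}} }{2^{\frac{\alpha+\beta-1}{2}} \sqrt{\pi} }\, g(\xi).$$ (ii) Let $\sigma>0$ be not an even integer and let $m<\min\{\sigma,\ (\sigma+1/2-\beta)/2,\ (\sigma+1/2-\alpha)/2\}$. Then, as $n\to\infty$, for $x\in[-1,1]$ with $x\ne\xi$, $$\mathcal{R}_n^m(x)=\begin{cases}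 O(n^{2m+\beta-\sigma-1/2}), & x=-1,\\ O(n^{2m+\alpha-\sigma-1/2}), & x=1,\\ O(n^{m-\sigma-1}), & x\in(-1,\xi)\cup(\xi,1),\end{cases}$$ and for $x=\xi$, $$\mathcal{R}_n^m(\xi)=\begin{cases} O(n^{m-\sigma-1}), & |m-\sigma| \text{ even (i.e. an even integer)},\\ O(n^{m-\sigma}), & \text{otherwise}.\end{cases}$$
   Context: The truncated power is defined by $(x)_+^{\sigma}=x^{\sigma}$ for $x\ge0$ and $(x)_+^{\sigma}=0$ for $x<0$. For $\alpha,\beta>-1$, the Jacobi polynomial of degree $n$ is $$P_n^{(\alpha,\beta)}(x) = \frac{(\alpha+1)_n}{n!}\, {}_2F_1\left(-n,\ n+\alpha+\beta+1;\ \alpha+1;\ \frac{1-x}{2}\right),$$ where ${}_2F_1$ is the Gauss hypergeometric function and $(z)_k$ is the Pochhammer symbol, $(z)_0=1$, $(z)_k=(z)_{k-1}(z+k-1)$. Put $\omega_{\alpha,\beta}(x)=(1-x)^{\alpha}(1+x)^{\beta}$ and $h_k^{(\alpha,\beta)}=\int_{-1}^1 (P_k^{(\alpha,\beta)}(x))^2\omega_{\alpha,\beta}(x)\,\mathrm{d}x$. The Jacobi coefficients and the Jacobi projection of degree $n$ of $f$ are $$a_k^{(\alpha,\beta)} = \frac{1}{h_k^{(\alpha,\beta)}}\int_{-1}^{1} f(x)P_k^{(\alpha,\beta)}(x)\,\omega_{\alpha,\beta}(x)\,\mathrm{d}x,\qquad S_n^{(\alpha,\beta)}(x) = \sum_{k=0}^{n}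 a_k^{(\alpha,\beta)} P_k^{(\alpha,\beta)}(x).$$ All estimates are pointwise: $\alpha,\beta,\sigma,\xi,g,m$ and $x$ are fixed as $k\to\infty$ or $n\to\infty$. *)

theory Defs
  imports "HOL-Analysis.Analysis" "HOL-Library.Landau_Symbols"
begin

(* "powr" has 0 powr 0 = 0, whereas here the power x^sigma at x = 0 for sigma = 0 is 1.
   For sigma < 0 the value at x = 0 is 0 (the power is undefined there). *)
definition truncated_power :: "real \<Rightarrow> real \<Rightarrow> real" where
  "truncated_power \<sigma> x = (if x < 0 then 0 else if \<sigma> = 0 then 1 else x powr \<sigma>)"

definition hyp2F1 :: "real \<Rightarrow> real \<Rightarrow> real \<Rightarrow> real \<Rightarrow> real" where
  "hyp2F1 a b c z = eval_fps (fps_hypergeo [a, b] [c] 1) z"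

lemma hyp2F1_series:
  "hyp2F1 a b c z =
     (\<Sum>k. pochhammer a k * pochhammer b k / (pochhammer c k * fact k) * z ^ k)"
  by (simp add: hyp2F1_def eval_fps_def)

definition jacobi_P :: "real \<Rightarrow> real \<Rightarrow> nat \<Rightarrow> real \<Rightarrow> real" where
  "jacobi_P \<alpha> \<beta> n x =
     pochhammer (\<alpha> + 1) n / fact n *
     hyp2F1 (- real n) (real n + \<alpha> + \<beta> + 1) (\<alpha> + 1) ((1 - x) / 2)"

(* Used only under integrals over [-1,1], so its values at the endpoints play no role. *)
definition jacobi_weight :: "real \<Rightarrow> real \<Rightarrow> real \<Rightarrow> real" where
  "jacobi_weight \<alpha> \<beta> x = (1 - x) powr \<alpha> * (1 + x) powr \<beta>"

definition jacobi_h :: "real \<Rightarrow> real \<Rightarrow> nat \<Rightarrow> real" where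
  "jacobi_h \<alpha> \<beta> k = (LBINT x:{-1..1}. (jacobi_P \<alpha> \<beta> k x)\<^sup>2 * jacobi_weight \<alpha> \<beta> x)"

definition jacobi_coeff :: "real \<Rightarrow> real \<Rightarrow> (real \<Rightarrow> complex) \<Rightarrow> nat \<Rightarrow> complex" where
  "jacobi_coeff \<alpha> \<beta> f k =
     1 / of_real (jacobi_h \<alpha> \<beta> k) *
     (LBINT x:{-1..1}. f x * of_real (jacobi_P \<alpha> \<beta> k x) * of_real (jacobi_weight \<alpha> \<beta> x))"

definition jacobi_proj ::
  "real \<Rightarrow> real \<Rightarrow> (real \<Rightarrow> complex) \<Rightarrow> nat \<Rightarrow> real \<Rightarrow> complex" where
  "jacobi_proj \<alpha> \<beta> f n x =
     (\<Sum>k=0..n. jacobi_coeff \<alpha> \<beta> f k * of_real (jacobi_P \<alpha> \<beta> k x))"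

(* m-fold derivative of a complex-valued function of a real variable *)
definition nth_vector_derivative :: "nat \<Rightarrow> (real \<Rightarrow> complex) \<Rightarrow> real \<Rightarrow> complex" where
  "nth_vector_derivative m = ((\<lambda>h t. vector_derivative h (at t)) ^^ m)"

(* The derivative is two-sided also at x = -1 and x = 1: the functions to which this is
   applied are defined and smooth in a real neighbourhood of these points. *)
definition jacobi_remainder ::
  "real \<Rightarrow> real \<Rightarrow> (real \<Rightarrow> complex) \<Rightarrow> nat \<Rightarrow> nat \<Rightarrow> real \<Rightarrow> complex" where
  "jacobi_remainder \<alpha> \<beta> f m n =
     nth_vector_derivative m (\<lambda>x. f x - jacobi_proj \<alpha> \<beta> f n x)"

definition sing_fun :: "real \<Rightarrow> real \<Rightarrow> (complex \<Rightarrow> complex) \<Rightarrow> real \<Rightarrow> complex" where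
  "sing_fun \<sigma> \<xi> g x = of_real (truncated_power \<sigma> (x - \<xi>)) * g (of_real x)"

definition phase :: "real \<Rightarrow> real \<Rightarrow> real \<Rightarrow> real \<Rightarrow> real" where
  "phase \<sigma> \<alpha> \<beta> x =
     ((\<sigma> + \<alpha>) / 2 + 3 / 4) * pi - (\<alpha> + \<beta> + 1) * arccos x / 2"

definition amplitude ::
  "real \<Rightarrow> real \<Rightarrow> real \<Rightarrow> real \<Rightarrow> (complex \<Rightarrow> complex) \<Rightarrow> complex" where
  "amplitude \<sigma> \<xi> \<alpha> \<beta> g =
     of_real (Gamma (\<sigma> + 1) * (1 - \<xi>) powr ((\<sigma> + \<alpha>) / 2 + 1 / 4)
                * (1 + \<xi>) powr ((\<sigma> + \<beta>) / 2 + 1 / 4)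
              / (2 powr ((\<alpha> + \<beta> - 1) / 2) * sqrt pi))
     * g (of_real \<xi>)"

end

theory Submission
  imports Defs "HOL-Real_Asymp.Real_Asymp" "HOL-Complex_Analysis.Complex_Analysis"
begin

text \<open>
  Let \<open>w\<close> be the Jacobi weight with parameters \<open>a\<close> and \<open>b\<close>, \<open>P_n\<close> the Jacobi polynomial and \<open>h_n\<close> its
  squared norm. Both estimates are statements about the moments \<open>\<integral> q P_n w\<close> of suitable functions \<open>q\<close>, because the
  coefficients are moments divided by \<open>h_n\<close> and the remainder can be expressed through moments as well.

  \<^emph>\<open>Moments.\<close> For a function with \<open>M\<close> derivatives, repeated integration by parts raises both parameters and gains
  a factor \<open>1 / n\<close> each time, so its moments are \<open>O(n powr (-M))\<close> (\<open>jacobi_moment_smooth\<close>). For the pure power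
  \<open>(x - \<xi>)_+^s (1 + x) powr (-b)\<close> the moments are known exactly: Bateman's fractional integral gives a quotient of
  Gamma functions times the value at \<open>\<xi>\<close> of the Jacobi polynomial with parameters \<open>a + s + 1\<close> and \<open>b - s - 1\<close>
  (\<open>jacobi_moment_pure_power\<close>). Expanding the holomorphic factor in powers of \<open>x - \<xi>\<close> reduces the general case to
  these two, and the leading term comes from Darboux's asymptotic formula for \<open>P_n\<close> (\<open>jacobi_moment_sing_fun_leading\<close>).
  Together with the closed form of \<open>h_n\<close> this is the expansion of the coefficients.

  \<^emph>\<open>Darboux's formula\<close> (\<open>jacobi_P_darboux\<close>). The value \<open>P_n (cos \<theta>)\<close> is a Taylor coefficient, hence a contour integral.
  In an exponential coordinate the contour is a rectangle whose horizontal sides run through the two saddle points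
  and carry complex conjugate values, and whose vertical sides can be moved to infinity. On a horizontal side the
  dependence on \<open>n\<close> is a power of \<open>1 + \<kappa> sinh(u/2)^2\<close>. Replacing the remaining amplitude by its value at the saddle point
  gives an integral that is known in closed form, a multiple of \<open>Gamma (n + 1/2) / Gamma (n + 1)\<close>. The error is bounded by
  the difference of two consecutive integrals of the same kind, which is smaller by one power of \<open>n\<close>.

  \<^emph>\<open>Remainder.\<close> By the Christoffel--Darboux formula, \<open>f(x) - S_n(x)\<close> equals a factor of order \<open>n\<close> times
  \<open>P_{n+1}(x) I_n - P_n(x) I_{n+1}\<close>, where \<open>I_n\<close> is the moment of the difference quotient \<open>(f(y) - f(x)) / (y - x)\<close>
  (\<open>jacobi_remainder_via_quotient\<close>). For \<open>x \<noteq> \<xi>\<close> the quotient has the same singularity as \<open>f\<close>, up to a smooth function. For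
  \<open>x = \<xi>\<close> its exponent drops by one, which costs one power of \<open>n\<close>, except that for an even exponent the two
  oscillations are in phase and the leading terms cancel. The size of \<open>P_n(x)\<close> is \<open>n powr (-1/2)\<close> inside the interval,
  \<open>n powr a\<close> at \<open>1\<close> and \<open>n powr b\<close> at \<open>-1\<close>.

  \<^emph>\<open>Derivatives.\<close> Since differentiation turns the projection of \<open>f\<close> into the projection of \<open>f'\<close> for parameters
  raised by one (\<open>jacobi_proj_has_derivative\<close>), the remainder of order \<open>m\<close> is the remainder of order \<open>0\<close> for
  \<open>a + m\<close>, \<open>b + m\<close> and the \<open>m\<close>-th derivative of \<open>f\<close>, a truncated power of exponent \<open>\<sigma> - m\<close> times a
  holomorphic function.
\<close>

section \<open>Orders of decay\<close>

text \<open>The order is a predicate on a normed space, with real exponent, so that real and complex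
  sequences share one calculus and exponents add and compare as real numbers.\<close>

definition decays :: "real \<Rightarrow> (nat \<Rightarrow> 'a::real_normed_vector) \<Rightarrow> bool" where
  "decays p f \<longleftrightarrow> (\<lambda>n. norm (f n)) \<in> O(\<lambda>n. real n powr p)"

lemma decaysI:
  assumes "eventually (\<lambda>n. norm (f n) \<le> C * real n powr p) sequentially"
  shows "decays p f"
  unfolding decays_def
  by (rule bigoI[of _ C], rule eventually_mono[OF assms]) simp

lemma decaysE:
  assumes "decays p f"
  obtains C where "C > 0" "eventually (\<lambda>n. norm (f n) \<le> C * real n powr p) sequentially"
  using assms unfolding decays_def by (elim landau_o.bigE) auto

lemma decays_dominated:
  assumes "decays p g" "eventually (\<lambda>n. norm (f n) \<le> norm (g n)) sequentially"
  shows "decays p f"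
proof -
  have "(\<lambda>n. norm (f n)) \<in> O(\<lambda>n. norm (g n))"
    by (rule bigoI[of _ 1]) (use assms(2) in simp)
  then show ?thesis
    using assms(1) unfolding decays_def by (rule landau_o.big_trans)
qed

lemma decays_cong:
  assumes "decays p g" "eventually (\<lambda>n. f n = g n) sequentially"
  shows "decays p f"
  using assms(1) by (rule decays_dominated) (use assms(2) in \<open>auto elim: eventually_mono\<close>)

lemma decays_mono:
  assumes "decays p f" "p \<le> q"
  shows "decays q f"
proof -
  have "(\<lambda>n. real n powr p) \<in> O(\<lambda>n. real n powr q)"
    by (rule bigoI[of _ 1], rule eventually_mono[OF eventually_gt_at_top[of 0]])
       (use assms(2) in \<open>auto intro!: powr_mono\<close>)
  with assms(1) show ?thesis
    unfolding decays_def by (rule landau_o.big_trans)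
qed

lemma decays_add:
  assumes "decays p f" "decays p g"
  shows "decays p (\<lambda>n. f n + g n)"
proof -
  have "decays p (\<lambda>n. norm (f n) + norm (g n))"
    using sum_in_bigo(1)[of "\<lambda>n. norm (f n)" _ "\<lambda>n. real n powr p" "\<lambda>n. norm (g n)"] assms
    unfolding decays_def by simp
  then show ?thesis
    by (rule decays_dominated) (auto intro!: always_eventually norm_triangle_ineq)
qed

lemma decays_zero [simp]: "decays p (\<lambda>n. 0)"
  by (simp add: decays_def)

lemma decays_minus: "decays p f \<Longrightarrow> decays p (\<lambda>n. - f n)"
  by (simp add: decays_def)

lemma decays_diff: "decays p f \<Longrightarrow> decays p g \<Longrightarrow> decays p (\<lambda>n. f n - g n)"
  using decays_add[of p f "\<lambda>n. - g n"] decays_minus[of p g] by simp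

lemma decays_sum:
  "finite A \<Longrightarrow> (\<And>i. i \<in> A \<Longrightarrow> decays p (f i)) \<Longrightarrow> decays p (\<lambda>n. \<Sum>i\<in>A. f i n)"
  by (induction A rule: finite_induct) (auto intro!: decays_add)

lemma decays_mult:
  fixes f g :: "nat \<Rightarrow> 'a::real_normed_algebra"
  assumes "decays p f" "decays q g"
  shows "decays (p + q) (\<lambda>n. f n * g n)"
proof -
  have "decays (p + q) (\<lambda>n. norm (f n) * norm (g n))"
    using landau_o.big.mult[OF assms[unfolded decays_def]] unfolding decays_def
    by (simp add: powr_add)
  then show ?thesis
    by (rule decays_dominated) (auto intro!: always_eventually norm_mult_ineq)
qed

lemma decays_const: "decays 0 (\<lambda>n. c)"
  by (rule decaysI[of _ "norm c"], rule eventually_mono[OF eventually_gt_at_top[of 0]]) simp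

lemma decays_cmult:
  fixes f :: "nat \<Rightarrow> 'a::real_normed_algebra"
  shows "decays p f \<Longrightarrow> decays p (\<lambda>n. c * f n)"
  using decays_mult[OF decays_const[of c]] by simp

lemma decays_bounded: "(\<And>n. norm (f n) \<le> C) \<Longrightarrow> decays 0 f"
  by (rule decaysI[of _ C], rule eventually_mono[OF eventually_gt_at_top[of 0]]) simp

lemma decays_powr: "decays p (\<lambda>n. real n powr p)"
  by (simp add: decays_def)

lemma decays_of_real [simp]:
  "decays p (\<lambda>n. of_real (f n) :: 'a::real_normed_algebra_1) \<longleftrightarrow> decays p f"
  by (simp add: decays_def)

lemma decays_shift_up:
  assumes "decays p f"
  shows "decays p (\<lambda>n. f (n + k))"
proof -
  have "(\<lambda>n. norm (f (n + k))) \<in> O(\<lambda>n. real (n + k) powr p)"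
    by (rule landau_o.big.compose[OF assms[unfolded decays_def]]) real_asymp
  also have "(\<lambda>n. real (n + k) powr p) \<in> O(\<lambda>n. real n powr p)"
    unfolding of_nat_add by real_asymp
  finally show ?thesis unfolding decays_def .
qed

lemma decays_shift_down:
  assumes "decays p f"
  shows "decays p (\<lambda>n. f (n - k))"
proof -
  have "(\<lambda>n. norm (f (n - k))) \<in> O(\<lambda>n. real (n - k) powr p)"
    by (rule landau_o.big.compose[OF assms[unfolded decays_def]])
       (simp add: filterlim_minus_const_nat_at_top)
  also have "(\<lambda>n. real (n - k) powr p) \<in> O(\<lambda>n. (real n - real k) powr p)"
    by (rule landau_o.bigI[of 1], simp, rule eventually_mono[OF eventually_ge_at_top[of k]])
       (simp add: of_nat_diff)
  also have "(\<lambda>n. (real n - real k) powr p) \<in> O(\<lambda>n. real n powr p)"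
    by real_asymp
  finally show ?thesis unfolding decays_def .
qed

text \<open>The asymptotic formulas below consist of a main term and an error that is one power of \<open>n\<close>
  smaller; this product rule propagates that form.\<close>

lemma decays_mult_leading:
  fixes f1 f2 m1 m2 :: "nat \<Rightarrow> 'a::real_normed_algebra"
  assumes "decays p m1" "decays (p - 1) (\<lambda>n. f1 n - m1 n)"
    and "decays q m2" "decays (q - 1) (\<lambda>n. f2 n - m2 n)"
  shows "decays (p + q - 1) (\<lambda>n. f1 n * f2 n - m1 n * m2 n)"
proof -
  have "decays (p + q - 1) (\<lambda>n. (f1 n - m1 n) * (f2 n - m2 n) + (f1 n - m1 n) * m2 n
            + m1 n * (f2 n - m2 n))"
    using decays_mono[OF decays_mult[OF assms(2,4)], of "p + q - 1"]
      decays_mult[OF assms(2,3)] decays_mult[OF assms(1,4)]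
    by (intro decays_add) (simp_all add: algebra_simps)
  then show ?thesis by (simp add: algebra_simps)
qed

lemma decays_leading_imp:
  assumes "decays p m" "decays (p - 1) (\<lambda>n. f n - m n)"
  shows "decays p f"
  using decays_add[OF assms(1) decays_mono[OF assms(2), of p]] by simp

lemma decays_leading_trans:
  assumes "decays p (\<lambda>n. f n - g n)" "decays p (\<lambda>n. g n - h n)"
  shows "decays p (\<lambda>n. f n - h n)"
  using decays_add[OF assms] by simp

lemma decays_neg_tendsto:
  assumes "decays p f" "p < 0"
  shows "f \<longlonglongrightarrow> 0"
proof -
  have "(\<lambda>n. norm (f n)) \<in> O(\<lambda>n. real n powr p)"
    using assms unfolding decays_def by simp
  moreover have "(\<lambda>n. real n powr p) \<in> o(\<lambda>n. 1)"
    using assms(2) by real_asymp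
  ultimately have "(\<lambda>n. norm (f n)) \<in> o(\<lambda>n. 1)"
    by (rule landau_o.big_small_trans)
  then show ?thesis
    using smalloD_tendsto tendsto_norm_zero_cancel by fastforce
qed

lemma decays_inverse_leading:
  fixes f :: "nat \<Rightarrow> real"
  assumes "decays (-1) (\<lambda>n. f n - 1)"
  shows "decays (-1) (\<lambda>n. 1 / f n - 1)"
proof -
  have "(\<lambda>n. f n - 1) \<longlonglongrightarrow> 0"
    by (rule decays_neg_tendsto[OF assms]) simp
  then have "eventually (\<lambda>n. \<bar>f n - 1\<bar> < 1/2) sequentially"
    using order_tendstoD(2)[OF tendsto_rabs_zero, of "\<lambda>n. f n - 1" sequentially "1/2"] by simp
  then have "eventually (\<lambda>n. norm (1 / f n - 1) \<le> norm (2 * (f n - 1))) sequentially"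
  proof eventually_elim
    case (elim n)
    then have f: "f n > 1/2" by linarith
    then have "1 / f n - 1 = (1 - f n) / f n" by (simp add: field_simps)
    then have "\<bar>1 / f n - 1\<bar> = \<bar>f n - 1\<bar> / f n" using f by (simp add: abs_divide abs_minus_commute)
    also have "\<dots> \<le> \<bar>f n - 1\<bar> / (1/2)" using f by (intro divide_left_mono) auto
    finally have "\<bar>1 / f n - 1\<bar> \<le> 2 * \<bar>f n - 1\<bar>" by (simp add: mult.commute)
    then show ?case by (simp only: norm_mult real_norm_def abs_numeral)
  qed
  then show ?thesis
    by (rule decays_dominated[OF decays_cmult[OF assms]])
qed

section \<open>Ratios of Gamma functions\<close>

lemma Gamma_plus1_pos: "x > 0 \<Longrightarrow> Gamma (x + 1) = x * Gamma (x::real)"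
  by (intro Gamma_plus1) (auto elim!: nonpos_Ints_cases)

text \<open>Log-convexity of \<open>Gamma\<close> between \<open>x\<close> and \<open>x + 1\<close>. Used at \<open>x\<close> with shift \<open>s\<close> and at \<open>x + s\<close>
  with shift \<open>1 - s\<close>, it encloses the ratio from both sides (Wendel's inequalities).\<close>

lemma Gamma_add_le_powr:
  fixes x s :: real
  assumes "x > 0" "0 \<le> s" "s \<le> 1"
  shows "Gamma (x + s) \<le> x powr s * Gamma x"
proof -
  have "(ln \<circ> Gamma) ((1 - s) *\<^sub>R x + s *\<^sub>R (x + 1))
      \<le> (1 - s) * (ln \<circ> Gamma) x + s * (ln \<circ> Gamma) (x + 1)"
    using assms by (intro convex_onD[OF log_convex_Gamma_real]) auto
  moreover have "(1 - s) *\<^sub>R x + s *\<^sub>R (x + 1) = x + s" by (simp add: algebra_simps)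
  moreover have "Gamma (x + 1) = x * Gamma x"
    by (rule Gamma_plus1_pos[OF assms(1)])
  ultimately have "ln (Gamma (x + s)) \<le> (1 - s) * ln (Gamma x) + s * ln (x * Gamma x)"
    by simp
  also have "\<dots> = ln (x powr s * Gamma x)"
    using assms by (simp add: ln_mult ln_powr algebra_simps less_imp_neq[symmetric])
  finally show ?thesis
    using assms by (subst (asm) ln_le_cancel_iff) (auto intro!: mult_pos_pos)
qed

lemma Gamma_ratio_unit_shift:
  fixes s :: real
  assumes "0 \<le> s" "s \<le> 1"
  shows "decays (-1) (\<lambda>n. Gamma (real n + s) / (Gamma (real n) * real n powr s) - 1)"
proof (rule decaysI[of _ 1])
  show "\<forall>\<^sub>F n in sequentially. norm (Gamma (real n + s) / (Gamma (real n) * real n powr s) - 1)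
          \<le> 1 * real n powr - 1"
    using eventually_gt_at_top[of 0]
  proof eventually_elim
    case (elim n)
    let ?x = "real n"
    have x: "?x > 0" using elim by simp
    have G: "Gamma ?x > 0" "Gamma (?x + s) > 0" using x assms by auto
    have up: "Gamma (?x + s) \<le> ?x powr s * Gamma ?x"
      by (rule Gamma_add_le_powr[OF x assms])
    have "Gamma (?x + s + (1 - s)) \<le> (?x + s) powr (1 - s) * Gamma (?x + s)"
      by (rule Gamma_add_le_powr) (use x assms in auto)
    then have lo: "?x * Gamma ?x \<le> (?x + s) powr (1 - s) * Gamma (?x + s)"
      using Gamma_plus1_pos[OF x] by (simp add: add.commute)
    have "?x * Gamma ?x / (?x + s) \<le> (?x + s) powr (1 - s) * Gamma (?x + s) / (?x + s)"
      using lo x assms by (intro divide_right_mono) auto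
    also have "\<dots> = Gamma (?x + s) / (?x + s) powr s"
      using x assms by (simp add: powr_diff)
    also have "\<dots> \<le> Gamma (?x + s) / ?x powr s"
      using x assms G by (intro divide_left_mono powr_mono2 mult_pos_pos) auto
    finally have "?x / (?x + s) \<le> Gamma (?x + s) / (Gamma ?x * ?x powr s)"
      using G x assms by (simp add: field_simps)
    moreover have "s * ?x \<le> 1 * ?x"
      using assms(2) by (intro mult_right_mono) (use assms in auto)
    then have "s * ?x \<le> s + ?x" using assms(1) by linarith
    then have "1 - 1 / ?x \<le> ?x / (?x + s)"
      using x assms by (simp add: field_simps)
    moreover have "Gamma (?x + s) / (Gamma ?x * ?x powr s) \<le> 1"
      using up G x by (subst divide_le_eq_1_pos) (auto simp: mult.commute)
    ultimately have "\<bar>Gamma (?x + s) / (Gamma ?x * ?x powr s) - 1\<bar> \<le> 1 / ?x"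
      unfolding abs_le_iff using x by linarith
    then show ?case
      using x by (simp only: real_norm_def) (simp add: powr_minus_divide)
  qed
qed

text \<open>The functional equation transports the estimate by integer steps in both directions,
  starting from the fractional part of \<open>a\<close>.\<close>

lemma Gamma_shift_leading:
  "decays (-1) (\<lambda>n. Gamma (real n + a) / (Gamma (real n) * real n powr a) - 1)"
proof -
  let ?u = "\<lambda>a n. Gamma (real n + a) / (Gamma (real n) * real n powr a)"
  have lead1: "decays (-1) (\<lambda>n. f n * g n - 1)"
    if "decays (-1) (\<lambda>n. f n - 1)" "decays (-1) (\<lambda>n. g n - 1)" for f g :: "nat \<Rightarrow> real"
    using decays_mult_leading[of 0 "\<lambda>_. 1" f 0 "\<lambda>_. 1" g] that decays_const[of "1::real"] by simp
  have one: "decays (-1) (\<lambda>n. (real n + a) / real n - 1)" for a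
  proof (rule decaysI[of _ "\<bar>a\<bar>"])
    show "\<forall>\<^sub>F n in sequentially. norm ((real n + a) / real n - 1) \<le> \<bar>a\<bar> * real n powr - 1"
      using eventually_gt_at_top[of 0]
      by eventually_elim (simp add: powr_minus_divide add_divide_distrib abs_divide)
  qed
  have rel: "\<forall>\<^sub>F n in sequentially. ?u (a + 1) n = (real n + a) / real n * ?u a n" for a
    using eventually_gt_at_top[of "nat \<lceil>\<bar>a\<bar>\<rceil> + 1"]
  proof eventually_elim
    case (elim n)
    then have p: "real n + a > 0" "real n > 0" by linarith+
    then have "Gamma (real n + a + 1) = (real n + a) * Gamma (real n + a)"
      by (intro Gamma_plus1_pos)
    then show ?case using p by (simp add: powr_add field_simps)
  qed
  have up: "decays (-1) (\<lambda>n. ?u (a + 1) n - 1)" if "decays (-1) (\<lambda>n. ?u a n - 1)" for a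
    by (rule decays_cong[OF lead1[OF one that]]) (use rel in \<open>auto elim: eventually_mono\<close>)
  have down: "decays (-1) (\<lambda>n. ?u a n - 1)" if "decays (-1) (\<lambda>n. ?u (a + 1) n - 1)" for a
  proof (rule decays_cong[OF lead1[OF decays_inverse_leading[OF one] that]])
    show "\<forall>\<^sub>F n in sequentially. ?u a n - 1 = 1 / ((real n + a) / real n) * ?u (a + 1) n - 1"
      using rel[of a] eventually_gt_at_top[of "nat \<lceil>\<bar>a\<bar>\<rceil> + 1"]
    proof eventually_elim
      case (elim n)
      then have p: "real n + a > 0" "real n > 0" by linarith+
      show ?case unfolding elim(1) using p by simp
    qed
  qed
  have "decays (-1) (\<lambda>n. ?u (frac a + of_int k) n - 1)" for k
  proof (induction k rule: int_induct[where k = 0])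
    case base
    show ?case using Gamma_ratio_unit_shift[of "frac a"] by (simp add: frac_lt_1 less_imp_le)
  next
    case (step1 i)
    show ?case using up[OF step1(2)] by (simp add: add.assoc)
  next
    case (step2 i)
    show ?case using down[of "frac a + of_int (i - 1)"] step2(2) by (simp add: add.assoc)
  qed
  from this[of "\<lfloor>a\<rfloor>"] show ?thesis by (simp add: frac_def)
qed

lemma Gamma_ratio_leading:
  "decays (a - b - 1) (\<lambda>n. Gamma (real n + a) / Gamma (real n + b) - real n powr (a - b))"
proof -
  let ?u = "\<lambda>a n. Gamma (real n + a) / (Gamma (real n) * real n powr a)"
  have "decays (0 + 0 - 1) (\<lambda>n. ?u a n * (1 / ?u b n) - 1 * 1)"
    using Gamma_shift_leading[of a] decays_inverse_leading[OF Gamma_shift_leading[of b]]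
    by (intro decays_mult_leading decays_const) simp_all
  then have "decays ((a - b) + (-1)) (\<lambda>n. real n powr (a - b) * (?u a n * (1 / ?u b n) - 1))"
    by (intro decays_mult[OF decays_powr]) simp
  then have D: "decays (a - b - 1) (\<lambda>n. real n powr (a - b) * (?u a n * (1 / ?u b n) - 1))"
    by (simp only: diff_conv_add_uminus)
  show ?thesis
  proof (rule decays_cong[OF D])
    show "\<forall>\<^sub>F n in sequentially. Gamma (real n + a) / Gamma (real n + b) - real n powr (a - b)
        = real n powr (a - b) * (?u a n * (1 / ?u b n) - 1)"
      using eventually_gt_at_top[of "nat \<lceil>\<bar>b\<bar>\<rceil> + 1"]
    proof eventually_elim
      case (elim n)
      then have p: "real n + b > 0" "real n > 0" by linarith+
      have "Gamma (real n + b) \<noteq> 0" "Gamma (real n) \<noteq> 0"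
        using Gamma_real_pos[OF p(1)] Gamma_real_pos[OF p(2)] by linarith+
      then show ?case using p(2) by (simp add: powr_diff right_diff_distrib)
    qed
  qed
qed

section \<open>Jacobi polynomials in powers of (1 - x) / 2\<close>

text \<open>The coefficient is a product of two generalized binomials, which is meaningful for every
  real \<open>b\<close> and exhibits the sum as a convolution. It vanishes beyond \<open>n\<close> so that sums up to
  \<open>n + 1\<close> can be compared term by term.\<close>

definition jacobi_c :: "real \<Rightarrow> real \<Rightarrow> nat \<Rightarrow> nat \<Rightarrow> real" where
  "jacobi_c a b n j =
     (if j \<le> n then ((real n + a) gchoose (n - j)) * ((- (real n + a + b + 1)) gchoose j) else 0)"

lemma jacobi_P_sum:
  assumes a: "a > -1"
  shows "jacobi_P a b n x = (\<Sum>j\<le>n. jacobi_c a b n j * ((1 - x) / 2) ^ j)"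
proof -
  let ?q = "real n + a + b + 1" and ?z = "(1 - x) / 2"
  have van: "pochhammer (- real n) k = 0" if "k \<notin> {..n}" for k
    using that by (simp add: pochhammer_of_nat_eq_0_iff)
  have "hyp2F1 (- real n) ?q (a + 1) ?z
      = (\<Sum>k\<le>n. pochhammer (- real n) k * pochhammer ?q k / (pochhammer (a + 1) k * fact k) * ?z ^ k)"
    unfolding hyp2F1_series by (rule suminf_finite) (use van in auto)
  then have "jacobi_P a b n x = (\<Sum>k\<le>n. pochhammer (a + 1) n / fact n *
        (pochhammer (- real n) k * pochhammer ?q k / (pochhammer (a + 1) k * fact k) * ?z ^ k))"
    unfolding jacobi_P_def by (simp add: sum_distrib_left)
  also have "\<dots> = (\<Sum>j\<le>n. jacobi_c a b n j * ?z ^ j)"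
  proof (rule sum.cong[OF refl])
    fix j assume j: "j \<in> {..n}"
    have p: "pochhammer (a + 1) j \<noteq> 0"
      using a pochhammer_pos[of "a + 1" j] by simp
    have split: "pochhammer (a + 1) n = pochhammer (a + 1) j * pochhammer (a + 1 + real j) (n - j)"
      using j by (intro pochhammer_product) simp
    have m: "pochhammer (- real n) j = (-1) ^ j * fact n / fact (n - j)"
    proof -
      have "real n gchoose j = (-1) ^ j * pochhammer (- real n) j / fact j"
        by (rule gbinomial_pochhammer)
      moreover have "real n gchoose j = fact n / (fact j * fact (n - j))"
        using j binomial_fact[of j n, where 'a = real] by (simp add: binomial_gbinomial)
      ultimately have "(-1) ^ j * pochhammer (- real n) j = fact n / fact (n - j)"
        by (simp add: field_simps)
      then have "(-1) ^ j * ((-1) ^ j * pochhammer (- real n) j) = (-1) ^ j * fact n / fact (n - j)"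
        by simp
      then show ?thesis by (simp flip: mult.assoc power_mult_distrib)
    qed
    have g1: "(real n + a) gchoose (n - j) = pochhammer (a + 1 + real j) (n - j) / fact (n - j)"
      using j by (simp add: gbinomial_pochhammer' of_nat_diff algebra_simps)
    have g2: "(- ?q) gchoose j = (-1) ^ j * pochhammer ?q j / fact j"
      by (subst gbinomial_pochhammer) (simp only: minus_minus)
    show "pochhammer (a + 1) n / fact n *
        (pochhammer (- real n) j * pochhammer ?q j / (pochhammer (a + 1) j * fact j) * ?z ^ j)
        = jacobi_c a b n j * ?z ^ j"
      unfolding jacobi_c_def m split using j p g1 g2 by simp
  qed
  finally show ?thesis .
qed

lemma jacobi_P_0: "a > -1 \<Longrightarrow> jacobi_P a b 0 x = 1"
  by (simp add: jacobi_P_sum jacobi_c_def)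

definition jacobi_poly :: "real \<Rightarrow> real \<Rightarrow> nat \<Rightarrow> real poly" where
  "jacobi_poly a b n = (\<Sum>j\<le>n. smult (jacobi_c a b n j) ([:1/2, -1/2:] ^ j))"

lemma poly_jacobi_poly: "a > -1 \<Longrightarrow> poly (jacobi_poly a b n) x = jacobi_P a b n x"
  by (simp add: jacobi_P_sum jacobi_poly_def poly_sum diff_divide_distrib)

lemma degree_jacobi_poly_le: "degree (jacobi_poly a b n) \<le> n"
proof -
  have "degree ([:1/2, -1/2:] ^ j :: real poly) = j" for j
    by (simp add: degree_power_eq)
  then show ?thesis
    unfolding jacobi_poly_def by (intro degree_sum_le) (auto intro: order.trans[OF degree_smult_le])
qed

lemma coeff_jacobi_poly_ne_0:
  assumes "a > -1" "b > -1"
  shows "coeff (jacobi_poly a b n) n \<noteq> 0"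
proof -
  have d: "degree ([:1/2, -1/2:] ^ j :: real poly) = j" for j
    by (simp add: degree_power_eq)
  have lc: "coeff ([:1/2, -1/2:] ^ n :: real poly) n = (-1/2) ^ n"
    using lead_coeff_power[of "[:1/2, -1/2:] :: real poly" n] unfolding d by simp
  have "coeff (jacobi_poly a b n) n
      = (\<Sum>j\<le>n. jacobi_c a b n j * coeff ([:1/2, -1/2:] ^ j) n)"
    by (simp add: jacobi_poly_def coeff_sum)
  also have "\<dots> = (\<Sum>j\<in>{n}. jacobi_c a b n j * coeff ([:1/2, -1/2:] ^ j) n)"
    proof (rule sum.mono_neutral_right)
    show "\<forall>i\<in>{..n} - {n}. jacobi_c a b n i * coeff ([:1/2, -1/2:] ^ i) n = 0"
    proof
      fix i assume "i \<in> {..n} - {n}"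
      then have "coeff ([:1/2, -1/2:] ^ i :: real poly) n = 0"
        by (intro coeff_eq_0, unfold d) simp
      then show "jacobi_c a b n i * coeff ([:1/2, -1/2:] ^ i) n = 0" by simp
    qed
  qed auto
  also have "\<dots> = ((- (real n + a + b + 1)) gchoose n) * (-1/2) ^ n"
    by (simp only: sum.insert[OF finite.emptyI] sum.empty empty_iff not_False_eq_True lc) (simp add: jacobi_c_def)
  also have "\<dots> \<noteq> 0"
  proof -
    have "pochhammer (real n + a + b + 1) n \<noteq> 0"
    proof (cases n)
      case (Suc k)
      then have "pochhammer (real n + a + b + 1) n > 0"
        using assms by (intro pochhammer_pos) simp
      then show ?thesis by simp
    qed simp
    then show ?thesis by (subst gbinomial_pochhammer) (simp only: minus_minus, simp)
  qed
  finally show ?thesis .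
qed

lemma degree_jacobi_poly: "a > -1 \<Longrightarrow> b > -1 \<Longrightarrow> degree (jacobi_poly a b n) = n"
  using coeff_jacobi_poly_ne_0[of a b n] degree_jacobi_poly_le[of a b n]
  by (simp add: le_degree le_antisym)

lemma continuous_on_jacobi_P [continuous_intros]: "a > -1 \<Longrightarrow> continuous_on S (jacobi_P a b n)"
  by (subst continuous_on_cong[OF refl poly_jacobi_poly[symmetric]]) (auto intro!: continuous_intros)

lemma jacobi_P_has_derivative:
  assumes a: "a > -1"
  shows "(jacobi_P a b (Suc n) has_real_derivative
           (real n + a + b + 2) / 2 * jacobi_P (a + 1) (b + 1) n x) (at x)"
proof -
  let ?z = "\<lambda>x::real. (1 - x) / 2"
  have eq: "jacobi_P a b (Suc n) = (\<lambda>x. \<Sum>j\<le>Suc n. jacobi_c a b (Suc n) j * ?z x ^ j)"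
    using jacobi_P_sum[OF a] by blast
  have "((\<lambda>x. \<Sum>j\<le>Suc n. jacobi_c a b (Suc n) j * ?z x ^ j) has_real_derivative
      (\<Sum>j\<le>Suc n. jacobi_c a b (Suc n) j * (real j * ?z x ^ (j - 1) * (-1/2)))) (at x)"
    by (auto intro!: derivative_eq_intros DERIV_sum sum.cong simp del: sum.atMost_Suc)
  also have "(\<Sum>j\<le>Suc n. jacobi_c a b (Suc n) j * (real j * ?z x ^ (j - 1) * (-1/2)))
      = (\<Sum>i\<le>n. jacobi_c a b (Suc n) (Suc i) * (real (Suc i) * ?z x ^ i * (-1/2)))"
    by (subst sum.atMost_Suc_shift) simp
  also have "\<dots> = (\<Sum>i\<le>n. (real n + a + b + 2) / 2 * (jacobi_c (a + 1) (b + 1) n i * ?z x ^ i))"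
  proof (rule sum.cong[OF refl])
    fix i assume i: "i \<in> {..n}"
    let ?q = "real n + a + b + 2"
    have A: "real (Suc i) * ((- ?q) gchoose Suc i) = (- ?q) * ((- ?q - 1) gchoose i)"
      using Suc_times_gbinomial[of i "- ?q - 1"] by (simp only: diff_add_cancel)
    have B: "jacobi_c a b (Suc n) (Suc i) = ((real n + 1 + a) gchoose (n - i)) * ((- ?q) gchoose Suc i)"
      using i by (simp add: jacobi_c_def algebra_simps)
    have C: "jacobi_c (a + 1) (b + 1) n i = ((real n + 1 + a) gchoose (n - i)) * ((- ?q - 1) gchoose i)"
      using i by (simp add: jacobi_c_def algebra_simps)
    have "C * G1 * (s * Z * (-1/2)) = q / 2 * (C * G2 * Z)"
      if "s * G1 = (- q) * G2" for C G1 s Z q G2 :: real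
    proof -
      have "C * G1 * (s * Z * (-1/2)) = (s * G1) * (C * Z * (-1/2))" by simp
      also have "\<dots> = q / 2 * (C * G2 * Z)" by (simp only: that) simp
      finally show ?thesis .
    qed
    from this[OF A] show "jacobi_c a b (Suc n) (Suc i) * (real (Suc i) * ?z x ^ i * (-1/2))
        = ?q / 2 * (jacobi_c (a + 1) (b + 1) n i * ?z x ^ i)"
      unfolding B C .
  qed
  also have "\<dots> = (real n + a + b + 2) / 2 * jacobi_P (a + 1) (b + 1) n x"
    using a by (simp add: jacobi_P_sum sum_distrib_left)
  finally show ?thesis unfolding eq .
qed

lemma gbinomial_Suc_times: "real (Suc k) * (x gchoose Suc k) = (x - real k) * (x gchoose k)"
  by (simp add: gbinomial_prod_rev fact_Suc atLeast0_lessThan_Suc divide_simps)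

text \<open>Pascal's rule for the factor with parameter \<open>a + b\<close> and the absorption identity for both
  factors.\<close>

lemma jacobi_c_relation:
  assumes "j \<le> Suc n"
  shows "- 2 * real (Suc n) * jacobi_c a b (Suc n) j
     = - 2 * (real j + a + 1) * jacobi_c (a + 1) (b + 1) n j
       + (if j = 0 then 0 else 2 * (real j + a + b + 1) * jacobi_c (a + 1) (b + 1) n (j - 1))"
proof -
  let ?q = "real n + a + b + 2" and ?x = "real n + 1 + a"
  have c: "jacobi_c a b (Suc n) j = (?x gchoose (Suc n - j)) * ((- ?q) gchoose j)"
    using assms by (simp add: jacobi_c_def algebra_simps)
  have p: "(real j + a + 1) * jacobi_c (a + 1) (b + 1) n j
      = (real (Suc n) - real j) * (?x gchoose (Suc n - j)) * ((- ?q - 1) gchoose j)"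
  proof (cases "j \<le> n")
    case True
    then have "real (Suc (n - j)) * (?x gchoose Suc (n - j)) = (?x - real (n - j)) * (?x gchoose (n - j))"
      by (rule_tac gbinomial_Suc_times)
    with True show ?thesis
      by (simp add: jacobi_c_def Suc_diff_le of_nat_diff algebra_simps)
  next
    case False
    then have "j = Suc n" using assms by simp
    then show ?thesis by (simp add: jacobi_c_def)
  qed
  show ?thesis
  proof (cases j)
    case 0
    then show ?thesis using p c by (simp add: algebra_simps)
  next
    case (Suc i)
    then have i: "i \<le> n" using assms by simp
    have pm: "jacobi_c (a + 1) (b + 1) n i = (?x gchoose (Suc n - j)) * ((- ?q - 1) gchoose i)"
      using i Suc by (simp add: jacobi_c_def algebra_simps)
    have pascal: "(- ?q) gchoose Suc i = ((- ?q - 1) gchoose i) + ((- ?q - 1) gchoose Suc i)"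
      using gbinomial_Suc_Suc[of "- ?q - 1" i] by (simp only: diff_add_cancel)
    have st: "real (Suc i) * ((- ?q - 1) gchoose Suc i) = (- ?q - 1 - real i) * ((- ?q - 1) gchoose i)"
      by (rule gbinomial_Suc_times)
    let ?G1 = "(- ?q - 1) gchoose Suc i" and ?G0 = "(- ?q - 1) gchoose i" and ?C = "?x gchoose (Suc n - j)"
    have "(real (Suc n) - real j) * ?G1 - (real j + a + b + 1) * ?G0 = real (Suc n) * (?G1 + ?G0)"
      using st Suc by (simp add: algebra_simps)
    then have "?C * ((real (Suc n) - real j) * ?G1 - (real j + a + b + 1) * ?G0)
        = ?C * (real (Suc n) * (?G1 + ?G0))" by simp
    then show ?thesis
      using p c pm Suc pascal by (simp add: algebra_simps)
  qed
qed

text \<open>Together with the power rule for the weight this is the derivative of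
  \<open>(1 - x) ^ (a + 1) (1 + x) ^ (b + 1) P\<close>, the structure relation behind the Rodrigues formula.\<close>

lemma jacobi_P_structure:
  assumes a: "a > -1" and D: "(jacobi_P (a + 1) (b + 1) n has_real_derivative D) (at x)"
  shows "(1 - x\<^sup>2) * D + ((b + 1) * (1 - x) - (a + 1) * (1 + x)) * jacobi_P (a + 1) (b + 1) n x
       = - 2 * real (Suc n) * jacobi_P a b (Suc n) x"
proof -
  let ?p = "jacobi_c (a + 1) (b + 1) n"
  define z where "z = (1 - x) / 2"
  have x: "x = 1 - 2 * z" by (simp add: z_def field_simps)
  have eq: "jacobi_P (a + 1) (b + 1) n = (\<lambda>x. \<Sum>j\<le>n. ?p j * ((1 - x) / 2) ^ j)"
    using jacobi_P_sum a by (simp add: fun_eq_iff)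
  have "(jacobi_P (a + 1) (b + 1) n has_real_derivative
      (\<Sum>j\<le>n. ?p j * (real j * z ^ (j - 1) * (-1/2)))) (at x)"
    unfolding eq z_def by (auto intro!: derivative_eq_intros DERIV_sum sum.cong)
  then have D': "D = (\<Sum>j\<le>n. ?p j * (real j * z ^ (j - 1) * (-1/2)))"
    using D DERIV_unique by blast
  have aux: "- 2 * (1 - z) * p * (r * w) + (2 * (b + 1) * z - 2 * (a + 1) * (1 - z)) * (p * w)
      = - 2 * (r + a + 1) * p * w + 2 * (r + a + b + 2) * p * (z * w)" for p r w
    by (simp add: algebra_simps)
  have "(1 - x\<^sup>2) * D + ((b + 1) * (1 - x) - (a + 1) * (1 + x)) * jacobi_P (a + 1) (b + 1) n x
      = (\<Sum>j\<le>n. (1 - x\<^sup>2) * (?p j * (real j * z ^ (j - 1) * (-1/2)))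
          + ((b + 1) * (1 - x) - (a + 1) * (1 + x)) * (?p j * z ^ j))"
    unfolding D' eq z_def by (simp only: sum_distrib_left sum.distrib)
  also have "\<dots> = (\<Sum>j\<le>n. - 2 * (real j + a + 1) * ?p j * z ^ j + 2 * (real j + a + b + 2) * ?p j * z ^ Suc j)"
  proof (rule sum.cong[OF refl])
    fix j assume "j \<in> {..n}"
    have zj: "real j * z ^ (j - 1) * z = real j * z ^ j"
      by (cases j) auto
    have xx: "1 - x\<^sup>2 = 4 * z * (1 - z)"
      by (simp add: x power2_eq_square algebra_simps)
    have "(1 - x\<^sup>2) * (?p j * (real j * z ^ (j - 1) * (-1/2)))
        = - 2 * (1 - z) * ?p j * (real j * z ^ (j - 1) * z)"
      unfolding xx by (simp only: ac_simps)
    then have e1: "(1 - x\<^sup>2) * (?p j * (real j * z ^ (j - 1) * (-1/2)))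
        = - 2 * (1 - z) * ?p j * (real j * z ^ j)"
      unfolding zj .
    have e2: "(b + 1) * (1 - x) - (a + 1) * (1 + x) = 2 * (b + 1) * z - 2 * (a + 1) * (1 - z)"
      by (simp add: x algebra_simps)
    show "(1 - x\<^sup>2) * (?p j * (real j * z ^ (j - 1) * (-1/2)))
          + ((b + 1) * (1 - x) - (a + 1) * (1 + x)) * (?p j * z ^ j)
        = - 2 * (real j + a + 1) * ?p j * z ^ j + 2 * (real j + a + b + 2) * ?p j * z ^ Suc j"
      unfolding e1 e2 power_Suc by (rule aux)
  qed
  also have "\<dots> = (\<Sum>j\<le>Suc n. - 2 * (real j + a + 1) * ?p j * z ^ j)
      + (\<Sum>j\<le>Suc n. (if j = 0 then 0 else 2 * (real j + a + b + 1) * ?p (j - 1)) * z ^ j)"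
  proof -
    have "(\<Sum>j\<le>Suc n. (if j = 0 then 0 else 2 * (real j + a + b + 1) * ?p (j - 1)) * z ^ j)
        = (\<Sum>j\<le>n. 2 * (real j + a + b + 2) * ?p j * z ^ Suc j)"
      by (subst sum.atMost_Suc_shift) (simp add: add_ac)
    moreover have "(\<Sum>j\<le>Suc n. - 2 * (real j + a + 1) * ?p j * z ^ j)
        = (\<Sum>j\<le>n. - 2 * (real j + a + 1) * ?p j * z ^ j)"
      by (simp add: jacobi_c_def[of _ _ n "Suc n"])
    ultimately show ?thesis by (simp only: sum.distrib)
  qed
  also have "\<dots> = (\<Sum>j\<le>Suc n. (- 2 * (real j + a + 1) * ?p j
      + (if j = 0 then 0 else 2 * (real j + a + b + 1) * ?p (j - 1))) * z ^ j)"
    by (simp only: sum.distrib distrib_right)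
  also have "\<dots> = (\<Sum>j\<le>Suc n. - 2 * real (Suc n) * jacobi_c a b (Suc n) j * z ^ j)"
  proof (rule sum.cong[OF refl])
    fix j assume "j \<in> {..Suc n}"
    then have "j \<le> Suc n" by simp
    then show "(- 2 * (real j + a + 1) * ?p j
        + (if j = 0 then 0 else 2 * (real j + a + b + 1) * ?p (j - 1))) * z ^ j
        = - 2 * real (Suc n) * jacobi_c a b (Suc n) j * z ^ j"
      by (subst jacobi_c_relation) simp_all
  qed
  also have "\<dots> = - 2 * real (Suc n) * jacobi_P a b (Suc n) x"
    using a by (simp add: jacobi_P_sum z_def sum_distrib_left mult.assoc del: sum.atMost_Suc)
  finally show ?thesis .
qed

lemma decays_pochhammer_over_fact:
  assumes "c > 0"
  shows "decays (c - 1) (\<lambda>n. pochhammer c n / fact n)"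
proof -
  have "decays (c - 1) (\<lambda>n. Gamma (real n + c) / Gamma (real n + 1))"
    by (rule decays_leading_imp[OF decays_powr Gamma_ratio_leading])
  then have "decays (c - 1) (\<lambda>n. 1 / Gamma c * (Gamma (real n + c) / Gamma (real n + 1)))"
    by (rule decays_cmult)
  moreover have "pochhammer c n / fact n = 1 / Gamma c * (Gamma (real n + c) / Gamma (real n + 1))" for n
  proof -
    have "c \<notin> \<int>\<^sub>\<le>\<^sub>0" using assms nonpos_Ints_nonpos[of c] by auto
    then have "pochhammer c n = Gamma (c + real n) / Gamma c"
      by (rule pochhammer_Gamma)
    moreover have "Gamma (real n + 1) = fact n"
      using Gamma_fact[of n, where 'a = real] by (simp only: add.commute)
    ultimately show ?thesis by (simp add: add.commute)
  qed
  ultimately show ?thesis by simp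
qed

lemma decays_jacobi_P_at_1:
  assumes "a > -1"
  shows "decays a (\<lambda>n. jacobi_P a b n 1)"
proof -
  have "jacobi_P a b n 1 = pochhammer (a + 1) n / fact n" for n
  proof -
    have "jacobi_P a b n 1 = (\<Sum>j\<le>n. if j = 0 then jacobi_c a b n 0 else 0)"
      unfolding jacobi_P_sum[OF assms] by (intro sum.cong) auto
    also have "\<dots> = (real n + a) gchoose n" by (simp add: jacobi_c_def)
    also have "\<dots> = pochhammer (a + 1) n / fact n"
      by (subst gbinomial_pochhammer') (simp add: algebra_simps)
    finally show ?thesis .
  qed
  then show ?thesis using decays_pochhammer_over_fact[of "a + 1"] assms by simp
qed

text \<open>At \<open>x = -1\<close> the powers of \<open>(1 - x) / 2\<close> are all \<open>1\<close> and the sum is a Chu--Vandermonde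
  convolution.\<close>

lemma jacobi_P_at_minus_1:
  assumes "a > -1"
  shows "jacobi_P a b n (-1) = (-1) ^ n * pochhammer (b + 1) n / fact n"
proof -
  have "jacobi_P a b n (-1) = (\<Sum>j\<in>{0..n}. ((- (real n + a + b + 1)) gchoose j) * ((real n + a) gchoose (n - j)))"
    unfolding jacobi_P_sum[OF assms] atMost_atLeast0
    by (intro sum.cong) (auto simp: jacobi_c_def)
  also have "\<dots> = ((- (real n + a + b + 1)) + (real n + a) gchoose n)"
    by (rule gbinomial_Vandermonde)
  also have "(- (real n + a + b + 1)) + (real n + a) = - (b + 1)"
    by simp
  finally show ?thesis by (subst (asm) gbinomial_pochhammer) (simp only: minus_minus)
qed

lemma decays_jacobi_P_at_minus_1:
  assumes "a > -1" "b > -1"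
  shows "decays b (\<lambda>n. jacobi_P a b n (-1))"
proof (rule decays_dominated)
  show "decays b (\<lambda>n. pochhammer (b + 1) n / fact n)"
    using decays_pochhammer_over_fact[of "b + 1"] assms by simp
  show "\<forall>\<^sub>F n in sequentially.
      norm (jacobi_P a b n (- 1)) \<le> norm (pochhammer (b + 1) n / fact n)"
    unfolding jacobi_P_at_minus_1[OF assms(1)] by (simp add: abs_mult)
qed

section \<open>Integration against the Jacobi weight\<close>

lemma set_integrable_mult_continuous:
  fixes F G :: "real \<Rightarrow> complex"
  assumes F: "set_integrable lborel {l..u} F" and G: "continuous_on {l..u} G"
  shows "set_integrable lborel {l..u} (\<lambda>x. F x * G x)"
proof -
  have "compact (G ` {l..u})"
    using G by (intro compact_continuous_image) auto
  then have "bounded (G ` {l..u})" by (rule compact_imp_bounded)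
  then obtain C where C: "\<And>x. x \<in> {l..u} \<Longrightarrow> norm (G x) \<le> C"
    unfolding bounded_iff by blast
  have "(\<lambda>x. (indicator {l..u} x *\<^sub>R F x) * (indicator {l..u} x *\<^sub>R G x)) \<in> borel_measurable lborel"
  proof (rule borel_measurable_times)
    show "(\<lambda>x. indicator {l..u} x *\<^sub>R F x) \<in> borel_measurable lborel"
      using F unfolding set_integrable_def by (rule borel_measurable_integrable)
    show "(\<lambda>x. indicator {l..u} x *\<^sub>R G x) \<in> borel_measurable lborel"
      using borel_measurable_continuous_on_indicator[OF _ G] by simp
  qed
  also have "(\<lambda>x. (indicator {l..u} x *\<^sub>R F x) * (indicator {l..u} x *\<^sub>R G x))
      = (\<lambda>x. indicator {l..u} x *\<^sub>R (F x * G x))"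
    by (auto simp: indicator_def)
  finally have meas: "set_borel_measurable lborel {l..u} (\<lambda>x. F x * G x)"
    unfolding set_borel_measurable_def .
  have "set_integrable lborel {l..u} (\<lambda>x. of_real C * F x)"
    using F by simp
  then show ?thesis
  proof (rule set_integrable_bound[OF _ meas])
    show "AE x in lborel. x \<in> {l..u} \<longrightarrow> norm (F x * G x) \<le> norm (of_real C * F x)"
    proof (intro always_eventually allI impI)
      fix x assume x: "x \<in> {l..u}"
      then have "norm (G x) \<le> \<bar>C\<bar>" using C[OF x] by linarith
      then show "norm (F x * G x) \<le> norm (of_real C * F x)"
        using mult_left_mono[of "norm (G x)" "\<bar>C\<bar>" "norm (F x)"] by (simp add: norm_mult mult.commute)
    qed
  qed
qed

lemma powr_mult_powr_integral:
  fixes p q s r :: real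
  assumes pq: "p < q" and s: "s > -1" and r: "r > -1"
  shows "set_integrable lborel {p..q} (\<lambda>x. (x - p) powr s * (q - x) powr r)"
    and "(LBINT x:{p..q}. (x - p) powr s * (q - x) powr r)
           = (q - p) powr (s + r + 1) * Beta (s + 1) (r + 1)"
proof -
  let ?f = "\<lambda>t. t powr s * (1 - t) powr r"
  let ?g = "\<lambda>x. (x - p) powr s * (q - x) powr r"
  define d where "d = q - p"
  have d: "d > 0" using pq by (simp add: d_def)
  have "(?f has_integral Beta (s + 1) (r + 1)) (cbox 0 1)"
    using has_integral_Beta_real[of "s + 1" "r + 1"] s r by simp
  then have "((\<lambda>x. ?f ((1 / d) *\<^sub>R x + (- p / d))) has_integral (Beta (s + 1) (r + 1) /\<^sub>R (1 / d) ^ DIM(real)))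
      (cbox ((0 - (- p / d)) /\<^sub>R (1 / d)) ((1 - (- p / d)) /\<^sub>R (1 / d)))"
    by (rule has_integral_affinity') (use d in simp)
  moreover have "cbox ((0 - (- p / d)) /\<^sub>R (1 / d)) ((1 - (- p / d)) /\<^sub>R (1 / d)) = {p..q}"
  proof -
    have "(0 - (- p / d)) /\<^sub>R (1 / d) = p" "(1 - (- p / d)) /\<^sub>R (1 / d) = q"
      using d by (simp_all add: d_def field_simps)
    then show ?thesis by (simp only: cbox_interval)
  qed
  ultimately have "((\<lambda>x. ?f ((1 / d) *\<^sub>R x + (- p / d))) has_integral
      (Beta (s + 1) (r + 1) /\<^sub>R (1 / d) ^ DIM(real))) {p..q}" by (simp only:)
  also have "Beta (s + 1) (r + 1) /\<^sub>R (1 / d) ^ DIM(real) = d * Beta (s + 1) (r + 1)"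
    using d by simp
  finally have "((\<lambda>x. ?f ((1 / d) *\<^sub>R x + (- p / d))) has_integral d * Beta (s + 1) (r + 1)) {p..q}" .
  then have "((\<lambda>x. d powr (s + r) * ?f ((1 / d) *\<^sub>R x + (- p / d)))
      has_integral d powr (s + r) * (d * Beta (s + 1) (r + 1))) {p..q}"
    by (rule has_integral_mult_right)
  moreover have "d powr (s + r) * ?f ((1 / d) *\<^sub>R x + (- p / d)) = ?g x" if "x \<in> {p..q}" for x
  proof -
    have e1: "(1 / d) *\<^sub>R x + (- p / d) = (x - p) / d" by (simp add: diff_divide_distrib)
    have e2: "1 - (x - p) / d = (q - x) / d" using d by (simp add: d_def field_simps)
    have "((x - p) / d) powr s = (x - p) powr s / d powr s" "((q - x) / d) powr r = (q - x) powr r / d powr r"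
      using that d by (simp_all add: powr_divide)
    then show ?thesis unfolding e1 e2 using d by (simp add: powr_add)
  qed
  ultimately have "(?g has_integral d powr (s + r) * (d * Beta (s + 1) (r + 1))) {p..q}"
    by (rule has_integral_eq[rotated])
  also have "d powr (s + r) * (d * Beta (s + 1) (r + 1)) = d powr (s + r + 1) * Beta (s + 1) (r + 1)"
    using d by (simp add: powr_add)
  finally have I: "(?g has_integral d powr (s + r + 1) * Beta (s + 1) (r + 1)) {p..q}" .
  have "set_integrable lebesgue {p..q} ?g"
    by (rule nonnegative_absolutely_integrable_1) (use I in auto)
  then show S: "set_integrable lborel {p..q} ?g"
    unfolding set_integrable_def by (subst (asm) integrable_completion) measurable
  show "(LBINT x:{p..q}. ?g x) = (q - p) powr (s + r + 1) * Beta (s + 1) (r + 1)"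
    using set_borel_integral_eq_integral(2)[OF S] integral_unique[OF I] by (simp add: d_def)
qed

lemma jacobi_weight_integrable:
  assumes "a > -1" "b > -1"
  shows "set_integrable lborel {-1..1} (\<lambda>x. complex_of_real (jacobi_weight a b x))"
proof -
  have "set_integrable lborel {-1..1} (jacobi_weight a b)"
    using powr_mult_powr_integral(1)[of "-1" 1 b a] assms
    by (simp add: jacobi_weight_def[abs_def] mult.commute add.commute)
  then show ?thesis 
    unfolding set_integrable_def by (auto dest: integrable_of_real[where 'a = complex] simp: scaleR_conv_of_real)
qed

text \<open>Integrability against the weight is tracked separately from continuity because the functions
  that occur may be unbounded at an interior point.\<close>

definition weight_integrable :: "real \<Rightarrow> real \<Rightarrow> (real \<Rightarrow> complex) \<Rightarrow> bool" where
  "weight_integrable a b f \<longleftrightarrow>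
     set_integrable lborel {-1..1} (\<lambda>x. f x * of_real (jacobi_weight a b x))"

definition weight_integral :: "real \<Rightarrow> real \<Rightarrow> (real \<Rightarrow> complex) \<Rightarrow> complex" where
  "weight_integral a b f = (LBINT x:{-1..1}. f x * of_real (jacobi_weight a b x))"

text \<open>The Jacobi coefficient without its normalization. Integration by parts and the fractional
  integral below act on moments; the norms enter only at the end.\<close>

definition jacobi_moment :: "real \<Rightarrow> real \<Rightarrow> (real \<Rightarrow> complex) \<Rightarrow> nat \<Rightarrow> complex" where
  "jacobi_moment a b f k = weight_integral a b (\<lambda>x. f x * of_real (jacobi_P a b k x))"

lemma jacobi_coeff_eq_moment:
  "jacobi_coeff a b f k = jacobi_moment a b f k / of_real (jacobi_h a b k)"
  by (simp add: jacobi_coeff_def jacobi_moment_def weight_integral_def)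

lemma weight_integrable_mult:
  assumes "weight_integrable a b f" "continuous_on {-1..1} G"
  shows "weight_integrable a b (\<lambda>x. f x * G x)"
  using set_integrable_mult_continuous[OF assms(1)[unfolded weight_integrable_def] assms(2)]
  unfolding weight_integrable_def by (simp add: mult_ac)

lemma weight_integrable_continuous:
  assumes "a > -1" "b > -1" "continuous_on {-1..1} G"
  shows "weight_integrable a b G"
  using set_integrable_mult_continuous[OF jacobi_weight_integrable[OF assms(1,2)] assms(3)]
  unfolding weight_integrable_def by (simp add: mult_ac)

lemma weight_integrable_cmult: "weight_integrable a b f \<Longrightarrow> weight_integrable a b (\<lambda>x. c * f x)"
  unfolding weight_integrable_def by (simp add: mult.assoc)

lemma weight_integrable_add:
  "weight_integrable a b f \<Longrightarrow> weight_integrable a b g \<Longrightarrow> weight_integrable a b (\<lambda>x. f x + g x)"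
  unfolding weight_integrable_def by (simp add: distrib_right)

lemma weight_integral_cong:
  "(\<And>x. x \<in> {-1..1} \<Longrightarrow> f x = g x) \<Longrightarrow> weight_integral a b f = weight_integral a b g"
  unfolding weight_integral_def by (rule set_lebesgue_integral_cong) auto

lemma weight_integral_add:
  "weight_integrable a b f \<Longrightarrow> weight_integrable a b g \<Longrightarrow>
     weight_integral a b (\<lambda>x. f x + g x) = weight_integral a b f + weight_integral a b g"
  unfolding weight_integrable_def weight_integral_def by (simp add: distrib_right)

lemma weight_integral_cmult: "weight_integral a b (\<lambda>x. c * f x) = c * weight_integral a b f"
  unfolding weight_integral_def by (simp add: mult.assoc)

lemma weight_integral_diff:
  assumes "weight_integrable a b f" "weight_integrable a b g"
  shows "weight_integral a b (\<lambda>x. f x - g x) = weight_integral a b f - weight_integral a b g"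
  using weight_integral_add[OF assms(1) weight_integrable_cmult[OF assms(2), of "-1"]]
    weight_integral_cmult[of a b "-1" g] by simp

lemma weight_integral_sum:
  assumes "finite A" "\<And>i. i \<in> A \<Longrightarrow> weight_integrable a b (f i)"
  shows "weight_integral a b (\<lambda>x. \<Sum>i\<in>A. f i x) = (\<Sum>i\<in>A. weight_integral a b (f i))"
    and "weight_integrable a b (\<lambda>x. \<Sum>i\<in>A. f i x)"
proof -
  have z: "weight_integrable a b (\<lambda>x. 0)" "weight_integral a b (\<lambda>x. 0) = 0"
    by (simp_all add: weight_integral_def weight_integrable_def set_integrable_def)
  have "weight_integral a b (\<lambda>x. \<Sum>i\<in>A. f i x) = (\<Sum>i\<in>A. weight_integral a b (f i))
      \<and> weight_integrable a b (\<lambda>x. \<Sum>i\<in>A. f i x)"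
    using assms
    by (induction A rule: finite_induct) (auto simp: z weight_integral_add weight_integrable_add)
  then show "weight_integral a b (\<lambda>x. \<Sum>i\<in>A. f i x) = (\<Sum>i\<in>A. weight_integral a b (f i))"
    "weight_integrable a b (\<lambda>x. \<Sum>i\<in>A. f i x)" by auto
qed

lemma weight_integral_norm_le:
  assumes "weight_integrable a b f"
    and "set_integrable lborel {-1..1} (\<lambda>x. G x * jacobi_weight a b x)"
    and "\<And>x. x \<in> {-1..1} \<Longrightarrow> norm (f x) \<le> G x"
  shows "norm (weight_integral a b f) \<le> (LBINT x:{-1..1}. G x * jacobi_weight a b x)"
proof -
  have "norm (weight_integral a b f) \<le> (LBINT x:{-1..1}. norm (f x * of_real (jacobi_weight a b x)))"
    unfolding weight_integral_def
    by (rule set_integral_norm_bound) (use assms(1) in \<open>simp add: weight_integrable_def\<close>)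
  also have "\<dots> \<le> (LBINT x:{-1..1}. G x * jacobi_weight a b x)"
  proof (rule set_integral_mono)
    show "set_integrable lborel {-1..1} (\<lambda>x. norm (f x * of_real (jacobi_weight a b x)))"
      using assms(1) unfolding weight_integrable_def by (rule set_integrable_norm)
    fix x :: real assume "x \<in> {-1..1}"
    from assms(3)[OF this] show "norm (f x * of_real (jacobi_weight a b x)) \<le> G x * jacobi_weight a b x"
      by (simp add: norm_mult jacobi_weight_def mult_right_mono)
  qed (rule assms(2))
  finally show ?thesis .
qed

lemma continuous_on_of_real_jacobi_P [continuous_intros]:
  "a > -1 \<Longrightarrow> continuous_on S (\<lambda>x. complex_of_real (jacobi_P a b n x))"
  by (intro continuous_on_of_real continuous_on_jacobi_P)

section \<open>Integration by parts and the norms\<close>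

text \<open>The structure relation says that \<open>-2 (k + 1) w_{a,b} P_{k+1}\<close> is the derivative of
  \<open>w_{a+1,b+1} P_k\<close> for the shifted parameters; since \<open>w_{a+1,b+1}\<close> vanishes at both ends there is
  no boundary term.\<close>

lemma jacobi_moment_Suc:
  assumes a: "a > -1" and b: "b > -1"
    and F: "continuous_on {-1..1} F" and F': "continuous_on {-1..1} F'"
    and D: "\<And>x. x \<in> {-1<..<1} \<Longrightarrow> (F has_vector_derivative F' x) (at x)"
  shows "jacobi_moment a b F (Suc k) = jacobi_moment (a + 1) (b + 1) F' k / of_real (2 * real (Suc k))"
proof -
  let ?w = "jacobi_weight a b" and ?W = "jacobi_weight (a + 1) (b + 1)"
  let ?P = "jacobi_P a b (Suc k)" and ?Q = "jacobi_P (a + 1) (b + 1) k"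
  let ?N = "complex_of_real (- 2 * real (Suc k))"
  have W0: "?W (-1) = 0" "?W 1 = 0" using a b by (simp_all add: jacobi_weight_def)
  have contW: "continuous_on {-1..1} ?W"
    unfolding jacobi_weight_def using a b
    by (intro continuous_intros continuous_on_powr') auto
  have der: "((\<lambda>x. F x * of_real (?W x * ?Q x)) has_vector_derivative
      (F' x * of_real (?Q x) * of_real (?W x) + ?N * (F x * of_real (?P x) * of_real (?w x)))) (at x)"
    if x: "x \<in> {-1<..<1}" for x
  proof -
    have "poly (jacobi_poly (a + 1) (b + 1) k) = ?Q"
      using poly_jacobi_poly[of "a + 1" "b + 1" k] a by (simp add: fun_eq_iff)
    then obtain Q' where Q': "(?Q has_real_derivative Q') (at x)"
      using poly_DERIV[of "jacobi_poly (a + 1) (b + 1) k" x] by metis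
    have Wder: "(?W has_real_derivative
        (?w x * ((b + 1) * (1 - x) - (a + 1) * (1 + x)))) (at x)"
    proof -
      have "((\<lambda>x. (1 - x) powr (a + 1)) has_real_derivative (a + 1) * (1 - x) powr (a + 1 - of_nat 1) * (- 1)) (at x)"
        by (rule DERIV_fun_powr) (use x in \<open>auto intro!: derivative_eq_intros\<close>)
      moreover have "((\<lambda>x. (1 + x) powr (b + 1)) has_real_derivative (b + 1) * (1 + x) powr (b + 1 - of_nat 1) * 1) (at x)"
        by (rule DERIV_fun_powr) (use x in \<open>auto intro!: derivative_eq_intros\<close>)
      ultimately have "(?W has_real_derivative
          (a + 1) * (1 - x) powr (a + 1 - of_nat 1) * (- 1) * (1 + x) powr (b + 1)
          + (b + 1) * (1 + x) powr (b + 1 - of_nat 1) * 1 * (1 - x) powr (a + 1)) (at x)"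
        unfolding jacobi_weight_def[abs_def] by (rule DERIV_mult)
      moreover have p: "(1 - x) powr (a + 1) = (1 - x) powr a * (1 - x)" "(1 + x) powr (b + 1) = (1 + x) powr b * (1 + x)"
        using x by (simp_all add: powr_add)
      have "(a + 1) * (1 - x) powr (a + 1 - of_nat 1) * (- 1) * (1 + x) powr (b + 1)
          + (b + 1) * (1 + x) powr (b + 1 - of_nat 1) * 1 * (1 - x) powr (a + 1)
          = ?w x * ((b + 1) * (1 - x) - (a + 1) * (1 + x))"
        unfolding p jacobi_weight_def by (simp add: algebra_simps)
      ultimately show ?thesis by simp
    qed
    have Wx: "?W x = ?w x * (1 - x\<^sup>2)"
      using x by (simp add: jacobi_weight_def powr_add power2_eq_square algebra_simps)
    have "((\<lambda>x. ?W x * ?Q x) has_real_derivative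
        (?w x * ((1 - x\<^sup>2) * Q' + ((b + 1) * (1 - x) - (a + 1) * (1 + x)) * ?Q x))) (at x)"
      by (rule DERIV_mult[OF Wder Q', THEN DERIV_cong], unfold Wx) (simp add: algebra_simps)
    then have "((\<lambda>x. ?W x * ?Q x) has_real_derivative (?w x * (- 2 * real (Suc k) * ?P x))) (at x)"
      unfolding jacobi_P_structure[OF a Q'] .
    then have "((\<lambda>x. complex_of_real (?W x * ?Q x)) has_vector_derivative
        of_real (?w x * (- 2 * real (Suc k) * ?P x))) (at x)"
      by (rule has_vector_derivative_of_real)
    from has_vector_derivative_mult[OF D[OF x] this] show ?thesis
      by (simp add: algebra_simps)
  qed
  have "((\<lambda>x. F' x * of_real (?Q x) * of_real (?W x) + ?N * (F x * of_real (?P x) * of_real (?w x)))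
      has_integral (F 1 * of_real (?W 1 * ?Q 1) - F (-1) * of_real (?W (-1) * ?Q (-1)))) {-1..1}"
    by (rule fundamental_theorem_of_calculus_interior[OF _ _ der])
       (use a F contW in \<open>auto intro!: continuous_intros\<close>)
  then have int0: "integral {-1..1} (\<lambda>x. F' x * of_real (?Q x) * of_real (?W x)
      + ?N * (F x * of_real (?P x) * of_real (?w x))) = 0"
    using W0 by (simp add: integral_unique)
  have i1: "weight_integrable (a + 1) (b + 1) (\<lambda>x. F' x * of_real (?Q x))"
    using a b F' by (intro weight_integrable_continuous continuous_intros) auto
  have i2: "weight_integrable a b (\<lambda>x. F x * of_real (?P x))"
    using a b F by (intro weight_integrable_continuous continuous_intros) auto
  have i2': "set_integrable lborel {-1..1} (\<lambda>x. ?N * (F x * of_real (?P x) * of_real (?w x)))"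
    by (rule set_integrable_mult_right) (use i2 in \<open>simp add: weight_integrable_def\<close>)
  have "0 = (LBINT x:{-1..1}. F' x * of_real (?Q x) * of_real (?W x)
      + ?N * (F x * of_real (?P x) * of_real (?w x)))"
    unfolding int0[symmetric]
    by (rule set_borel_integral_eq_integral(2)[symmetric], rule set_integral_add(1))
       (use i1 i2' in \<open>auto simp: weight_integrable_def\<close>)
  also have "\<dots> = jacobi_moment (a + 1) (b + 1) F' k + ?N * jacobi_moment a b F (Suc k)"
    unfolding jacobi_moment_def weight_integral_def
    by (subst set_integral_add(2)) (use i1 i2' in \<open>auto simp: weight_integrable_def mult.assoc\<close>)
  finally have "of_real (2 * real (Suc k)) * jacobi_moment a b F (Suc k) = jacobi_moment (a + 1) (b + 1) F' k"
    by (simp add: algebra_simps)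
  then show ?thesis
    by (metis nonzero_mult_div_cancel_left of_nat_neq_0 of_real_eq_0_iff mult_eq_0_iff zero_neq_numeral)
qed

lemma of_real_jacobi_h:
  "complex_of_real (jacobi_h a b k) = jacobi_moment a b (\<lambda>x. of_real (jacobi_P a b k x)) k"
  unfolding jacobi_h_def jacobi_moment_def weight_integral_def
  by (simp flip: set_integral_complex_of_real add: power2_eq_square)

lemma jacobi_P_has_vector_derivative:
  assumes "a > -1"
  shows "((\<lambda>x. complex_of_real (jacobi_P a b (Suc n) x)) has_vector_derivative
           of_real ((real n + a + b + 2) / 2) * of_real (jacobi_P (a + 1) (b + 1) n x)) (at x)"
  using has_vector_derivative_of_real[OF jacobi_P_has_derivative[OF assms], where 'a = complex]
  by simp

text \<open>Integration by parts applied to \<open>P_{n+1}\<close> itself.\<close>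

lemma jacobi_h_Suc:
  assumes a: "a > -1" and b: "b > -1"
  shows "jacobi_h a b (Suc n) = (real n + a + b + 2) / (4 * real (Suc n)) * jacobi_h (a + 1) (b + 1) n"
proof -
  have "complex_of_real (jacobi_h a b (Suc n))
     = jacobi_moment (a + 1) (b + 1)
         (\<lambda>x. of_real ((real n + a + b + 2) / 2) * of_real (jacobi_P (a + 1) (b + 1) n x)) n
         / of_real (2 * real (Suc n))"
    unfolding of_real_jacobi_h using a b
    by (intro jacobi_moment_Suc jacobi_P_has_vector_derivative continuous_intros) auto
  also have "\<dots> = of_real ((real n + a + b + 2) / 2) * of_real (jacobi_h (a + 1) (b + 1) n)
         / of_real (2 * real (Suc n))"
    unfolding of_real_jacobi_h jacobi_moment_def by (simp only: mult.assoc weight_integral_cmult)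
  also have "\<dots> = of_real ((real n + a + b + 2) / (4 * real (Suc n)) * jacobi_h (a + 1) (b + 1) n)"
    by (simp add: field_simps)
  finally show ?thesis by (simp only: of_real_eq_iff)
qed

lemma jacobi_h_0:
  assumes "a > -1" "b > -1"
  shows "jacobi_h a b 0 = 2 powr (a + b + 1) * Beta (b + 1) (a + 1)"
  using powr_mult_powr_integral(2)[of "-1" 1 b a] assms
  by (simp add: jacobi_h_def jacobi_P_0 jacobi_weight_def mult.commute add.commute)

text \<open>Lowering \<open>n\<close> raises both parameters, down to the Beta integral of the weight. The last
  hypothesis excludes the case \<open>n = 0\<close>, \<open>a + b = -1\<close>, in which the formula reads
  \<open>1 / (0 * Gamma 0)\<close> while the norm is finite.\<close>

lemma jacobi_h_eq:
  assumes "a > -1" "b > -1" "n > 0 \<or> a + b + 1 \<noteq> 0"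
  shows "jacobi_h a b n = 2 powr (a + b + 1) / (2 * real n + a + b + 1) *
    (Gamma (real n + a + 1) / Gamma (real n + (a + b + 1)) * (Gamma (real n + (b + 1)) / Gamma (real n + 1)))"
  using assms
proof (induction n arbitrary: a b)
  case 0
  then have "a + b + 1 \<notin> \<int>\<^sub>\<le>\<^sub>0"
  proof -
    have "a + b + 1 \<noteq> - real m" for m
      using 0 by (cases m) auto
    then show ?thesis by (auto elim!: nonpos_Ints_cases')
  qed
  then have "Gamma (a + b + 1 + 1) = (a + b + 1) * Gamma (a + b + 1)"
    by (rule Gamma_plus1)
  then have G: "Gamma (b + 1 + (a + 1)) = (a + b + 1) * Gamma (a + b + 1)"
    by (simp add: algebra_simps)
  show ?case using 0 unfolding jacobi_h_0[OF 0(1,2)] Beta_def G by simp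
next
  case (Suc n)
  have g: "Gamma (real n + (a + b + 3)) = (real n + a + b + 2) * Gamma (real n + (a + b + 2))"
    using Gamma_plus1_pos[of "real n + a + b + 2"] Suc by (simp add: algebra_simps)
  have f: "Gamma (real n + 2) = real (Suc n) * Gamma (real n + 1)"
    using Gamma_plus1_pos[of "real n + 1"] by (simp add: algebra_simps)
  have nz: "real n + a + b + 2 \<noteq> 0" "real (Suc n) \<noteq> 0" "2 * real n + a + b + 3 \<noteq> 0" using Suc by auto
  have p: "2 powr (a + b + 3) = 4 * 2 powr (a + b + 1)"
    using powr_add[of 2 "a + b + 1" 2] by (simp add: algebra_simps)
  have "jacobi_h a b (Suc n) = (real n + a + b + 2) / (4 * real (Suc n)) *
     (2 powr (a + b + 3) / (2 * real n + a + b + 3) *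
       (Gamma (real n + a + 2) / Gamma (real n + (a + b + 3)) * (Gamma (real n + (b + 2)) / Gamma (real n + 1))))"
    unfolding jacobi_h_Suc[OF Suc.prems(1,2)]
    by (subst Suc.IH) (use Suc.prems in \<open>simp_all add: algebra_simps\<close>)
  also have "\<dots> = 2 powr (a + b + 1) / (2 * real n + a + b + 3) *
       (Gamma (real n + a + 2) / Gamma (real n + (a + b + 2)) * (Gamma (real n + (b + 2)) / Gamma (real n + 2)))"
  proof -
    have "c / (4 * N) * (4 * p / D * (A / (c * G) * (B / H))) = p / D * (A / G * (B / (N * H)))"
      if "c \<noteq> 0" for c N p D A G B H :: real
      using that by simp
    from this[OF nz(1)] show ?thesis unfolding g f p .
  qed
  finally show ?case by (simp add: algebra_simps)
qed

lemma jacobi_h_pos: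
  assumes "a > -1" "b > -1"
  shows "jacobi_h a b n > 0"
proof (cases n)
  case 0
  then show ?thesis using assms by (simp add: jacobi_h_0 Beta_def)
next
  case (Suc k)
  then have "real n + a > 0" "real n + a + b + 1 > 0" "2 * real n + a + b + 1 > 0" using assms by auto
  then show ?thesis
    using assms Suc by (subst jacobi_h_eq) (auto intro!: mult_pos_pos divide_pos_pos)
qed

lemma decays_linear_leading:
  "decays 0 (\<lambda>n. (c * real n + d) - c * real n)"
  using decays_const[of d] by simp

text \<open>The two Gamma quotients have orders \<open>n powr b\<close> and \<open>n powr (-b)\<close>, which cancel.\<close>

lemma jacobi_h_inverse_leading:
  assumes "a > -1" "b > -1"
  shows "decays 0 (\<lambda>n. 1 / jacobi_h a b n - real n / 2 powr (a + b))"
proof -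
  have A: "decays (b + (-b) - 1) (\<lambda>n.
      Gamma (real n + (a + b + 1)) / Gamma (real n + (a + 1)) * (Gamma (real n + 1) / Gamma (real n + (b + 1)))
      - real n powr b * real n powr (- b))"
    using decays_powr[of b] decays_powr[of "-b"]
      Gamma_ratio_leading[of "a + b + 1" "a + 1"] Gamma_ratio_leading[of 1 "b + 1"]
    by (intro decays_mult_leading) (simp_all add: algebra_simps)
  have "decays (-1) (\<lambda>n.
      Gamma (real n + (a + b + 1)) / Gamma (real n + (a + 1)) * (Gamma (real n + 1) / Gamma (real n + (b + 1))) - 1)"
    by (rule decays_cong[OF A[simplified]], rule eventually_mono[OF eventually_gt_at_top[of 0]])
       (simp flip: powr_add)
  then have B: "decays (1 + 0 - 1) (\<lambda>n. ((1 / 2 powr (a + b)) * real n + (a + b + 1) / 2 powr (a + b + 1)) *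
      (Gamma (real n + (a + b + 1)) / Gamma (real n + (a + 1)) * (Gamma (real n + 1) / Gamma (real n + (b + 1))))
      - (1 / 2 powr (a + b)) * real n * 1)"
  proof (intro decays_mult_leading)
    show "decays 1 (\<lambda>n. 1 / 2 powr (a + b) * real n)"
    proof (rule decays_cmult)
      show "decays 1 real"
        by (rule decays_cong[OF decays_powr[of 1]]) simp
    qed
    show "decays (1 - 1) (\<lambda>n. ((1 / 2 powr (a + b)) * real n + (a + b + 1) / 2 powr (a + b + 1)) - (1 / 2 powr (a + b)) * real n)"
      using decays_linear_leading by simp
  qed (auto intro: decays_const)
  show ?thesis
  proof (rule decays_cong[OF B[simplified]], rule eventually_mono[OF eventually_gt_at_top[of 0]])
    fix n :: nat assume n: "0 < n"
    have p: "2 powr (a + b + 1) = 2 * 2 powr (a + b)" by (simp add: powr_add)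
    have q: "real n / 2 powr (a + b) + (a + b + 1) / 2 powr (a + b + 1)
        = (2 * real n + a + b + 1) / 2 powr (a + b + 1)"
      unfolding p by (simp add: field_simps)
    have "1 / jacobi_h a b n = (2 * real n + a + b + 1) / 2 powr (a + b + 1) *
       (Gamma (real n + (a + b + 1)) / Gamma (real n + (a + 1)) *
         (Gamma (real n + 1) / Gamma (real n + (b + 1))))"
      using assms n by (subst jacobi_h_eq) (auto simp: add.assoc)
    then show "1 / jacobi_h a b n - real n / 2 powr (a + b) =
       (real n / 2 powr (a + b) + (a + b + 1) / 2 powr (a + b + 1)) *
       (Gamma (real n + (a + b + 1)) * Gamma (real n + 1)) /
       (Gamma (real n + (a + 1)) * Gamma (real n + (b + 1))) - real n / 2 powr (a + b)"
      unfolding q by simp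
  qed
qed

lemma decays_inverse_jacobi_h:
  assumes "a > -1" "b > -1"
  shows "decays 1 (\<lambda>n. 1 / jacobi_h a b n)"
proof (rule decays_leading_imp)
  have "decays 1 real"
    by (rule decays_cong[OF decays_powr[of 1]]) simp
  from decays_cmult[OF this, of "1 / 2 powr (a + b)"]
  show "decays 1 (\<lambda>n. real n / 2 powr (a + b))" by simp
qed (use jacobi_h_inverse_leading[OF assms] in simp)

lemma decays_jacobi_h:
  assumes "a > -1" "b > -1"
  shows "decays (-1) (jacobi_h a b)"
proof -
  have "(\<lambda>n. 1 / jacobi_h a b n / real n - 1 / 2 powr (a + b)) \<longlonglongrightarrow> 0"
  proof (rule decays_neg_tendsto)
    have "decays (0 + (-1)) (\<lambda>n. (1 / jacobi_h a b n - real n / 2 powr (a + b)) * real n powr (-1))"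
      by (intro decays_mult jacobi_h_inverse_leading assms decays_powr)
    then show "decays (-1) (\<lambda>n. 1 / jacobi_h a b n / real n - 1 / 2 powr (a + b))"
      using decays_cong[where f = "\<lambda>n. 1 / jacobi_h a b n / real n - 1 / 2 powr (a + b)"]
      by (rule_tac decays_cong[where g = "\<lambda>n. (1 / jacobi_h a b n - real n / 2 powr (a + b)) * real n powr (-1)"],
          simp, intro eventually_mono[OF eventually_gt_at_top[of 0]])
         (simp add: powr_minus_divide diff_divide_distrib)
  qed simp
  then have "(\<lambda>n. 1 / jacobi_h a b n / real n) \<longlonglongrightarrow> 1 / 2 powr (a + b)"
    using LIM_zero_iff by blast
  then have "eventually (\<lambda>n. 1 / jacobi_h a b n / real n > 1 / (2 * 2 powr (a + b))) sequentially"
    by (rule order_tendstoD) (simp add: divide_strict_left_mono)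
  then have "eventually (\<lambda>n. norm (jacobi_h a b n) \<le> (2 * 2 powr (a + b)) * real n powr (-1)) sequentially"
    using eventually_gt_at_top[of 0]
  proof eventually_elim
    case (elim n)
    then show ?case
      using jacobi_h_pos[OF assms, of n] by (simp add: powr_minus_divide field_simps)
  qed
  then show ?thesis by (rule decaysI)
qed

section \<open>Orthogonality and the Christoffel--Darboux formula\<close>

text \<open>Each integration by parts differentiates the polynomial and lowers the index, so the
  polynomial is exhausted first.\<close>

lemma jacobi_moment_low_degree:
  assumes "a > -1" "b > -1" "degree q < k"
  shows "jacobi_moment a b (\<lambda>x. of_real (poly q x)) k = 0"
  using assms
proof (induction k arbitrary: a b q)
  case 0
  then show ?case by simp
next
  case (Suc k)
  have "jacobi_moment a b (\<lambda>x. of_real (poly q x)) (Suc k)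
      = jacobi_moment (a + 1) (b + 1) (\<lambda>x. of_real (poly (pderiv q) x)) k / of_real (2 * real (Suc k))"
    using Suc.prems
    by (intro jacobi_moment_Suc has_vector_derivative_of_real poly_DERIV continuous_intros) auto
  also have "jacobi_moment (a + 1) (b + 1) (\<lambda>x. of_real (poly (pderiv q) x)) k = 0"
  proof (cases "degree q = 0")
    case True
    then have "pderiv q = 0" by (simp add: pderiv_eq_0_iff)
    then show ?thesis by (simp add: jacobi_moment_def weight_integral_def)
  next
    case False
    then show ?thesis
      using Suc.prems by (intro Suc.IH) (auto simp: degree_pderiv)
  qed
  finally show ?case by simp
qed

definition jacobi_functional :: "real \<Rightarrow> real \<Rightarrow> real poly \<Rightarrow> real" where
  "jacobi_functional a b p = (LBINT x:{-1..1}. poly p x * jacobi_weight a b x)"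

text \<open>The matrix entry of multiplication by \<open>x\<close> between consecutive Jacobi polynomials.\<close>

definition jacobi_cross :: "real \<Rightarrow> real \<Rightarrow> nat \<Rightarrow> real" where
  "jacobi_cross a b k = jacobi_functional a b ([:0, 1:] * jacobi_poly a b k * jacobi_poly a b (Suc k))"

definition jacobi_cd_factor :: "real \<Rightarrow> real \<Rightarrow> nat \<Rightarrow> real" where
  "jacobi_cd_factor a b n = jacobi_cross a b n / (jacobi_h a b n * jacobi_h a b (Suc n))"

locale jacobi_params =
  fixes a b :: real
  assumes a: "a > -1" and b: "b > -1"
begin

abbreviation (input) "L \<equiv> jacobi_functional a b"
abbreviation (input) "P \<equiv> jacobi_poly a b"
abbreviation (input) "h \<equiv> jacobi_h a b"
abbreviation (input) "M \<equiv> jacobi_cross a b"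

lemma jacobi_functional_integrable:
  "set_integrable lborel {-1..1} (\<lambda>x. poly p x * jacobi_weight a b x)"
proof -
  have "weight_integrable a b (\<lambda>x. of_real (poly p x))"
    by (intro weight_integrable_continuous a b continuous_intros)
  then have "set_integrable lborel {-1..1} (\<lambda>x. Re (of_real (poly p x) * of_real (jacobi_weight a b x)))"
    unfolding weight_integrable_def set_integrable_def by (auto dest: integrable_Re)
  then show ?thesis by simp
qed

lemma jacobi_functional_linear:
  "L (p + q) = L p + L q" "L (smult c p) = c * L p"
  "finite A \<Longrightarrow> L (\<Sum>i\<in>A. f i) = (\<Sum>i\<in>A. L (f i))"
proof -
  show add: "L (p + q) = L p + L q" for p q
    unfolding jacobi_functional_def
    by (subst set_integral_add(2)[symmetric])
       (auto simp: jacobi_functional_integrable distrib_right)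
  show "L (smult c p) = c * L p"
    unfolding jacobi_functional_def by (simp add: mult.assoc)
  have "L 0 = 0" by (simp add: jacobi_functional_def)
  note L0 = this
  show "L (\<Sum>i\<in>A. f i) = (\<Sum>i\<in>A. L (f i))" if "finite A"
    using that by (induction A rule: finite_induct) (auto simp: add L0)
qed

lemma of_real_jacobi_functional:
  "complex_of_real (L (q * P k)) = jacobi_moment a b (\<lambda>x. of_real (poly q x)) k"
  unfolding jacobi_functional_def jacobi_moment_def weight_integral_def
  by (simp flip: set_integral_complex_of_real add: poly_jacobi_poly[OF a])

lemma jacobi_orthogonal: "degree q < k \<Longrightarrow> L (q * P k) = 0"
  using of_real_jacobi_functional[of q k] jacobi_moment_low_degree[OF a b, of q k] by simp

lemma jacobi_orthogonal': "i \<noteq> j \<Longrightarrow> L (P i * P j) = 0"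
  using jacobi_orthogonal[of "P i" j] jacobi_orthogonal[of "P j" i] degree_jacobi_poly[OF a b]
  by (cases "i < j") (auto simp: mult.commute)

lemma jacobi_functional_square: "L (P k * P k) = h k"
  by (simp add: jacobi_functional_def jacobi_h_def poly_jacobi_poly[OF a] power2_eq_square)

lemma jacobi_poly_spanning:
  "degree q \<le> n \<Longrightarrow> \<exists>c. q = (\<Sum>k\<le>n. smult (c k) (P k))"
proof (induction n arbitrary: q)
  case 0
  then obtain d where d: "q = [:d:]" by (auto elim: degree_eq_zeroE)
  obtain e where e: "P 0 = [:e:]" using degree_jacobi_poly[OF a b, of 0] by (auto elim: degree_eq_zeroE)
  have "e \<noteq> 0" using coeff_jacobi_poly_ne_0[OF a b, of 0] e by simp
  then show ?case by (intro exI[of _ "\<lambda>_. d / e"]) (simp add: d e)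
next
  case (Suc n)
  let ?r = "coeff q (Suc n) / coeff (P (Suc n)) (Suc n)"
  have "coeff (q - smult ?r (P (Suc n))) (Suc n) = 0"
    using coeff_jacobi_poly_ne_0[OF a b, of "Suc n"] by simp
  moreover have "degree (q - smult ?r (P (Suc n))) \<le> Suc n"
    using Suc.prems degree_jacobi_poly[OF a b, of "Suc n"]
    by (intro degree_diff_le order.trans[OF degree_smult_le]) auto
  ultimately have "degree (q - smult ?r (P (Suc n))) \<le> n"
    by (metis degree_0 le_SucE leading_coeff_0_iff le0)
  from Suc.IH[OF this] obtain c where "q - smult ?r (P (Suc n)) = (\<Sum>k\<le>n. smult (c k) (P k))" by blast
  then have "q = (\<Sum>k\<le>n. smult (c k) (P k)) + smult ?r (P (Suc n))" by (simp add: algebra_simps)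
  also have "\<dots> = (\<Sum>k\<le>Suc n. smult ((c(Suc n := ?r)) k) (P k))"
    by simp
  finally show ?case by blast
qed

lemma jacobi_poly_expansion:
  assumes "degree q \<le> n"
  shows "q = (\<Sum>k\<le>n. smult (L (q * P k) / h k) (P k))"
proof -
  obtain c where c: "q = (\<Sum>k\<le>n. smult (c k) (P k))" using jacobi_poly_spanning[OF assms] by blast
  have "L (q * P j) = c j * h j" if "j \<le> n" for j
  proof -
    have "L (q * P j) = (\<Sum>k\<le>n. c k * L (P k * P j))"
      unfolding c by (simp add: sum_distrib_right jacobi_functional_linear)
    also have "\<dots> = (\<Sum>k\<in>{j}. c k * L (P k * P j))"
      by (rule sum.mono_neutral_right) (use that jacobi_orthogonal' in auto)
    finally show ?thesis by (simp add: jacobi_functional_square)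
  qed
  then have "L (q * P j) / h j = c j" if "j \<le> n" for j
    using that jacobi_h_pos[OF a b, of j] by simp
  then have "(\<Sum>k\<le>n. smult (L (q * P k) / h k) (P k)) = (\<Sum>k\<le>n. smult (c k) (P k))"
    by (intro sum.cong) auto
  with c show ?thesis by simp
qed

text \<open>The outer recurrence coefficients come from one and the same number \<open>M k\<close>, because
  multiplication by \<open>x\<close> is symmetric for the inner product. This is why the Christoffel--Darboux
  sum telescopes.\<close>

lemma jacobi_recurrence_0:
  "\<exists>B. [:0, 1:] * P 0 = smult (M 0 / h 1) (P 1) + smult B (P 0)"
proof -
  have "degree ([:0, 1:] * P 0) \<le> 1"
    using degree_mult_le[of "[:0, 1::real:]" "P 0"] degree_jacobi_poly[OF a b, of 0] by simp
  then have "[:0, 1:] * P 0 = (\<Sum>k\<le>1. smult (L ([:0, 1:] * P 0 * P k) / h k) (P k))"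
    by (rule jacobi_poly_expansion)
  also have "\<dots> = smult (M 0 / h 1) (P 1) + smult (L ([:0, 1:] * P 0 * P 0) / h 0) (P 0)"
    unfolding One_nat_def sum.atMost_Suc jacobi_cross_def
    by (simp only: atMost_0 sum.insert[OF finite.emptyI] sum.empty empty_iff not_False_eq_True
        add_0_right add.commute)
  finally show ?thesis by blast
qed

lemma jacobi_recurrence_Suc:
  "\<exists>B. [:0, 1:] * P (Suc k) = smult (M (Suc k) / h (Suc (Suc k))) (P (Suc (Suc k)))
        + smult B (P (Suc k)) + smult (M k / h k) (P k)"
proof -
  let ?q = "[:0, 1:] * P (Suc k)"
  have "degree ?q \<le> Suc (Suc k)"
    using degree_mult_le[of "[:0, 1::real:]" "P (Suc k)"] degree_jacobi_poly[OF a b, of "Suc k"] by simp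
  then have "?q = (\<Sum>j\<le>Suc (Suc k). smult (L (?q * P j) / h j) (P j))"
    by (rule jacobi_poly_expansion)
  also have "\<dots> = (\<Sum>j\<in>{k, Suc k, Suc (Suc k)}. smult (L (?q * P j) / h j) (P j))"
  proof (rule sum.mono_neutral_right)
    show "\<forall>i\<in>{..Suc (Suc k)} - {k, Suc k, Suc (Suc k)}. smult (L (?q * P i) / h i) (P i) = 0"
    proof
      fix i assume "i \<in> {..Suc (Suc k)} - {k, Suc k, Suc (Suc k)}"
      then have i: "i < k" by auto
      have "degree ([:0, 1:] * P i) < Suc k"
        using degree_mult_le[of "[:0, 1::real:]" "P i"] degree_jacobi_poly[OF a b, of i] i by simp
      then have "L (([:0, 1:] * P i) * P (Suc k)) = 0" by (rule jacobi_orthogonal)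
      then have "L (?q * P i) = 0" by (simp only: ac_simps)
      then show "smult (L (?q * P i) / h i) (P i) = 0" by simp
    qed
  qed auto
  also have "\<dots> = smult (L (?q * P k) / h k) (P k) + (smult (L (?q * P (Suc k)) / h (Suc k)) (P (Suc k))
      + smult (L (?q * P (Suc (Suc k))) / h (Suc (Suc k))) (P (Suc (Suc k))))"
    by simp
  also have "L (?q * P (Suc (Suc k))) = M (Suc k)" by (simp add: jacobi_cross_def)
  also have "L (?q * P k) = M k" by (simp only: jacobi_cross_def ac_simps)
  also have "smult (M k / h k) (P k) + (smult (L (?q * P (Suc k)) / h (Suc k)) (P (Suc k))
        + smult (M (Suc k) / h (Suc (Suc k))) (P (Suc (Suc k))))
      = smult (M (Suc k) / h (Suc (Suc k))) (P (Suc (Suc k)))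
        + smult (L (?q * P (Suc k)) / h (Suc k)) (P (Suc k)) + smult (M k / h k) (P k)"
    by (simp only: ac_simps)
  finally show ?thesis by blast
qed

lemma christoffel_darboux:
  "(x - y) * (\<Sum>k\<le>n. poly (P k) x * poly (P k) y / h k)
     = jacobi_cd_factor a b n * (poly (P (Suc n)) x * poly (P n) y - poly (P n) x * poly (P (Suc n)) y)"
proof (induction n)
  case 0
  have hp: "h 0 \<noteq> 0" "h 1 \<noteq> 0" using jacobi_h_pos[OF a b] by (metis less_irrefl)+
  obtain B where "[:0, 1:] * P 0 = smult (M 0 / h 1) (P 1) + smult B (P 0)"
    using jacobi_recurrence_0 by blast
  then have "poly ([:0, 1:] * P 0) z = poly (smult (M 0 / h 1) (P 1) + smult B (P 0)) z" for z
    by simp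
  then have r: "z * poly (P 0) z = M 0 / h 1 * poly (P 1) z + B * poly (P 0) z" for z
    by simp
  have "(x - y) * (poly (P 0) x * poly (P 0) y) = (x * poly (P 0) x) * poly (P 0) y - poly (P 0) x * (y * poly (P 0) y)"
    by (simp add: algebra_simps)
  also have "\<dots> = M 0 / h 1 * (poly (P 1) x * poly (P 0) y - poly (P 0) x * poly (P 1) y)"
    unfolding r by (simp add: algebra_simps)
  finally have *: "(x - y) * (poly (P 0) x * poly (P 0) y)
      = M 0 / h 1 * (poly (P 1) x * poly (P 0) y - poly (P 0) x * poly (P 1) y)" .
  show ?case using arg_cong[OF *, of "\<lambda>r. r / h 0"] by (simp add: jacobi_cd_factor_def)
next
  case (Suc n)
  have hp: "h k \<noteq> 0" for k using jacobi_h_pos[OF a b, of k] by simp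
  obtain B where "[:0, 1:] * P (Suc n) = smult (M (Suc n) / h (Suc (Suc n))) (P (Suc (Suc n)))
        + smult B (P (Suc n)) + smult (M n / h n) (P n)"
    using jacobi_recurrence_Suc by blast
  then have "poly ([:0, 1:] * P (Suc n)) z = poly (smult (M (Suc n) / h (Suc (Suc n))) (P (Suc (Suc n)))
        + smult B (P (Suc n)) + smult (M n / h n) (P n)) z" for z by simp
  then have r: "z * poly (P (Suc n)) z = M (Suc n) / h (Suc (Suc n)) * poly (P (Suc (Suc n))) z
      + B * poly (P (Suc n)) z + M n / h n * poly (P n) z" for z
    by simp
  have "(x - y) * (poly (P (Suc n)) x * poly (P (Suc n)) y)
      = (x * poly (P (Suc n)) x) * poly (P (Suc n)) y - poly (P (Suc n)) x * (y * poly (P (Suc n)) y)"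
    by (simp add: algebra_simps)
  also have "\<dots> = M (Suc n) / h (Suc (Suc n)) *
        (poly (P (Suc (Suc n))) x * poly (P (Suc n)) y - poly (P (Suc n)) x * poly (P (Suc (Suc n))) y)
      - M n / h n * (poly (P (Suc n)) x * poly (P n) y - poly (P n) x * poly (P (Suc n)) y)"
    unfolding r by (simp add: algebra_simps)
  finally have "(x - y) * (poly (P (Suc n)) x * poly (P (Suc n)) y / h (Suc n))
      = jacobi_cd_factor a b (Suc n) *
        (poly (P (Suc (Suc n))) x * poly (P (Suc n)) y - poly (P (Suc n)) x * poly (P (Suc (Suc n))) y)
      - jacobi_cd_factor a b n * (poly (P (Suc n)) x * poly (P n) y - poly (P n) x * poly (P (Suc n)) y)"
    using hp by (simp add: jacobi_cd_factor_def diff_divide_distrib)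
  then show ?case using Suc by (simp add: distrib_left)
qed

text \<open>On the interval \<open>\<bar>x P_n P_{n+1}\<bar>\<close> is at most half the sum of the two squares. Hence the
  factor is bounded by \<open>1 / h\<close> at \<open>n\<close> and \<open>n + 1\<close>, which has order \<open>1\<close>.\<close>

lemma decays_jacobi_cd_factor: "decays 1 (jacobi_cd_factor a b)"
proof -
  have M: "\<bar>M n\<bar> \<le> (h n + h (Suc n)) / 2" for n
  proof -
    have w: "jacobi_weight a b x \<ge> 0" for x by (simp add: jacobi_weight_def)
    let ?s = "smult (1/2) (P n * P n + P (Suc n) * P (Suc n))" and ?m = "[:0, 1:] * P n * P (Suc n)"
    have b1: "\<bar>poly ?m x\<bar> \<le> poly ?s x" if "x \<in> {-1..1}" for x
    proof -
      have "\<bar>poly ?m x\<bar> = \<bar>x\<bar> * (\<bar>poly (P n) x\<bar> * \<bar>poly (P (Suc n)) x\<bar>)" by (simp add: abs_mult)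
      also have "\<dots> \<le> 1 * (\<bar>poly (P n) x\<bar> * \<bar>poly (P (Suc n)) x\<bar>)"
        using that by (intro mult_right_mono) auto
      also have "\<dots> \<le> poly ?s x"
        using sum_squares_bound[of "\<bar>poly (P n) x\<bar>" "\<bar>poly (P (Suc n)) x\<bar>"]
        by (simp add: power2_eq_square)
      finally show ?thesis .
    qed
    have ls: "L ?s = (h n + h (Suc n)) / 2"
      by (simp add: jacobi_functional_linear jacobi_functional_square)
    have "L ?m \<le> L ?s" unfolding jacobi_functional_def
      by (intro set_integral_mono jacobi_functional_integrable mult_right_mono w)
         (use b1 abs_le_D1 in blast)
    moreover have "L (smult (-1) ?m) \<le> L ?s" unfolding jacobi_functional_def
    proof (intro set_integral_mono jacobi_functional_integrable mult_right_mono w)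
      fix x :: real assume "x \<in> {-1..1}"
      from b1[OF this] show "poly (smult (-1) ?m) x \<le> poly ?s x" by (simp del: mult_pCons_left)
    qed
    moreover have "L (smult (-1) ?m) = - L ?m"
      unfolding jacobi_functional_linear by simp
    ultimately show ?thesis
      unfolding ls jacobi_cross_def abs_le_iff by simp
  qed
  have "decays 1 (\<lambda>n. 1 / h n + 1 / h (Suc n))"
    using decays_inverse_jacobi_h[OF a b] decays_shift_up[OF decays_inverse_jacobi_h[OF a b], of 1]
    by (intro decays_add) auto
  then show ?thesis
  proof (rule decays_dominated, intro always_eventually allI)
    fix n
    have hp: "h n > 0" "h (Suc n) > 0" using jacobi_h_pos[OF a b] by auto
    have "norm (jacobi_cd_factor a b n) = \<bar>M n\<bar> / (h n * h (Suc n))"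
      using hp by (simp add: jacobi_cd_factor_def abs_mult)
    also have "\<dots> \<le> (h n + h (Suc n)) / (h n * h (Suc n))"
      using hp M[of n] by (intro divide_right_mono) auto
    also have "\<dots> = 1 / h n + 1 / h (Suc n)" using hp by (simp add: field_simps)
    finally show "norm (jacobi_cd_factor a b n) \<le> norm (1 / h n + 1 / h (Suc n))" by simp
  qed
qed

end

lemmas jacobi_functional_integrable = jacobi_params.jacobi_functional_integrable[OF jacobi_params.intro]
lemmas jacobi_functional_linear = jacobi_params.jacobi_functional_linear[OF jacobi_params.intro]
lemmas jacobi_functional_square = jacobi_params.jacobi_functional_square[OF jacobi_params.intro]
lemmas christoffel_darboux = jacobi_params.christoffel_darboux[OF jacobi_params.intro]
lemmas decays_jacobi_cd_factor = jacobi_params.decays_jacobi_cd_factor[OF jacobi_params.intro]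

text \<open>The projection reproduces constants, so \<open>c - S_n(x)\<close> is minus the integral of \<open>f - c\<close>
  against the kernel. The factor \<open>y - x\<close> of \<open>f - c\<close> cancels the denominator of the
  Christoffel--Darboux kernel, and two moments remain. The identity is exact for each \<open>n\<close>, which
  reduces pointwise convergence to decay of moments.\<close>

lemma jacobi_remainder_via_quotient:
  assumes a: "a > -1" and b: "b > -1"
    and f: "weight_integrable a b f" and q: "weight_integrable a b q"
    and quot: "\<And>y. y \<in> {-1..1} \<Longrightarrow> f y - c = of_real (y - x) * q y"
  shows "c - jacobi_proj a b f n x = of_real (jacobi_cd_factor a b n) *
    (of_real (jacobi_P a b (Suc n) x) * jacobi_moment a b q n
      - of_real (jacobi_P a b n x) * jacobi_moment a b q (Suc n))"
proof -
  let ?P = "\<lambda>k y. complex_of_real (jacobi_P a b k y)" and ?h = "\<lambda>k. complex_of_real (jacobi_h a b k)"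
  let ?K = "\<lambda>y. \<Sum>k\<le>n. ?P k x / ?h k * ?P k y"
  have hp: "?h k \<noteq> 0" for k using jacobi_h_pos[OF a b, of k] by simp
  have fP: "weight_integrable a b (\<lambda>y. f y * ?P k y)" for k
    by (intro weight_integrable_mult f continuous_intros a)
  have qP: "weight_integrable a b (\<lambda>y. q y * ?P k y)" for k
    by (intro weight_integrable_mult q continuous_intros a)
  have cP: "weight_integrable a b (\<lambda>y. c * ?P k y)" for k
    by (intro weight_integrable_cmult weight_integrable_continuous a b continuous_intros)
  have proj: "jacobi_proj a b g n x = weight_integral a b (\<lambda>y. g y * ?K y)"
    and projint: "weight_integrable a b (\<lambda>y. g y * ?K y)"
    if gP: "\<And>k. weight_integrable a b (\<lambda>y. g y * ?P k y)" for g
  proof -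
    have gP': "weight_integrable a b (\<lambda>y. ?P k x / ?h k * (g y * ?P k y))" for k
      by (rule weight_integrable_cmult[OF gP])
    have eq: "(\<lambda>y. g y * ?K y) = (\<lambda>y. \<Sum>k\<le>n. ?P k x / ?h k * (g y * ?P k y))"
      by (simp add: sum_distrib_left mult_ac fun_eq_iff)
    show "weight_integrable a b (\<lambda>y. g y * ?K y)"
      unfolding eq by (rule weight_integral_sum(2)) (use gP' in auto)
    show "jacobi_proj a b g n x = weight_integral a b (\<lambda>y. g y * ?K y)"
    proof -
      have "weight_integral a b (\<lambda>y. g y * ?K y)
          = (\<Sum>k\<le>n. weight_integral a b (\<lambda>y. ?P k x / ?h k * (g y * ?P k y)))"
        unfolding eq by (rule weight_integral_sum(1)) (use gP' in auto)
      then show ?thesis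
        unfolding weight_integral_cmult jacobi_proj_def jacobi_coeff_eq_moment jacobi_moment_def
          atMost_atLeast0 by (simp add: mult.commute)
    qed
  qed
  have const: "jacobi_proj a b (\<lambda>_. c) n x = c"
  proof -
    have "jacobi_moment a b (\<lambda>_. c) k = (if k = 0 then c * ?h 0 else 0)" for k
    proof -
      have "jacobi_moment a b (\<lambda>_. c) k = c * jacobi_moment a b (\<lambda>_. 1) k"
        unfolding jacobi_moment_def by (simp add: weight_integral_cmult)
      moreover have "jacobi_moment a b (\<lambda>_. 1) k = (if k = 0 then ?h 0 else 0)"
        using jacobi_moment_low_degree[OF a b, of 1 k] of_real_jacobi_h[of a b 0] a
        by (auto simp: jacobi_P_0)
      ultimately show ?thesis by simp
    qed
    then have "jacobi_proj a b (\<lambda>_. c) n x = (\<Sum>k=0..n. if k = 0 then c else 0)"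
      unfolding jacobi_proj_def jacobi_coeff_eq_moment
      using hp a by (intro sum.cong) (auto simp: jacobi_P_0)
    then show ?thesis by simp
  qed
  have ker: "(of_real (y - x) * q y) * ?K y = of_real (jacobi_cd_factor a b n) *
      (?P n x * (q y * ?P (Suc n) y) - ?P (Suc n) x * (q y * ?P n y))" for y
  proof -
    have "(x - y) * (\<Sum>k\<le>n. jacobi_P a b k x * jacobi_P a b k y / jacobi_h a b k)
       = jacobi_cd_factor a b n *
         (jacobi_P a b (Suc n) x * jacobi_P a b n y - jacobi_P a b n x * jacobi_P a b (Suc n) y)"
      using christoffel_darboux[OF a b, of x y n] by (simp add: poly_jacobi_poly[OF a])
    from arg_cong[OF this, of complex_of_real]
    have "of_real (x - y) * ?K y = of_real (jacobi_cd_factor a b n) *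
         (?P (Suc n) x * ?P n y - ?P n x * ?P (Suc n) y)" by simp
    then have "q y * (of_real (x - y) * ?K y) = q y * (of_real (jacobi_cd_factor a b n) *
         (?P (Suc n) x * ?P n y - ?P n x * ?P (Suc n) y))" by (rule arg_cong)
    moreover have "(of_real (y - x) * q y) * ?K y = - (q y * (of_real (x - y) * ?K y))"
      by (simp add: algebra_simps)
    ultimately show ?thesis by (simp add: algebra_simps)
  qed
  have "jacobi_proj a b f n x - c = weight_integral a b (\<lambda>y. f y * ?K y) - weight_integral a b (\<lambda>y. c * ?K y)"
    using proj[OF fP] proj[OF cP] const by simp
  also have "\<dots> = weight_integral a b (\<lambda>y. f y * ?K y - c * ?K y)"
    by (rule weight_integral_diff[symmetric]) (use projint[OF fP] projint[OF cP] in auto)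
  also have "\<dots> = weight_integral a b (\<lambda>y. of_real (jacobi_cd_factor a b n) *
      (?P n x * (q y * ?P (Suc n) y) - ?P (Suc n) x * (q y * ?P n y)))"
    using quot by (intro weight_integral_cong) (simp only: left_diff_distrib[symmetric] ker)
  also have "\<dots> = of_real (jacobi_cd_factor a b n) *
      (?P n x * jacobi_moment a b q (Suc n) - ?P (Suc n) x * jacobi_moment a b q n)"
    unfolding jacobi_moment_def weight_integral_cmult
    by (subst weight_integral_diff) (use qP in \<open>auto simp: weight_integral_cmult intro!: weight_integrable_cmult\<close>)
  finally have *: "jacobi_proj a b f n x - c = of_real (jacobi_cd_factor a b n) *
      (?P n x * jacobi_moment a b q (Suc n) - ?P (Suc n) x * jacobi_moment a b q n)" .
  have "c - jacobi_proj a b f n x = - (jacobi_proj a b f n x - c)" by simp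
  also have "\<dots> = of_real (jacobi_cd_factor a b n) *
    (?P (Suc n) x * jacobi_moment a b q n - ?P n x * jacobi_moment a b q (Suc n))"
    unfolding * by (simp add: algebra_simps)
  finally show ?thesis .
qed

section \<open>Taylor remainders of holomorphic functions\<close>

lemma holomorphic_taylor_remainder:
  assumes U: "open U" and f: "f holomorphic_on U" and z0: "z0 \<in> U"
  shows "\<exists>c g. g holomorphic_on U \<and>
           (\<forall>z\<in>U. f z = (\<Sum>j<N. c j * (z - z0) ^ j) + (z - z0) ^ N * g z)"
proof (induction N)
  case 0
  show ?case by (intro exI[of _ "\<lambda>_. 0"] exI[of _ f]) (use f in auto)
next
  case (Suc N)
  then obtain c g where g: "g holomorphic_on U"
    and eq: "\<And>z. z \<in> U \<Longrightarrow> f z = (\<Sum>j<N. c j * (z - z0) ^ j) + (z - z0) ^ N * g z" by blast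
  define g' where "g' = (\<lambda>z. if z = z0 then deriv g z0 else (g z - g z0) / (z - z0))"
  have "g' holomorphic_on U"
    unfolding g'_def by (rule pole_lemma_open[OF g U])
  moreover have "f z = (\<Sum>j<Suc N. (c(N := g z0)) j * (z - z0) ^ j) + (z - z0) ^ Suc N * g' z" if "z \<in> U" for z
  proof -
    have "g z = g z0 + (z - z0) * g' z" by (simp add: g'_def)
    then have "f z = (\<Sum>j<N. c j * (z - z0) ^ j) + (z - z0) ^ N * (g z0 + (z - z0) * g' z)"
      using eq[OF that] by simp
    then show ?thesis by (simp add: algebra_simps)
  qed
  ultimately show ?case by blast
qed

text \<open>Connects the Taylor expansion with holomorphic remainder, which is what is integrated along
  a contour, to formal power series, in which the coefficient is computed.\<close>

lemma taylor_coefficient_unique: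
  fixes f :: "complex \<Rightarrow> complex"
  assumes U: "open U" "z0 \<in> U" and g: "g holomorphic_on U"
    and eq: "\<And>z. z \<in> U \<Longrightarrow> f z = (\<Sum>j<Suc n. c j * (z - z0) ^ j) + (z - z0) ^ Suc n * g z"
    and F: "(\<lambda>w. f (z0 + w)) has_fps_expansion F"
  shows "c n = fps_nth F n"
proof -
  have "g analytic_on {z0}" using U g by (auto simp: analytic_at)
  then have G: "(\<lambda>w. g (z0 + w)) has_fps_expansion fps_expansion g z0"
    by (rule analytic_at_imp_has_fps_expansion)
  let ?G = "fps_expansion g z0"
  have "(\<lambda>w. (\<Sum>j\<in>{..<Suc n}. c j * w ^ j) + w ^ Suc n * g (z0 + w)) has_fps_expansion
      (\<Sum>j\<in>{..<Suc n}. fps_const (c j) * fps_X ^ j) + fps_X ^ Suc n * ?G"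
    by (intro fps_expansion_intros G)
  also have "?this \<longleftrightarrow> (\<lambda>w. f (z0 + w)) has_fps_expansion
      (\<Sum>j\<in>{..<Suc n}. fps_const (c j) * fps_X ^ j) + fps_X ^ Suc n * ?G"
  proof (rule has_fps_expansion_cong)
    have "eventually (\<lambda>z. z \<in> U) (nhds z0)" using U by (rule eventually_nhds_in_open)
    then have "eventually (\<lambda>w. z0 + w \<in> U) (nhds 0)"
      by (simp add: nhds_to_0'[of z0] eventually_filtermap)
    then show "eventually (\<lambda>w. (\<Sum>j\<in>{..<Suc n}. c j * w ^ j) + w ^ Suc n * g (z0 + w) = f (z0 + w)) (nhds 0)"
    proof eventually_elim
      case (elim w)
      from eq[OF this] show ?case by simp
    qed
  qed simp
  finally have "F = (\<Sum>j\<in>{..<Suc n}. fps_const (c j) * fps_X ^ j) + fps_X ^ Suc n * ?G"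
    using F by (intro fps_expansion_unique_complex)
  then have "fps_nth F n = (\<Sum>j\<in>{..<Suc n}. c j * (if n = j then 1 else 0)) + fps_nth (fps_X ^ Suc n * ?G) n"
    by (simp add: fps_sum_nth fps_X_power_nth)
  also have "fps_nth (fps_X ^ Suc n * ?G) n = 0"
    by (simp only: fps_X_power_mult_nth) simp
  also have "(\<Sum>j\<in>{..<Suc n}. c j * (if n = j then 1 else 0)) = c n"
    by (subst sum.mono_neutral_right[of _ "{n}"]) auto
  finally show ?thesis by simp
qed

section \<open>A contour integral for Jacobi polynomials\<close>

lemma contour_integral_linepath_horizontal:
  assumes "u1 < u2"
  shows "contour_integral (linepath (Complex u1 y) (Complex u2 y)) f = integral {u1..u2} (\<lambda>u. f (Complex u y))"
proof -
  have "linepath (Complex u1 y) (Complex u2 y) x = linepath (of_real u1) (of_real u2) x + Complex 0 y" for x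
    by (simp add: linepath_def complex_eq_iff algebra_simps)
  moreover have "Complex u2 y - Complex u1 y = of_real u2 - of_real u1"
    by (simp add: complex_eq_iff)
  ultimately have "contour_integral (linepath (Complex u1 y) (Complex u2 y)) f
      = contour_integral (linepath (of_real u1) (of_real u2)) (\<lambda>z. f (z + Complex 0 y))"
    unfolding contour_integral_integral vector_derivative_linepath_at by (simp add: o_def)
  also have "\<dots> = integral {u1..u2} (\<lambda>u. f (of_real u + Complex 0 y))"
    using contour_integral_linepath_Reals_eq[of "of_real u1" "of_real u2"] assms by simp
  also have "(\<lambda>u. f (of_real u + Complex 0 y)) = (\<lambda>u. f (Complex u y))"
    by (simp add: complex_eq_iff fun_eq_iff Complex_eq algebra_simps)
  finally show ?thesis .
qed

lemma half_angle_pos: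
  assumes "0 < \<theta>" "\<theta> < pi"
  shows "sin (\<theta> / 2) > 0" "cos (\<theta> / 2) > 0"
  using assms by (auto intro!: sin_gt_zero cos_gt_zero)

text \<open>With \<open>v = 1 + w\<close> the second base is \<open>1 + sin(\<theta>/2)^2 w\<close>, so this is a product of two binomial
  series in \<open>w\<close>. Unlike the classical generating function it depends on \<open>n\<close>: the Jacobi polynomial
  of degree \<open>n\<close> is its \<open>n\<close>-th coefficient only.\<close>

definition jgen :: "real \<Rightarrow> real \<Rightarrow> real \<Rightarrow> nat \<Rightarrow> complex \<Rightarrow> complex" where
  "jgen a b \<theta> n v = v powr of_real (real n + a) *
     (of_real ((cos (\<theta> / 2))\<^sup>2) + of_real ((sin (\<theta> / 2))\<^sup>2) * v) powr of_real (- (real n + a + b + 1))"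

text \<open>The exponential coordinate turns the rays from \<open>0\<close> in the \<open>v\<close>-plane into horizontal lines.
  The factor is chosen so that the saddle points \<open>v = i c / s\<close> and \<open>v = - i c / s\<close> of the \<open>n\<close>-th
  powers, with \<open>c\<close> and \<open>s\<close> the half-angle cosine and sine, sit at \<open>i \<pi> / 2\<close> and \<open>- i \<pi> / 2\<close>.\<close>

definition jpoint :: "real \<Rightarrow> complex \<Rightarrow> complex" where
  "jpoint \<theta> \<zeta> = of_real (cos (\<theta> / 2) / sin (\<theta> / 2)) * exp \<zeta>"

text \<open>The first factor is \<open>dv / d\<zeta>\<close>.\<close>

definition jintegrand :: "real \<Rightarrow> real \<Rightarrow> real \<Rightarrow> nat \<Rightarrow> complex \<Rightarrow> complex" where
  "jintegrand a b \<theta> n \<zeta> = jpoint \<theta> \<zeta> * jgen a b \<theta> n (jpoint \<theta> \<zeta>) / (jpoint \<theta> \<zeta> - 1) ^ Suc n"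

text \<open>The point of the strip at which \<open>v = 1\<close>, the pole of the integrand.\<close>

definition jzero :: "real \<Rightarrow> complex" where
  "jzero \<theta> = of_real (- ln (cos (\<theta> / 2) / sin (\<theta> / 2)))"

definition jrect :: "real \<Rightarrow> real \<Rightarrow> complex" where
  "jrect U = rectpath (Complex (- U) (- pi / 2)) (Complex U (pi / 2))"

locale jacobi_contour =
  fixes a b \<theta> :: real and n :: nat
  assumes a: "a > -1" and nb: "real n + b + 1 > 0" and \<theta>: "0 < \<theta>" "\<theta> < pi"
begin

abbreviation (input) "s \<equiv> sin (\<theta> / 2)"
abbreviation (input) "c \<equiv> cos (\<theta> / 2)"
abbreviation (input) "A \<equiv> real n + a"
abbreviation (input) "B \<equiv> - (real n + a + b + 1)"

lemmas sc_pos = half_angle_pos[OF \<theta>]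

lemma jgen_holomorphic: "jgen a b \<theta> n holomorphic_on (- \<real>\<^sub>\<le>\<^sub>0)"
proof -
  have "of_real (c\<^sup>2) + of_real (s\<^sup>2) * v \<notin> \<real>\<^sub>\<le>\<^sub>0" if "v \<notin> \<real>\<^sub>\<le>\<^sub>0" for v :: complex
    using that sc_pos by (auto simp: complex_nonpos_Reals_iff not_le intro!: add_pos_pos mult_pos_pos)
  then show ?thesis
    unfolding jgen_def[abs_def] by (intro holomorphic_intros) auto
qed

text \<open>The Jacobi polynomial is a Taylor coefficient at \<open>v = 1\<close>: the hypergeometric sum is the
  Cauchy product of two binomial series.\<close>

lemma jgen_coefficient:
  "\<exists>F. (\<lambda>w. jgen a b \<theta> n (1 + w)) has_fps_expansion F \<and> fps_nth F n = of_real (jacobi_P a b n (cos \<theta>))"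
proof -
  let ?S = "complex_of_real (s\<^sup>2)"
  let ?F = "(fps_binomial (of_real B) oo (fps_const ?S * fps_X)) * fps_binomial (complex_of_real A)"
  have "(\<lambda>w. (1 + ?S * w) powr of_real B * (1 + w) powr of_real A) has_fps_expansion ?F"
  proof (intro has_fps_expansion_mult has_fps_expansion_binomial_complex)
    have "((\<lambda>w. (1 + w) powr complex_of_real B) \<circ> (\<lambda>w. ?S * w)) has_fps_expansion
        (fps_binomial (of_real B) oo (fps_const ?S * fps_X))"
      by (intro has_fps_expansion_compose fps_expansion_intros) auto
    then show "(\<lambda>w. (1 + ?S * w) powr of_real B) has_fps_expansion
        (fps_binomial (of_real B) oo (fps_const ?S * fps_X))" by (simp add: o_def)
  qed
  moreover have "(1 + ?S * w) powr of_real B * (1 + w) powr of_real A = jgen a b \<theta> n (1 + w)" for w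
  proof -
    have "complex_of_real (c\<^sup>2) + ?S = of_real (c\<^sup>2 + s\<^sup>2)" by (simp only: of_real_add)
    also have "c\<^sup>2 + s\<^sup>2 = 1" by (rule sin_cos_squared_add2)
    finally have "of_real (c\<^sup>2) + ?S * (1 + w) = 1 + ?S * w" by (simp add: algebra_simps)
    then show ?thesis unfolding jgen_def by (simp add: mult.commute)
  qed
  ultimately have "(\<lambda>w. jgen a b \<theta> n (1 + w)) has_fps_expansion ?F" by simp
  moreover have "fps_nth ?F n = of_real (jacobi_P a b n (cos \<theta>))"
  proof -
    have z: "(1 - cos \<theta>) / 2 = s\<^sup>2"
      using cos_double_sin[of "\<theta> / 2"] by simp
    have gb: "complex_of_real x gchoose k = of_real (x gchoose k)" for x k
      by (simp add: gbinomial_prod_rev)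
    have "fps_nth ?F n = (\<Sum>j=0..n. ?S ^ j * (of_real B gchoose j) * (of_real A gchoose (n - j)))"
      by (simp add: fps_mult_nth)
    also have "\<dots> = (\<Sum>j\<le>n. of_real (jacobi_c a b n j * (s\<^sup>2) ^ j))"
      unfolding gb atMost_atLeast0
      by (intro sum.cong) (auto simp: jacobi_c_def mult_ac simp flip: of_real_power of_real_mult)
    finally show ?thesis by (simp only: jacobi_P_sum[OF a] z of_real_sum)
  qed
  ultimately show ?thesis by blast
qed

abbreviation (input) "strip \<equiv> {\<zeta>. - pi < Im \<zeta> \<and> Im \<zeta> < pi}"

lemma open_strip: "open strip"
  using open_Int[OF open_halfspace_Im_gt[of "-pi"] open_halfspace_Im_lt[of pi]]
  by (simp add: Int_def)

lemma convex_strip: "convex strip"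
  using convex_Int[OF convex_halfspace_Im_gt[of "-pi"] convex_halfspace_Im_lt[of pi]]
  by (simp add: Int_def)

lemma jpoint_eq: "jpoint \<theta> \<zeta> = exp (\<zeta> - jzero \<theta>)"
proof -
  have "c / s > 0" using sc_pos by simp
  then have "exp (- (jzero \<theta>)) = complex_of_real (c / s)"
    by (simp add: jzero_def exp_of_real)
  then show ?thesis
    by (simp only: jpoint_def exp_diff mult.commute) (simp add: exp_minus field_simps)
qed

lemma jpoint_in_domain: "\<zeta> \<in> strip \<Longrightarrow> jpoint \<theta> \<zeta> \<notin> \<real>\<^sub>\<le>\<^sub>0"
proof
  assume z: "\<zeta> \<in> strip" and "jpoint \<theta> \<zeta> \<in> \<real>\<^sub>\<le>\<^sub>0"
  then have "Re (jpoint \<theta> \<zeta>) \<le> 0" "Im (jpoint \<theta> \<zeta>) = 0" by (auto simp: complex_nonpos_Reals_iff)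
  moreover have "Re (jpoint \<theta> \<zeta>) = c / s * exp (Re \<zeta>) * cos (Im \<zeta>)" "Im (jpoint \<theta> \<zeta>) = c / s * exp (Re \<zeta>) * sin (Im \<zeta>)"
    by (simp_all add: jpoint_def Re_exp Im_exp)
  moreover have "c / s * exp (Re \<zeta>) > 0" using sc_pos by simp
  ultimately have "sin (Im \<zeta>) = 0" "cos (Im \<zeta>) \<le> 0"
    using mult_le_0_iff[of "c / s * exp (Re \<zeta>)" "cos (Im \<zeta>)"] by (metis mult_eq_0_iff less_irrefl, metis leD)
  moreover have "Im \<zeta> = 0" using z \<open>sin (Im \<zeta>) = 0\<close> sin_eq_0_pi[of "Im \<zeta>"] by simp
  ultimately show False by simp
qed

lemma jpoint_eq_1_iff: "\<zeta> \<in> strip \<Longrightarrow> jpoint \<theta> \<zeta> = 1 \<longleftrightarrow> \<zeta> = jzero \<theta>"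
proof
  assume z: "\<zeta> \<in> strip" and "jpoint \<theta> \<zeta> = 1"
  then obtain k :: int where "Re (\<zeta> - jzero \<theta>) = 0" "Im (\<zeta> - jzero \<theta>) = of_int (2 * k) * pi"
    unfolding jpoint_eq exp_eq_1 by auto
  then have r: "Re \<zeta> = Re (jzero \<theta>)" and i: "Im \<zeta> = of_int (2 * k) * pi"
    by (simp_all add: jzero_def)
  have "of_int (2 * k) * pi < 1 * pi" "-1 * pi < of_int (2 * k) * pi" using z i by auto
  then have "of_int (2 * k) < (1::real)" "-1 < (of_int (2 * k) :: real)"
    by (simp_all only: mult_less_cancel_right_pos[OF pi_gt_zero])
  then have "k = 0" by linarith
  then show "\<zeta> = jzero \<theta>" using r i by (simp add: complex_eq_iff jzero_def)
qed (simp add: jpoint_eq)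

lemma jpoint_has_derivative: "(jpoint \<theta> has_field_derivative jpoint \<theta> \<zeta>) (at \<zeta> within X)"
  unfolding jpoint_def[abs_def] using sc_pos by (auto intro!: derivative_eq_intros)

lemma jpoint_holomorphic [holomorphic_intros]: "jpoint \<theta> holomorphic_on X"
  unfolding jpoint_def[abs_def] by (intro holomorphic_intros)

lemma jintegrand_holomorphic: "jintegrand a b \<theta> n holomorphic_on (strip - {jzero \<theta>})"
proof -
  have "(jgen a b \<theta> n \<circ> jpoint \<theta>) holomorphic_on (strip - {jzero \<theta>})"
    by (intro holomorphic_on_compose_gen[OF _ jgen_holomorphic] holomorphic_intros)
       (use jpoint_in_domain in auto)
  then have "(\<lambda>\<zeta>. jgen a b \<theta> n (jpoint \<theta> \<zeta>)) holomorphic_on (strip - {jzero \<theta>})" by (simp add: o_def)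
  then show ?thesis
    unfolding jintegrand_def[abs_def] using jpoint_eq_1_iff
    by (intro holomorphic_intros) auto
qed

lemma jrect_props:
  assumes U: "U > \<bar>Re (jzero \<theta>)\<bar>"
  shows "path_image (jrect U) \<subseteq> strip - {jzero \<theta>}" "winding_number (jrect U) (jzero \<theta>) = 1"
proof -
  have i: "Im (jzero \<theta>) = 0" by (simp add: jzero_def)
  have "jzero \<theta> \<in> box (Complex (- U) (- pi / 2)) (Complex U (pi / 2))"
    using U i pi_gt_zero by (auto simp: in_box_complex_iff)
  then show "winding_number (jrect U) (jzero \<theta>) = 1"
    unfolding jrect_def by (rule winding_number_rectpath)
  show "path_image (jrect U) \<subseteq> strip - {jzero \<theta>}"
    unfolding jrect_def using U i pi_gt_zero
    by (subst path_image_rectpath) (auto, (use pi_gt_zero in linarith)+)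
qed

text \<open>The Taylor expansion of the generating function at \<open>v = 1\<close> is integrated term by term:
  negative powers of \<open>v - 1\<close> beyond the first have a primitive, the Taylor remainder is
  holomorphic, and \<open>v / (v - 1)\<close> is a logarithmic derivative.\<close>

lemma jintegrand_contour_integral:
  assumes U: "U > \<bar>Re (jzero \<theta>)\<bar>"
  shows "(jintegrand a b \<theta> n has_contour_integral (2 * pi * \<i> * of_real (jacobi_P a b n (cos \<theta>)))) (jrect U)"
proof -
  have D: "open (- \<real>\<^sub>\<le>\<^sub>0 :: complex set)" "(1::complex) \<in> - \<real>\<^sub>\<le>\<^sub>0"
    by (auto simp: complex_nonpos_Reals_iff)
  obtain k g where g: "g holomorphic_on (- \<real>\<^sub>\<le>\<^sub>0)"
    and eq: "\<And>v. v \<in> - \<real>\<^sub>\<le>\<^sub>0 \<Longrightarrow> jgen a b \<theta> n v = (\<Sum>j<Suc n. k j * (v - 1) ^ j) + (v - 1) ^ Suc n * g v"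
    using holomorphic_taylor_remainder[OF D(1) jgen_holomorphic D(2), of "Suc n"] by blast
  obtain F where F: "(\<lambda>w. jgen a b \<theta> n (1 + w)) has_fps_expansion F" "fps_nth F n = of_real (jacobi_P a b n (cos \<theta>))"
    using jgen_coefficient by blast
  have kn: "k n = of_real (jacobi_P a b n (cos \<theta>))"
    using taylor_coefficient_unique[OF D g eq F(1)] F(2) by simp
  have vp: "valid_path (jrect U)" "pathfinish (jrect U) = pathstart (jrect U)"
    by (simp_all add: jrect_def)
  note img = jrect_props(1)[OF U]
  have low: "((\<lambda>\<zeta>. k j * (jpoint \<theta> \<zeta> / (jpoint \<theta> \<zeta> - 1) ^ (Suc n - j))) has_contour_integral k j * 0) (jrect U)"
    if "j < n" for j
  proof (rule has_contour_integral_lmul)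
    define m where "m = n - j - 1"
    have m: "Suc n - j = Suc (Suc m)" using that by (simp add: m_def)
    show "((\<lambda>\<zeta>. jpoint \<theta> \<zeta> / (jpoint \<theta> \<zeta> - 1) ^ (Suc n - j)) has_contour_integral 0) (jrect U)"
    proof (rule Cauchy_theorem_primitive[OF _ vp(1) img vp(2)])
      fix \<zeta> assume "\<zeta> \<in> strip - {jzero \<theta>}"
      then have nz: "jpoint \<theta> \<zeta> - 1 \<noteq> 0" using jpoint_eq_1_iff by auto
      have "((\<lambda>\<zeta>. - inverse (of_nat (Suc m)) * inverse ((jpoint \<theta> \<zeta> - 1) ^ Suc m)) has_field_derivative
          - inverse (of_nat (Suc m)) * (- (inverse ((jpoint \<theta> \<zeta> - 1) ^ Suc m) *
             (of_nat (Suc m) * (jpoint \<theta> \<zeta> - 1) ^ m * jpoint \<theta> \<zeta>) * inverse ((jpoint \<theta> \<zeta> - 1) ^ Suc m))))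
          (at \<zeta> within strip - {jzero \<theta>})"
        by (rule derivative_eq_intros jpoint_has_derivative refl | use nz in simp)+
      also have "- inverse (of_nat (Suc m)) * (- (inverse ((jpoint \<theta> \<zeta> - 1) ^ Suc m) *
             (of_nat (Suc m) * (jpoint \<theta> \<zeta> - 1) ^ m * jpoint \<theta> \<zeta>) * inverse ((jpoint \<theta> \<zeta> - 1) ^ Suc m)))
          = jpoint \<theta> \<zeta> / (jpoint \<theta> \<zeta> - 1) ^ (Suc n - j)"
      proof -
        have "inverse N * (inverse (w * W) * (N * W * p) * inverse (w * W)) = p / (w * (w * W))"
          if "N \<noteq> 0" "w \<noteq> 0" "W \<noteq> 0" for N w W p :: complex
          using that by (simp add: field_simps)
        from this[OF of_nat_neq_0 nz power_not_zero[OF nz], of m m "jpoint \<theta> \<zeta>"]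
        show ?thesis unfolding m power_Suc minus_mult_minus .
      qed
      finally show "((\<lambda>\<zeta>. - inverse (of_nat (Suc m)) * inverse ((jpoint \<theta> \<zeta> - 1) ^ Suc m)) has_field_derivative
          jpoint \<theta> \<zeta> / (jpoint \<theta> \<zeta> - 1) ^ (Suc n - j)) (at \<zeta> within strip - {jzero \<theta>})" .
    qed
  qed
  have rem: "((\<lambda>\<zeta>. jpoint \<theta> \<zeta> * g (jpoint \<theta> \<zeta>)) has_contour_integral 0) (jrect U)"
  proof (rule Cauchy_theorem_convex_simple[OF _ convex_strip vp(1) _ vp(2)])
    have "(g \<circ> jpoint \<theta>) holomorphic_on strip"
      by (intro holomorphic_on_compose_gen[OF _ g] holomorphic_intros)
         (use jpoint_in_domain in auto)
    then show "(\<lambda>\<zeta>. jpoint \<theta> \<zeta> * g (jpoint \<theta> \<zeta>)) holomorphic_on strip"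
      by (intro holomorphic_intros) (simp_all add: o_def)
  qed (use img in blast)
  have res: "((\<lambda>\<zeta>. k n * (jpoint \<theta> \<zeta> / (jpoint \<theta> \<zeta> - 1))) has_contour_integral k n * (2 * pi * \<i>)) (jrect U)"
  proof (rule has_contour_integral_lmul)
    \<comment> \<open>\<open>v - 1\<close> is \<open>\<zeta> - jzero \<theta>\<close> times \<open>e\<close>, and \<open>e\<close> has no zero in the strip.\<close>
    define e where "e = (\<lambda>\<zeta>. if \<zeta> = jzero \<theta> then deriv (jpoint \<theta>) (jzero \<theta>) else (jpoint \<theta> \<zeta> - jpoint \<theta> (jzero \<theta>)) / (\<zeta> - jzero \<theta>))"
    have j0: "jpoint \<theta> (jzero \<theta>) = 1" by (simp add: jpoint_eq)
    have e_hol: "e holomorphic_on strip"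
      unfolding e_def by (rule pole_lemma_open[OF jpoint_holomorphic open_strip])
    have e0: "e (jzero \<theta>) = 1"
      using DERIV_imp_deriv[OF jpoint_has_derivative[of "jzero \<theta>" UNIV]] j0 by (simp add: e_def)
    have e_nz: "e \<zeta> \<noteq> 0" if "\<zeta> \<in> strip" for \<zeta>
      using that jpoint_eq_1_iff[OF that] e0 j0 by (cases "\<zeta> = jzero \<theta>") (auto simp: e_def)
    have "(\<lambda>\<zeta>. jpoint \<theta> \<zeta> / e \<zeta>) holomorphic_on strip"
      by (intro holomorphic_intros e_hol) (use e_nz in auto)
    moreover have "jzero \<theta> \<in> interior strip"
      using interior_open[OF open_strip] by (simp add: jzero_def)
    ultimately have "((\<lambda>\<zeta>. (jpoint \<theta> \<zeta> / e \<zeta>) / (\<zeta> - jzero \<theta>)) has_contour_integral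
        (2 * pi * \<i> * winding_number (jrect U) (jzero \<theta>) * (jpoint \<theta> (jzero \<theta>) / e (jzero \<theta>)))) (jrect U)"
      by (rule Cauchy_integral_formula_convex_simple[OF convex_strip _ _ vp(1) img vp(2)])
    then have "((\<lambda>\<zeta>. (jpoint \<theta> \<zeta> / e \<zeta>) / (\<zeta> - jzero \<theta>)) has_contour_integral (2 * pi * \<i>)) (jrect U)"
      by (simp add: jrect_props(2)[OF U] e0 j0)
    then show "((\<lambda>\<zeta>. jpoint \<theta> \<zeta> / (jpoint \<theta> \<zeta> - 1)) has_contour_integral (2 * pi * \<i>)) (jrect U)"
      by (rule has_contour_integral_eq) (use img j0 in \<open>auto simp: e_def\<close>)
  qed
  have "((\<lambda>\<zeta>. (\<Sum>j\<in>{..<n}. k j * (jpoint \<theta> \<zeta> / (jpoint \<theta> \<zeta> - 1) ^ (Suc n - j)))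
        + k n * (jpoint \<theta> \<zeta> / (jpoint \<theta> \<zeta> - 1)) + jpoint \<theta> \<zeta> * g (jpoint \<theta> \<zeta>))
      has_contour_integral ((\<Sum>j\<in>{..<n}. k j * 0) + k n * (2 * pi * \<i>) + 0)) (jrect U)"
    by (intro has_contour_integral_add has_contour_integral_sum low res rem) auto
  then have "(jintegrand a b \<theta> n has_contour_integral ((\<Sum>j\<in>{..<n}. k j * 0) + k n * (2 * pi * \<i>) + 0)) (jrect U)"
  proof (rule has_contour_integral_eq)
    fix \<zeta> assume "\<zeta> \<in> path_image (jrect U)"
    then have z: "\<zeta> \<in> strip" "\<zeta> \<noteq> (jzero \<theta>)" using img by auto
    let ?v = "jpoint \<theta> \<zeta>"
    have nz: "?v - 1 \<noteq> 0" using z jpoint_eq_1_iff by auto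
    have "jintegrand a b \<theta> n \<zeta> = ?v * ((\<Sum>j<Suc n. k j * (?v - 1) ^ j) + (?v - 1) ^ Suc n * g ?v) / (?v - 1) ^ Suc n"
      unfolding jintegrand_def using eq[of ?v] jpoint_in_domain[OF z(1)] by simp
    also have "\<dots> = (\<Sum>j<Suc n. k j * (?v * ((?v - 1) ^ j / (?v - 1) ^ Suc n))) + ?v * g ?v"
      using nz by (simp add: add_divide_distrib distrib_left sum_distrib_left sum_divide_distrib mult_ac del: sum.lessThan_Suc power_Suc)
    also have "(\<Sum>j<Suc n. k j * (?v * ((?v - 1) ^ j / (?v - 1) ^ Suc n)))
        = (\<Sum>j<Suc n. k j * (?v / (?v - 1) ^ (Suc n - j)))"
      using nz by (intro sum.cong) (auto simp: power_diff simp del: power_Suc)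
    finally show "(\<Sum>j\<in>{..<n}. k j * (?v / (?v - 1) ^ (Suc n - j))) + k n * (?v / (?v - 1)) + ?v * g ?v
        = jintegrand a b \<theta> n \<zeta>" by simp
  qed
  then show ?thesis by (simp add: kn mult_ac)
qed

lemma jintegrand_cnj:
  "jintegrand a b \<theta> n (Complex u (- pi / 2)) = cnj (jintegrand a b \<theta> n (Complex u (pi / 2)))"
proof -
  let ?v = "jpoint \<theta> (Complex u (pi / 2))"
  have cz: "Complex u (- pi / 2) = cnj (Complex u (pi / 2))" by (simp add: complex_eq_iff)
  have v: "jpoint \<theta> (Complex u (- pi / 2)) = cnj ?v"
    unfolding cz by (simp add: jpoint_def exp_cnj)
  have im: "Im ?v > 0" using sc_pos by (simp add: jpoint_def Im_exp)
  have g: "jgen a b \<theta> n (cnj ?v) = cnj (jgen a b \<theta> n ?v)"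
  proof -
    have "cnj (?v powr of_real A) = cnj ?v powr cnj (of_real A)"
      by (rule cnj_powr) (use im in auto)
    moreover have "cnj ((of_real (c\<^sup>2) + of_real (s\<^sup>2) * ?v) powr of_real B)
        = cnj (of_real (c\<^sup>2) + of_real (s\<^sup>2) * ?v) powr cnj (of_real B)"
    proof (rule cnj_powr)
      have "Im (of_real (c\<^sup>2) + of_real (s\<^sup>2) * ?v) = s\<^sup>2 * Im ?v" by simp
      moreover have "s\<^sup>2 * Im ?v > 0" using im sc_pos by (intro mult_pos_pos) auto
      ultimately show "0 \<le> Re (of_real (c\<^sup>2) + of_real (s\<^sup>2) * ?v)"
        if "Im (of_real (c\<^sup>2) + of_real (s\<^sup>2) * ?v) = 0" using that by linarith
    qed
    ultimately show ?thesis
      unfolding jgen_def complex_cnj_mult complex_cnj_add complex_cnj_complex_of_real by simp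
  qed
  show ?thesis unfolding jintegrand_def v g by simp
qed

text \<open>One bound for both signs of the exponent: the factor \<open>max 1 (l powr p)\<close> pays for the lower
  estimate when \<open>p\<close> is negative.\<close>

lemma norm_powr_between:
  fixes w :: complex
  assumes "l > 0" "l * r \<le> norm w" "norm w \<le> r" "r > 0"
  shows "norm (w powr of_real p) \<le> max 1 (l powr p) * r powr p"
proof -
  have n: "norm (w powr of_real p) = norm w powr p" by (subst norm_powr_real_powr') auto
  show ?thesis
  proof (cases "p \<ge> 0")
    case True
    then have "norm w powr p \<le> r powr p" using assms by (intro powr_mono2) auto
    also have "\<dots> \<le> max 1 (l powr p) * r powr p" by (simp add: mult_le_cancel_right1)
    finally show ?thesis unfolding n .
  next
    case False
    then have "norm w powr p \<le> (l * r) powr p"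
      using assms by (intro powr_mono2') (auto intro!: mult_pos_pos)
    also have "\<dots> = l powr p * r powr p" using assms by (simp add: powr_mult)
    also have "\<dots> \<le> max 1 (l powr p) * r powr p" by (intro mult_right_mono) auto
    finally show ?thesis unfolding n .
  qed
qed

text \<open>On a vertical side \<open>v\<close> has constant modulus \<open>\<rho>\<close> and \<open>Re v \<ge> 0\<close>, so the second base has
  modulus at least \<open>c^2\<close> and \<open>s^2 \<rho>\<close>. The exponents of \<open>\<rho>\<close> have the signs that make both bounds
  vanish as the sides move to infinity, since \<open>n + a + 1\<close> and \<open>n + b + 1\<close> are positive.\<close>

lemma jintegrand_side_bound:
  assumes z: "\<bar>Im \<zeta>\<bar> \<le> pi / 2" and \<rho>: "\<rho> = c / s * exp (Re \<zeta>)"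
  shows "\<rho> \<ge> 2 \<Longrightarrow> norm (jintegrand a b \<theta> n \<zeta>) \<le>
           2 ^ Suc n * max 1 ((s\<^sup>2) powr B) * \<rho> powr (- (real n + b + 1))"
    and "\<rho> \<le> 1 / 2 \<Longrightarrow> norm (jintegrand a b \<theta> n \<zeta>) \<le>
           2 ^ Suc n * max 1 ((c\<^sup>2) powr B) * \<rho> powr (A + 1)"
proof -
  let ?v = "jpoint \<theta> \<zeta>" and ?w = "of_real (c\<^sup>2) + of_real (s\<^sup>2) * jpoint \<theta> \<zeta>"
  have rp: "\<rho> > 0" using sc_pos unfolding \<rho> by simp
  have nv: "norm ?v = \<rho>" using sc_pos by (simp add: jpoint_def norm_mult norm_divide \<rho>)
  have rev: "Re ?v \<ge> 0"
  proof -
    have "cos (Im \<zeta>) \<ge> 0" using z by (intro cos_ge_zero) auto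
    moreover have "Re ?v = c / s * exp (Re \<zeta>) * cos (Im \<zeta>)" by (simp add: jpoint_def Re_exp)
    ultimately show ?thesis using sc_pos by simp
  qed
  have cs: "c\<^sup>2 + s\<^sup>2 = 1" by (rule sin_cos_squared_add2)
  have pos: "c\<^sup>2 > 0" "s\<^sup>2 > 0" using sc_pos by auto
  have up: "norm ?w \<le> c\<^sup>2 + s\<^sup>2 * \<rho>"
    by (rule order.trans[OF norm_triangle_ineq]) (simp add: norm_mult norm_power nv)
  have lo1: "norm ?w \<ge> s\<^sup>2 * \<rho>"
  proof -
    have "(s\<^sup>2 * \<rho>)\<^sup>2 = (s\<^sup>2 * Re ?v)\<^sup>2 + (s\<^sup>2 * Im ?v)\<^sup>2"
      unfolding nv[symmetric] cmod_def by (simp add: power_mult_distrib distrib_left)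
    also have "\<dots> \<le> (c\<^sup>2 + s\<^sup>2 * Re ?v)\<^sup>2 + (s\<^sup>2 * Im ?v)\<^sup>2"
      using rev pos by (intro add_right_mono power_mono) auto
    also have "\<dots> = (norm ?w)\<^sup>2" by (simp add: cmod_def)
    finally show ?thesis by (rule power2_le_imp_le) simp
  qed
  have lo2: "norm ?w \<ge> c\<^sup>2"
  proof -
    have "c\<^sup>2 \<le> Re ?w" using rev pos by simp
    also have "\<dots> \<le> norm ?w" by (rule complex_Re_le_cmod)
    finally show ?thesis .
  qed
  have nA: "norm (?v powr of_real A) = \<rho> powr A" by (subst norm_powr_real_powr') (auto simp: nv)
  have norm_eq: "norm (jintegrand a b \<theta> n \<zeta>) = \<rho> * (\<rho> powr A * norm (?w powr of_real B)) / norm (?v - 1) ^ Suc n"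
    unfolding jintegrand_def jgen_def by (simp only: norm_divide norm_mult norm_power nv nA)
  { assume big: "\<rho> \<ge> 2"
    have "c\<^sup>2 * 1 \<le> c\<^sup>2 * \<rho>" using big by (intro mult_left_mono) auto
    then have "c\<^sup>2 + s\<^sup>2 * \<rho> \<le> c\<^sup>2 * \<rho> + s\<^sup>2 * \<rho>" by simp
    also have "\<dots> = (c\<^sup>2 + s\<^sup>2) * \<rho>" by (simp only: distrib_right)
    also have "\<dots> = \<rho>" unfolding cs by simp
    finally have "norm ?w \<le> \<rho>" using up by linarith
    then have wB: "norm (?w powr of_real B) \<le> max 1 ((s\<^sup>2) powr B) * \<rho> powr B"
      using lo1 pos rp by (intro norm_powr_between) auto
    have "norm (?v - 1) \<ge> \<rho> / 2" using norm_triangle_ineq2[of ?v 1] nv big by simp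
    then have d: "norm (?v - 1) ^ Suc n \<ge> (\<rho> / 2) ^ Suc n" using rp by (intro power_mono) auto
    have "norm (jintegrand a b \<theta> n \<zeta>) \<le> \<rho> * (\<rho> powr A * (max 1 ((s\<^sup>2) powr B) * \<rho> powr B)) / (\<rho> / 2) ^ Suc n"
      unfolding norm_eq using wB d rp by (intro frac_le mult_left_mono) auto
    also have "\<dots> = 2 ^ Suc n * max 1 ((s\<^sup>2) powr B) * (\<rho> * \<rho> powr A * \<rho> powr B / \<rho> ^ Suc n)"
      by (simp add: power_divide del: power_Suc)
    also have "\<rho> * \<rho> powr A * \<rho> powr B / \<rho> ^ Suc n = \<rho> powr 1 * \<rho> powr A * \<rho> powr B / \<rho> powr real (Suc n)"
      using rp by (simp only: powr_realpow[OF rp] powr_one[OF less_imp_le[OF rp]])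
    also have "\<rho> powr 1 * \<rho> powr A * \<rho> powr B / \<rho> powr real (Suc n) = \<rho> powr (1 + A + B - real (Suc n))"
      by (simp only: powr_add powr_diff)
    also have "1 + A + B - real (Suc n) = - (real n + b + 1)" by simp
    finally show "norm (jintegrand a b \<theta> n \<zeta>) \<le>
           2 ^ Suc n * max 1 ((s\<^sup>2) powr B) * \<rho> powr (- (real n + b + 1))" . }
  { assume small: "\<rho> \<le> 1 / 2"
    have "s\<^sup>2 * \<rho> \<le> s\<^sup>2 * 1" using small by (intro mult_left_mono) auto
    then have "norm ?w \<le> 1" using up cs by linarith
    then have wB: "norm (?w powr of_real B) \<le> max 1 ((c\<^sup>2) powr B) * 1 powr B"
      using lo2 pos by (intro norm_powr_between) auto
    have "norm (?v - 1) \<ge> 1 / 2" using norm_triangle_ineq2[of 1 ?v] nv small by (simp add: norm_minus_commute)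
    then have d: "norm (?v - 1) ^ Suc n \<ge> (1 / 2) ^ Suc n" by (intro power_mono) auto
    have "norm (jintegrand a b \<theta> n \<zeta>) \<le> \<rho> * (\<rho> powr A * (max 1 ((c\<^sup>2) powr B) * 1 powr B)) / (1 / 2) ^ Suc n"
      unfolding norm_eq using wB d rp by (intro frac_le mult_left_mono) auto
    also have "\<dots> = 2 ^ Suc n * max 1 ((c\<^sup>2) powr B) * (\<rho> powr A * \<rho> powr 1)"
      using rp by (simp add: power_divide)
    also have "\<rho> powr A * \<rho> powr 1 = \<rho> powr (A + 1)" by (simp only: powr_add)
    finally show "norm (jintegrand a b \<theta> n \<zeta>) \<le>
           2 ^ Suc n * max 1 ((c\<^sup>2) powr B) * \<rho> powr (A + 1)" . }
qed

text \<open>The integrand takes conjugate values on the two horizontal sides, so together they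
  contribute \<open>-2i\<close> times an imaginary part; the vertical sides vanish in the limit.\<close>

lemma jacobi_P_integral_limit:
  "((\<lambda>U. Im (integral {-U..U} (\<lambda>u. jintegrand a b \<theta> n (Complex u (pi / 2))))) \<longlongrightarrow> - pi * jacobi_P a b n (cos \<theta>)) at_top"
proof -
  let ?P = "jacobi_P a b n (cos \<theta>)"
  let ?I = "\<lambda>U. integral {-U..U} (\<lambda>u. jintegrand a b \<theta> n (Complex u (pi / 2)))"
  define K1 where "K1 = 2 ^ Suc n * max 1 ((s\<^sup>2) powr B)"
  define K2 where "K2 = 2 ^ Suc n * max 1 ((c\<^sup>2) powr B)"
  define bd where "bd = (\<lambda>U. pi / 2 * (K1 * (c / s * exp U) powr (- (real n + b + 1)) + K2 * (c / s * exp (- U)) powr (A + 1)))"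
  have t: "c / s > 0" using sc_pos by simp
  have fin: "\<bar>Im (?I U) - (- pi * ?P)\<bar> \<le> bd U"
    if U: "U > \<bar>Re (jzero \<theta>)\<bar>" and U1: "c / s * exp U \<ge> 2" and U2: "c / s * exp (- U) \<le> 1 / 2" for U
  proof -
    define l1 where "l1 = linepath (Complex (-U) (- pi / 2)) (Complex U (- pi / 2))"
    define l2 where "l2 = linepath (Complex U (- pi / 2)) (Complex U (pi / 2))"
    define l3 where "l3 = linepath (Complex U (pi / 2)) (Complex (-U) (pi / 2))"
    define l4 where "l4 = linepath (Complex (-U) (pi / 2)) (Complex (-U) (- pi / 2))"
    have U0: "- U < U" using U by linarith
    have rect: "jrect U = l1 +++ l2 +++ l3 +++ l4"
      by (simp add: jrect_def rectpath_def l1_def l2_def l3_def l4_def Let_def)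
    have "path_image (jrect U) = path_image l1 \<union> path_image l2 \<union> path_image l3 \<union> path_image l4"
      unfolding rect by (simp add: path_image_join l1_def l2_def l3_def l4_def Un_assoc)
    then have img: "path_image l \<subseteq> strip - {jzero \<theta>}" if "l \<in> {l1, l2, l3, l4}" for l
      using that jrect_props(1)[OF U] by auto
    have int: "jintegrand a b \<theta> n contour_integrable_on l" if "l \<in> {l1, l2, l3, l4}" for l
      by (rule contour_integrable_holomorphic_simple[OF jintegrand_holomorphic _ _ img[OF that]])
         (use that open_strip in \<open>auto simp: l1_def l2_def l3_def l4_def intro: open_delete\<close>)
    have split: "2 * pi * \<i> * of_real ?P = contour_integral l1 (jintegrand a b \<theta> n) + (contour_integral l2 (jintegrand a b \<theta> n)
        + (contour_integral l3 (jintegrand a b \<theta> n) + contour_integral l4 (jintegrand a b \<theta> n)))"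
    proof -
      have "(jintegrand a b \<theta> n has_contour_integral (contour_integral l1 (jintegrand a b \<theta> n) + (contour_integral l2 (jintegrand a b \<theta> n)
        + (contour_integral l3 (jintegrand a b \<theta> n) + contour_integral l4 (jintegrand a b \<theta> n))))) (jrect U)"
        unfolding rect
        by (intro has_contour_integral_join has_contour_integral_integral int valid_path_join)
           (auto simp: l1_def l2_def l3_def l4_def)
      from contour_integral_unique[OF this] contour_integral_unique[OF jintegrand_contour_integral[OF U]]
      show ?thesis by simp
    qed
    have top: "contour_integral l3 (jintegrand a b \<theta> n) = - ?I U"
    proof -
      have r: "l3 = reversepath (linepath (Complex (-U) (pi / 2)) (Complex U (pi / 2)))"
        by (simp add: l3_def)
      show ?thesis
        unfolding r by (subst contour_integral_reversepath)
          (simp_all add: contour_integral_linepath_horizontal[OF U0])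
    qed
    have cont: "continuous_on {-U..U} (\<lambda>u. jintegrand a b \<theta> n (Complex u (pi / 2)))"
    proof (rule continuous_on_compose2[OF holomorphic_on_imp_continuous_on[OF jintegrand_holomorphic]])
      show "continuous_on {-U..U} (\<lambda>u. Complex u (pi / 2))"
        by (simp add: Complex_eq) (intro continuous_intros)
      show "(\<lambda>u. Complex u (pi / 2)) ` {- U..U} \<subseteq> strip - {jzero \<theta>}"
        using pi_gt_zero by (auto simp: jzero_def complex_eq_iff)
    qed
    have bot: "contour_integral l1 (jintegrand a b \<theta> n) = cnj (?I U)"
    proof -
      have "contour_integral l1 (jintegrand a b \<theta> n) = integral {-U..U} (cnj \<circ> (\<lambda>u. jintegrand a b \<theta> n (Complex u (pi / 2))))"
        unfolding l1_def contour_integral_linepath_horizontal[OF U0] jintegrand_cnj by (simp add: o_def)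
      also have "\<dots> = cnj (?I U)"
        by (rule integral_linear[OF integrable_continuous_interval[OF cont] bounded_linear_cnj])
      finally show ?thesis .
    qed
    have K: "K1 \<ge> 0" "K2 \<ge> 0" by (auto simp: K1_def K2_def)
    have right: "norm (contour_integral l2 (jintegrand a b \<theta> n)) \<le> K1 * (c / s * exp U) powr (- (real n + b + 1)) * pi"
    proof -
      have "norm (contour_integral l2 (jintegrand a b \<theta> n)) \<le> K1 * (c / s * exp U) powr (- (real n + b + 1))
          * norm (Complex U (pi / 2) - Complex U (- pi / 2))"
        unfolding l2_def
      proof (rule contour_integral_bound_linepath)
        show "jintegrand a b \<theta> n contour_integrable_on linepath (Complex U (- pi / 2)) (Complex U (pi / 2))"
          using int[of l2] by (simp add: l2_def)
        fix \<zeta> assume "\<zeta> \<in> closed_segment (Complex U (- pi / 2)) (Complex U (pi / 2))"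
        then have "Re \<zeta> = U" "\<bar>Im \<zeta>\<bar> \<le> pi / 2"
          by (auto simp: closed_segment_same_Re closed_segment_eq_real_ivl split: if_splits)
        then show "norm (jintegrand a b \<theta> n \<zeta>) \<le> K1 * (c / s * exp U) powr (- (real n + b + 1))"
          using jintegrand_side_bound(1)[of \<zeta> "c / s * exp U"] U1 unfolding K1_def by simp
      qed (use K in simp)
      also have "norm (Complex U (pi / 2) - Complex U (- pi / 2)) = pi"
        by (simp add: cmod_def)
      finally show ?thesis .
    qed
    have left: "norm (contour_integral l4 (jintegrand a b \<theta> n)) \<le> K2 * (c / s * exp (- U)) powr (A + 1) * pi"
    proof -
      have "norm (contour_integral l4 (jintegrand a b \<theta> n)) \<le> K2 * (c / s * exp (- U)) powr (A + 1)
          * norm (Complex (- U) (- pi / 2) - Complex (- U) (pi / 2))"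
        unfolding l4_def
      proof (rule contour_integral_bound_linepath)
        show "jintegrand a b \<theta> n contour_integrable_on linepath (Complex (- U) (pi / 2)) (Complex (- U) (- pi / 2))"
          using int[of l4] by (simp add: l4_def)
        fix \<zeta> assume "\<zeta> \<in> closed_segment (Complex (- U) (pi / 2)) (Complex (- U) (- pi / 2))"
        then have "Re \<zeta> = - U" "\<bar>Im \<zeta>\<bar> \<le> pi / 2"
          by (auto simp: closed_segment_same_Re closed_segment_eq_real_ivl split: if_splits)
        then show "norm (jintegrand a b \<theta> n \<zeta>) \<le> K2 * (c / s * exp (- U)) powr (A + 1)"
          using jintegrand_side_bound(2)[of \<zeta> "c / s * exp (- U)"] U2 unfolding K2_def by simp
      qed (use K in simp)
      also have "norm (Complex (- U) (- pi / 2) - Complex (- U) (pi / 2)) = pi"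
        by (simp add: cmod_def)
      finally show ?thesis .
    qed
    let ?E = "contour_integral l2 (jintegrand a b \<theta> n) + contour_integral l4 (jintegrand a b \<theta> n)"
    have cz: "cnj z - z = - 2 * \<i> * of_real (Im z)" for z by (simp add: complex_eq_iff)
    have "2 * pi * \<i> * of_real ?P = - 2 * \<i> * of_real (Im (?I U)) + ?E"
      unfolding split bot top cz[symmetric] by simp
    then have "2 * \<i> * of_real (Im (?I U) - (- pi * ?P)) = ?E" by (simp add: algebra_simps)
    then have "norm (2 * \<i> * complex_of_real (Im (?I U) - (- pi * ?P))) = norm ?E" by simp
    then have "2 * \<bar>Im (?I U) - (- pi * ?P)\<bar> = norm ?E"
      by (simp only: norm_mult norm_of_real norm_ii norm_numeral)
    also have "\<dots> \<le> K1 * (c / s * exp U) powr (- (real n + b + 1)) * pi + K2 * (c / s * exp (- U)) powr (A + 1) * pi"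
      by (rule order.trans[OF norm_triangle_ineq add_mono[OF right left]])
    finally show ?thesis unfolding bd_def by (simp add: algebra_simps)
  qed
  have b1: "((\<lambda>U. (c / s * exp U) powr (- (real n + b + 1))) \<longlongrightarrow> 0) at_top"
    by (rule tendsto_neg_powr[OF _ filterlim_tendsto_pos_mult_at_top[OF tendsto_const t exp_at_top]])
       (use nb in simp)
  have b2: "((\<lambda>U. (c / s * exp (- U)) powr (A + 1)) \<longlongrightarrow> 0) at_top"
  proof -
    have "((\<lambda>U. c / s * exp (- U)) \<longlongrightarrow> c / s * 0) at_top"
      by (intro tendsto_mult tendsto_const filterlim_compose[OF exp_at_bot] filterlim_uminus_at_bot_at_top)
    then have "((\<lambda>U. c / s * exp (- U)) \<longlongrightarrow> 0) at_top" by simp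
    then show ?thesis
    proof (rule tendsto_zero_powrI[OF _ tendsto_const])
      show "\<forall>\<^sub>F U in at_top. 0 \<le> c / s * exp (- U)"
        using t by (intro always_eventually allI mult_nonneg_nonneg) auto
    qed (use a in simp)
  qed
  have "(bd \<longlongrightarrow> pi / 2 * (K1 * 0 + K2 * 0)) at_top"
    unfolding bd_def by (intro tendsto_intros b1 b2)
  then have bd0: "(bd \<longlongrightarrow> 0) at_top" by simp
  have ev: "eventually (\<lambda>U. norm (Im (?I U) - (- pi * ?P)) \<le> bd U) at_top"
    using eventually_gt_at_top[of "\<bar>Re (jzero \<theta>)\<bar>"] eventually_ge_at_top[of "ln (2 / (c / s))"]
      eventually_ge_at_top[of "- ln (1 / 2 / (c / s))"]
  proof eventually_elim
    case (elim U)
    have "2 / (c / s) = exp (ln (2 / (c / s)))" by (rule exp_ln[symmetric]) (use sc_pos in simp)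
    also have "\<dots> \<le> exp U" using elim by simp
    finally have g1: "c / s * exp U \<ge> 2" using sc_pos by (simp add: field_simps)
    have "exp (- U) \<le> exp (ln (1 / 2 / (c / s)))" using elim by (subst exp_le_cancel_iff) linarith
    also have "\<dots> = 1 / 2 / (c / s)" by (rule exp_ln) (use sc_pos in simp)
    finally have g2: "c / s * exp (- U) \<le> 1 / 2" using sc_pos by (simp add: field_simps)
    show ?case using fin[OF elim(1) g1 g2] by simp
  qed
  have "((\<lambda>U. Im (?I U) - (- pi * ?P)) \<longlongrightarrow> 0) at_top"
    by (rule Lim_null_comparison[OF ev bd0])
  then show ?thesis by (rule LIM_zero_cancel)
qed

end

lemmas jacobi_P_integral_limit = jacobi_contour.jacobi_P_integral_limit[OF jacobi_contour.intro]

section \<open>A model integral in closed form\<close>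

text \<open>On the line \<open>Im \<zeta> = \<pi> / 2\<close> the factor of the integrand that depends on \<open>n\<close> is, up to a
  phase, a negative power of \<open>1 + \<kappa> sinh(u/2)^2\<close> with a complex number \<open>\<kappa>\<close>. The extra factor
  \<open>cosh (u / 2)\<close> makes the integral elementary through the substitution \<open>z = sinh (u / 2)\<close>, with
  no loss since the amplitude can absorb its inverse.\<close>

definition model_integral :: "complex \<Rightarrow> nat \<Rightarrow> real \<Rightarrow> complex" where
  "model_integral \<kappa> m U =
     integral {-U..U} (\<lambda>u. of_real (cosh (u / 2)) / (1 + \<kappa> * of_real (sinh (u / 2)) ^ 2) ^ m)"

lemma model_denominator:
  assumes "Re \<kappa> > 0"
  shows "norm (1 + \<kappa> * of_real r ^ 2) \<ge> 1 + Re \<kappa> * r\<^sup>2" "1 + \<kappa> * of_real r ^ 2 \<noteq> 0"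
proof -
  have "Re (1 + \<kappa> * of_real r ^ 2) = 1 + Re \<kappa> * r\<^sup>2"
    by (simp flip: of_real_power)
  then show *: "norm (1 + \<kappa> * of_real r ^ 2) \<ge> 1 + Re \<kappa> * r\<^sup>2"
    using complex_Re_le_cmod by metis
  have "Re \<kappa> * r\<^sup>2 \<ge> 0" using assms by simp
  then show "1 + \<kappa> * of_real r ^ 2 \<noteq> 0" using * by (intro notI) simp
qed

lemma continuous_on_model:
  assumes "Re \<kappa> > 0"
  shows "continuous_on X (\<lambda>u::real. complex_of_real (cosh (u / 2)) / (1 + \<kappa> * of_real (sinh (u / 2)) ^ 2) ^ m)"
  using model_denominator(2)[OF assms] by (intro continuous_intros) auto

lemma half_sinh_chain:
  assumes "(G has_field_derivative G') (at (complex_of_real (sinh (u / 2))))"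
  shows "((\<lambda>u. G (of_real (sinh (u / 2)))) has_vector_derivative (of_real (cosh (u / 2) / 2) * G')) (at u within X)"
proof -
  have "((\<lambda>u::real. sinh (u / 2)) has_real_derivative cosh (u / 2) / 2) (at u)"
    by (auto intro!: derivative_eq_intros)
  then have "((\<lambda>u. complex_of_real (sinh (u / 2))) has_vector_derivative of_real (cosh (u / 2) / 2)) (at u)"
    by (rule has_vector_derivative_of_real)
  from field_vector_diff_chain_at[OF this assms] show ?thesis
    by (simp add: o_def has_vector_derivative_at_within)
qed

text \<open>The reduction formula for \<open>\<integral> dz / (1 + \<kappa> z^2)^m\<close>, from the primitive \<open>2 z / (1 + \<kappa> z^2)^m\<close>.\<close>

lemma model_integral_Suc:
  assumes \<kappa>: "Re \<kappa> > 0" and U: "U \<ge> 0" and m: "m > 0"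
  shows "2 * of_nat m * model_integral \<kappa> (Suc m) U = (2 * of_nat m - 1) * model_integral \<kappa> m U
     + 4 * of_real (sinh (U / 2)) / (1 + \<kappa> * of_real (sinh (U / 2)) ^ 2) ^ m"
proof -
  let ?q = "\<lambda>z. 1 + \<kappa> * z ^ 2"
  let ?\<phi> = "\<lambda>m u. complex_of_real (cosh (u / 2)) / (?q (of_real (sinh (u / 2)))) ^ m"
  let ?G = "\<lambda>z. 2 * z / ?q z ^ m"
  obtain k where k: "m = Suc k" using m by (cases m) auto
  have der: "((\<lambda>u. ?G (of_real (sinh (u / 2)))) has_vector_derivative
      (2 * of_nat m * ?\<phi> (Suc m) u - (2 * of_nat m - 1) * ?\<phi> m u)) (at u within {-U..U})" for u
  proof -
    let ?z = "complex_of_real (sinh (u / 2))"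
    have nz: "?q ?z \<noteq> 0" by (rule model_denominator(2)[OF \<kappa>])
    have "(?q has_field_derivative \<kappa> * (2 * ?z)) (at ?z)"
      by (auto intro!: derivative_eq_intros)
    from DERIV_power[OF this, of m]
    have "((\<lambda>z. ?q z ^ m) has_field_derivative of_nat m * ?q ?z ^ k * (\<kappa> * (2 * ?z))) (at ?z)"
      by (rule DERIV_cong) (simp add: k)
    from DERIV_divide[OF DERIV_cmult_Id[of 2] this] nz
    have "(?G has_field_derivative ((2 * ?q ?z ^ m - 2 * ?z * (of_nat m * ?q ?z ^ k * (\<kappa> * (2 * ?z)))) / (?q ?z ^ m * ?q ?z ^ m))) (at ?z)"
      by simp
    moreover have "(2 * q ^ m - 2 * z * (of_nat m * q ^ k * (\<kappa> * (2 * z)))) / (q ^ m * q ^ m)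
        = 2 * ((2 * of_nat m) / q ^ Suc m - (2 * of_nat m - 1) / q ^ m)"
      if "q \<noteq> 0" "\<kappa> * z ^ 2 = q - 1" for q z :: complex
    proof -
      have "2 * z * (of_nat m * q ^ k * (\<kappa> * (2 * z))) = 4 * of_nat m * q ^ k * (\<kappa> * z ^ 2)"
        by (simp add: power2_eq_square)
      then have "(2 * q ^ m - 2 * z * (of_nat m * q ^ k * (\<kappa> * (2 * z)))) / (q ^ m * q ^ m)
          = (2 * q ^ m - 4 * of_nat m * q ^ k * (q - 1)) / (q ^ m * q ^ m)" by (simp only: that(2))
      also have "\<dots> = 2 * ((2 * of_nat m) / q ^ Suc m - (2 * of_nat m - 1) / q ^ m)"
        using that(1) by (simp add: k divide_simps) (simp add: algebra_simps)
      finally show ?thesis .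
    qed
    from this[OF nz, of ?z] have "(2 * ?q ?z ^ m - 2 * ?z * (of_nat m * ?q ?z ^ k * (\<kappa> * (2 * ?z)))) / (?q ?z ^ m * ?q ?z ^ m)
       = 2 * ((2 * of_nat m) / ?q ?z ^ Suc m - (2 * of_nat m - 1) / ?q ?z ^ m)" by simp
    ultimately have "(?G has_field_derivative (2 * ((2 * of_nat m) / ?q ?z ^ Suc m - (2 * of_nat m - 1) / ?q ?z ^ m))) (at ?z)"
      by simp
    note G = half_sinh_chain[OF this, of "{-U..U}"]
    have aux: "complex_of_real (x / 2) * (2 * (A / B - C / D)) = A * (of_real x / B) - C * (of_real x / D)"
      for x A B C D by (simp add: algebra_simps)
    show ?thesis using G unfolding aux .
  qed
  have "((\<lambda>u. 2 * of_nat m * ?\<phi> (Suc m) u - (2 * of_nat m - 1) * ?\<phi> m u) has_integral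
      (?G (of_real (sinh (U / 2))) - ?G (of_real (sinh (- U / 2))))) {-U..U}"
    by (rule fundamental_theorem_of_calculus[OF _ der]) (use U in auto)
  then have 1: "integral {-U..U} (\<lambda>u. 2 * of_nat m * ?\<phi> (Suc m) u - (2 * of_nat m - 1) * ?\<phi> m u)
      = 4 * of_real (sinh (U / 2)) / ?q (of_real (sinh (U / 2))) ^ m"
    by (simp add: integral_unique)
  have int: "?\<phi> m integrable_on {-U..U}" for m
    by (intro integrable_continuous_interval continuous_on_model \<kappa>)
  have "integral {-U..U} (\<lambda>u. 2 * of_nat m * ?\<phi> (Suc m) u - (2 * of_nat m - 1) * ?\<phi> m u)
      = 2 * of_nat m * integral {-U..U} (?\<phi> (Suc m)) - (2 * of_nat m - 1) * integral {-U..U} (?\<phi> m)"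
  proof -
    have "integral S (\<lambda>u. c * f u - d * g u) = c * integral S f - d * integral S g"
      if "f integrable_on S" "g integrable_on S" for c d :: complex and f g :: "real \<Rightarrow> complex" and S
      using that by (subst integral_diff) (auto intro: integrable_on_mult_right)
    from this[OF int int] show ?thesis .
  qed
  then show ?thesis unfolding model_integral_def using 1 by (simp add: algebra_simps)
qed

lemma sinh_half_at_top: "filterlim (\<lambda>U::real. sinh (U / 2)) at_top at_top"
  by real_asymp

text \<open>After the substitution this is an arctangent integral with complex parameter. Its primitive
  is a difference of principal logarithms of \<open>1 \<plusminus> i w z\<close>, whose arguments tend to opposite
  directions; the logarithms then differ by \<open>i \<pi>\<close>.\<close>

lemma model_integral_1_limit:
  fixes w :: complex
  assumes w: "Re w > 0" and \<kappa>: "Re (w\<^sup>2) > 0"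
  shows "(model_integral (w\<^sup>2) 1 \<longlongrightarrow> 2 * pi / w) at_top"
proof -
  have w0: "w \<noteq> 0" using w by auto
  let ?L = "\<lambda>z. (Ln (1 + \<i> * w * z) - Ln (1 - \<i> * w * z)) / (\<i> * w)"
  have nn: "1 + \<i> * w * of_real r \<notin> \<real>\<^sub>\<le>\<^sub>0" "1 - \<i> * w * of_real r \<notin> \<real>\<^sub>\<le>\<^sub>0" for r
    using w by (auto simp: complex_nonpos_Reals_iff)
  have der: "((\<lambda>u. ?L (of_real (sinh (u / 2)))) has_vector_derivative
      (of_real (cosh (u / 2)) / (1 + w\<^sup>2 * of_real (sinh (u / 2)) ^ 2) ^ 1)) (at u within {-U..U})" for u U
  proof -
    let ?z = "complex_of_real (sinh (u / 2))"
    have p: "1 + \<i> * w * ?z \<noteq> 0" "1 - \<i> * w * ?z \<noteq> 0" using nn[of "sinh (u / 2)"] by auto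
    have "(?L has_field_derivative ((\<i> * w / (1 + \<i> * w * ?z) - (- (\<i> * w)) / (1 - \<i> * w * ?z)) / (\<i> * w))) (at ?z)"
      using nn[of "sinh (u / 2)"] w0 by (auto intro!: derivative_eq_intros simp: field_simps)
    also have "(\<i> * w / (1 + \<i> * w * ?z) - (- (\<i> * w)) / (1 - \<i> * w * ?z)) / (\<i> * w)
        = 1 / (1 + \<i> * w * ?z) + 1 / (1 - \<i> * w * ?z)"
      using w0 by (simp add: add_divide_distrib diff_divide_distrib)
    also have "\<dots> = 2 / ((1 + \<i> * w * ?z) * (1 - \<i> * w * ?z))"
      using p by (simp add: divide_simps)
    also have "(1 + \<i> * w * ?z) * (1 - \<i> * w * ?z) = 1 + w\<^sup>2 * ?z ^ 2"
      by (simp add: algebra_simps power2_eq_square)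
    finally have "(?L has_field_derivative (2 / (1 + w\<^sup>2 * ?z ^ 2))) (at ?z)" .
    from half_sinh_chain[OF this, of "{-U..U}"] show ?thesis by simp
  qed
  have val: "model_integral (w\<^sup>2) 1 U = 2 * ?L (of_real (sinh (U / 2)))" if "U \<ge> 0" for U
  proof -
    have "((\<lambda>u. of_real (cosh (u / 2)) / (1 + w\<^sup>2 * of_real (sinh (u / 2)) ^ 2) ^ 1) has_integral
       (?L (of_real (sinh (U / 2))) - ?L (of_real (sinh (- U / 2))))) {-U..U}"
      by (rule fundamental_theorem_of_calculus[OF _ der]) (use that in auto)
    then have "model_integral (w\<^sup>2) 1 U = ?L (of_real (sinh (U / 2))) - ?L (of_real (sinh (- U / 2)))"
      unfolding model_integral_def by (rule integral_unique)
    also have "complex_of_real (sinh (- U / 2)) = - of_real (sinh (U / 2))" by simp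
    also have "?L (- of_real (sinh (U / 2))) = - ?L (of_real (sinh (U / 2)))"
      by (simp add: diff_divide_distrib)
    finally show ?thesis by simp
  qed
  have Lr: "?L (of_real r) = (Ln (of_real (1 / r) + \<i> * w) - Ln (of_real (1 / r) - \<i> * w)) / (\<i> * w)" if r: "r > 0" for r
  proof -
    have "Ln (1 + \<i> * w * of_real r) = of_real (ln r) + Ln (of_real (1 / r) + \<i> * w)"
    proof -
      have f: "of_real r * (of_real (1 / r) + \<i> * w) = 1 + \<i> * w * of_real r"
        using r by (simp add: distrib_left)
      then have "of_real (1 / r) + \<i> * w \<noteq> 0" using nn(1)[of r] by auto
      from Ln_times_of_real[OF r this] show ?thesis unfolding f Ln_of_real[OF r] .
    qed
    moreover have "Ln (1 - \<i> * w * of_real r) = of_real (ln r) + Ln (of_real (1 / r) - \<i> * w)"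
    proof -
      have f: "of_real r * (of_real (1 / r) - \<i> * w) = 1 - \<i> * w * of_real r"
        using r by (simp add: right_diff_distrib)
      then have "of_real (1 / r) - \<i> * w \<noteq> 0" using nn(2)[of r] by auto
      from Ln_times_of_real[OF r this] show ?thesis unfolding f Ln_of_real[OF r] .
    qed
    ultimately show ?thesis by simp
  qed
  have "((\<lambda>r. (Ln (of_real (1 / r) + \<i> * w) - Ln (of_real (1 / r) - \<i> * w)) / (\<i> * w))
      \<longlongrightarrow> (Ln (of_real 0 + \<i> * w) - Ln (of_real 0 - \<i> * w)) / (\<i> * w)) at_top"
  proof -
    have "((\<lambda>r::real. 1 / r) \<longlongrightarrow> 0) at_top" by real_asymp
    then show ?thesis
      using w w0 by (intro tendsto_intros) (auto simp: complex_nonpos_Reals_iff)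
  qed
  also have "(Ln (of_real 0 + \<i> * w) - Ln (of_real 0 - \<i> * w)) / (\<i> * w) = pi / w"
  proof -
    have "Ln (- (\<i> * w)) = Ln (\<i> * w) - \<i> * pi"
      using w w0 by (subst Ln_minus) auto
    then show ?thesis using w0 by simp
  qed
  finally have "((\<lambda>r. (Ln (of_real (1 / r) + \<i> * w) - Ln (of_real (1 / r) - \<i> * w)) / (\<i> * w)) \<longlongrightarrow> pi / w) at_top" .
  then have "((\<lambda>r. ?L (of_real r)) \<longlongrightarrow> pi / w) at_top"
  proof (rule Lim_transform_eventually)
    show "\<forall>\<^sub>F r in at_top. (Ln (of_real (1 / r) + \<i> * w) - Ln (of_real (1 / r) - \<i> * w)) / (\<i> * w) = ?L (of_real r)"
      by (rule eventually_mono[OF eventually_gt_at_top[of 0]]) (rule Lr[symmetric])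
  qed
  then have "((\<lambda>U. ?L (of_real (sinh (U / 2)))) \<longlongrightarrow> pi / w) at_top"
    by (rule filterlim_compose[OF _ sinh_half_at_top])
  then have "((\<lambda>U. 2 * ?L (of_real (sinh (U / 2)))) \<longlongrightarrow> 2 * (pi / w)) at_top"
    by (rule tendsto_mult[OF tendsto_const])
  then have "(model_integral (w\<^sup>2) 1 \<longlongrightarrow> 2 * (pi / w)) at_top"
  proof (rule Lim_transform_eventually)
    show "\<forall>\<^sub>F U in at_top. 2 * ?L (of_real (sinh (U / 2))) = model_integral (w\<^sup>2) 1 U"
      by (rule eventually_mono[OF eventually_ge_at_top[of 0]]) (rule val[symmetric])
  qed
  then show ?thesis by simp
qed

lemma model_integral_limit:
  fixes w :: complex
  assumes w: "Re w > 0" and \<kappa>: "Re (w\<^sup>2) > 0"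
  shows "(model_integral (w\<^sup>2) (Suc m) \<longlongrightarrow>
    of_real (2 * sqrt pi * (Gamma (real m + 1 / 2) / Gamma (real m + 1))) / w) at_top"
proof (induction m)
  case 0
  have "sqrt pi * sqrt pi = pi" by simp
  then show ?case using model_integral_1_limit[OF assms] by (simp add: Gamma_one_half_real mult.assoc)
next
  case (Suc m)
  let ?M = "complex_of_nat (Suc m)"
  have bd: "((\<lambda>U. 4 * of_real (sinh (U / 2)) / (1 + w\<^sup>2 * of_real (sinh (U / 2)) ^ 2) ^ Suc m) \<longlongrightarrow> 0) at_top"
  proof (rule filterlim_compose[OF _ sinh_half_at_top])
    have lim: "((\<lambda>r::real. 4 / (Re (w\<^sup>2) * r)) \<longlongrightarrow> 0) at_top" using \<kappa> by real_asymp
    show "((\<lambda>r. 4 * of_real r / (1 + w\<^sup>2 * of_real r ^ 2) ^ Suc m) \<longlongrightarrow> 0) at_top"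
    proof (rule Lim_null_comparison[OF _ lim], rule eventually_mono[OF eventually_gt_at_top[of 0]])
      fix r :: real assume r: "r > 0"
      have q1: "1 + Re (w\<^sup>2) * r\<^sup>2 \<ge> 1" using \<kappa> by simp
      have "Re (w\<^sup>2) * r\<^sup>2 \<le> (1 + Re (w\<^sup>2) * r\<^sup>2) ^ 1" by simp
      also have "\<dots> \<le> (1 + Re (w\<^sup>2) * r\<^sup>2) ^ Suc m"
        using q1 by (intro power_increasing) auto
      also have "\<dots> \<le> norm (1 + w\<^sup>2 * of_real r ^ 2) ^ Suc m"
        using model_denominator(1)[OF \<kappa>, of r] q1 by (intro power_mono) auto
      finally have "norm (4 * of_real r / (1 + w\<^sup>2 * of_real r ^ 2) ^ Suc m) \<le> 4 * r / (Re (w\<^sup>2) * r\<^sup>2)"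
        using r \<kappa> unfolding norm_divide norm_power norm_mult
        by (intro frac_le) (auto intro!: mult_pos_pos)
      also have "\<dots> = 4 / (Re (w\<^sup>2) * r)" using r by (simp add: power2_eq_square)
      finally show "norm (4 * of_real r / (1 + w\<^sup>2 * of_real r ^ 2) ^ Suc m) \<le> 4 / (Re (w\<^sup>2) * r)" .
    qed
  qed
  have "((\<lambda>U. ((2 * ?M - 1) * model_integral (w\<^sup>2) (Suc m) U
      + 4 * of_real (sinh (U / 2)) / (1 + w\<^sup>2 * of_real (sinh (U / 2)) ^ 2) ^ Suc m) / (2 * ?M))
    \<longlongrightarrow> ((2 * ?M - 1) * (of_real (2 * sqrt pi * (Gamma (real m + 1 / 2) / Gamma (real m + 1))) / w) + 0) / (2 * ?M)) at_top"
    by (intro tendsto_intros Suc bd) (simp only: mult_eq_0_iff of_nat_eq_0_iff, simp)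
  then have "(model_integral (w\<^sup>2) (Suc (Suc m)) \<longlongrightarrow>
      ((2 * ?M - 1) * (of_real (2 * sqrt pi * (Gamma (real m + 1 / 2) / Gamma (real m + 1))) / w) + 0) / (2 * ?M)) at_top"
  proof (rule Lim_transform_eventually, intro eventually_mono[OF eventually_ge_at_top[of 0]])
    fix U :: real assume "0 \<le> U"
    from model_integral_Suc[OF \<kappa> this, of "Suc m"]
    have "2 * ?M * model_integral (w\<^sup>2) (Suc (Suc m)) U = (2 * ?M - 1) * model_integral (w\<^sup>2) (Suc m) U
      + 4 * of_real (sinh (U / 2)) / (1 + w\<^sup>2 * of_real (sinh (U / 2)) ^ 2) ^ Suc m" by simp
    then show "((2 * ?M - 1) * model_integral (w\<^sup>2) (Suc m) U
      + 4 * of_real (sinh (U / 2)) / (1 + w\<^sup>2 * of_real (sinh (U / 2)) ^ 2) ^ Suc m) / (2 * ?M)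
      = model_integral (w\<^sup>2) (Suc (Suc m)) U"
      by (metis nonzero_mult_div_cancel_left mult_eq_0_iff of_nat_neq_0 zero_neq_numeral)
  qed
  moreover have "((2 * ?M - 1) * (of_real (2 * sqrt pi * (Gamma (real m + 1 / 2) / Gamma (real m + 1))) / w) + 0) / (2 * ?M)
      = of_real (2 * sqrt pi * (Gamma (real (Suc m) + 1 / 2) / Gamma (real (Suc m) + 1))) / w"
  proof -
    have g: "Gamma (real (Suc m) + 1 / 2) = (real m + 1 / 2) * Gamma (real m + 1 / 2)"
      "Gamma (real (Suc m) + 1) = real (Suc m) * Gamma (real m + 1)"
      using Gamma_plus1_pos[of "real m + 1 / 2"] Gamma_plus1_pos[of "real m + 1"] by (simp_all add: algebra_simps)
    have "(2 * real (Suc m) - 1) * (2 * sqrt pi * (G / H)) / (2 * real (Suc m))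
        = 2 * sqrt pi * (((real m + 1 / 2) * G) / (real (Suc m) * H))" for G H :: real
      by (simp add: field_simps)
    from arg_cong[OF this, of complex_of_real "Gamma (real m + 1 / 2)" "Gamma (real m + 1)"]
    have "(2 * ?M - 1) * of_real (2 * sqrt pi * (Gamma (real m + 1 / 2) / Gamma (real m + 1))) / (2 * ?M)
      = of_real (2 * sqrt pi * (Gamma (real (Suc m) + 1 / 2) / Gamma (real (Suc m) + 1)))"
      unfolding g of_real_mult of_real_divide of_real_diff of_real_of_nat_eq of_real_numeral of_real_1 .
    then have h: "((2 * ?M - 1) * of_real (2 * sqrt pi * (Gamma (real m + 1 / 2) / Gamma (real m + 1))) / (2 * ?M)) / w
      = of_real (2 * sqrt pi * (Gamma (real (Suc m) + 1 / 2) / Gamma (real (Suc m) + 1))) / w"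
      by (rule arg_cong)
    have "(c * (x / w) + 0) / d = c * x / d / w" for c x d by simp
    then show ?thesis unfolding h[symmetric] .
  qed
  ultimately show ?case by simp
qed

section \<open>Darboux asymptotics\<close>

text \<open>Near \<open>0\<close> the linear Taylor terms cancel and \<open>x^2\<close> remains; away from \<open>0\<close> the factor \<open>x^2\<close> is
  bounded below and the growth hypothesis suffices.\<close>

lemma symmetric_second_difference_bound:
  assumes U: "open U" "\<And>x. complex_of_real x \<in> U" and f: "f holomorphic_on U"
    and K: "K \<ge> 0" and C: "\<And>x. norm (f (of_real x)) \<le> C * exp (K * \<bar>x\<bar>)"
  shows "\<exists>C'\<ge>0. \<forall>x. norm (f (of_real x) + f (of_real (- x)) - 2 * f 0) \<le> C' * (x\<^sup>2 * exp (K * \<bar>x\<bar>))"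
proof -
  have "0 \<in> U" using U(2)[of 0] by simp
  from holomorphic_taylor_remainder[OF U(1) f this, of 2] obtain k g
    where g: "g holomorphic_on U" and eq: "\<And>z. z \<in> U \<Longrightarrow> f z = (\<Sum>j<2. k j * (z - 0) ^ j) + (z - 0) ^ 2 * g z"
    by blast
  have f2: "f z = k 0 + k 1 * z + z\<^sup>2 * g z" if "z \<in> U" for z
    using eq[OF that] by (simp add: numeral_2_eq_2)
  have f0: "f 0 = k 0" using f2[OF \<open>0 \<in> U\<close>] by simp
  have "continuous_on {-1..1} (\<lambda>x. g (of_real x))"
    by (rule continuous_on_compose2[OF holomorphic_on_imp_continuous_on[OF g]])
       (use U(2) in \<open>auto intro!: continuous_intros\<close>)
  then have "bounded ((\<lambda>x. g (of_real x)) ` {-1..1::real})"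
    by (intro compact_imp_bounded compact_continuous_image) auto
  then obtain M where M: "\<And>x. x \<in> {-1..1::real} \<Longrightarrow> norm (g (of_real x)) \<le> M"
    unfolding bounded_iff by blast
  have M0: "M \<ge> 0" 
  proof -
    have "norm (g (of_real 0)) \<le> M" by (rule M) simp
    then show ?thesis by (rule order_trans[OF norm_ge_zero])
  qed
  have C0: "C \<ge> 0" using order_trans[OF norm_ge_zero C[of 0]] by simp
  show ?thesis
  proof (intro exI[of _ "2 * M + 4 * C"] conjI allI)
    fix x :: real
    have e1: "exp (K * \<bar>x\<bar>) \<ge> 1" using K by simp
    show "norm (f (of_real x) + f (of_real (- x)) - 2 * f 0) \<le> (2 * M + 4 * C) * (x\<^sup>2 * exp (K * \<bar>x\<bar>))"
    proof (cases "\<bar>x\<bar> \<le> 1")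
      case True
      have "f (of_real x) + f (of_real (- x)) - 2 * f 0 = of_real x ^ 2 * (g (of_real x) + g (of_real (- x)))"
        unfolding f2[OF U(2)[of x]] f2[OF U(2)[of "-x"]] f0 by (simp add: algebra_simps)
      then have "norm (f (of_real x) + f (of_real (- x)) - 2 * f 0) = x\<^sup>2 * norm (g (of_real x) + g (of_real (- x)))"
        by (simp add: norm_mult norm_power)
      also have "\<dots> \<le> x\<^sup>2 * (M + M)"
        using True by (intro mult_left_mono order.trans[OF norm_triangle_ineq] add_mono M) auto
      also have "\<dots> \<le> (2 * M + 4 * C) * (x\<^sup>2 * 1)" using C0 by (simp add: algebra_simps)
      also have "\<dots> \<le> (2 * M + 4 * C) * (x\<^sup>2 * exp (K * \<bar>x\<bar>))"
        using e1 M0 C0 by (intro mult_left_mono) auto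
      finally show ?thesis .
    next
      case False
      then have x1: "x\<^sup>2 \<ge> 1" using abs_le_square_iff[of 1 x] by simp
      have "norm (f (of_real x) + f (of_real (- x)) - 2 * f 0)
          \<le> norm (f (of_real x)) + norm (f (of_real (- x))) + norm (2 * f 0)"
        by (rule order.trans[OF norm_triangle_ineq4 add_right_mono[OF norm_triangle_ineq]])
      also have "\<dots> \<le> C * exp (K * \<bar>x\<bar>) + C * exp (K * \<bar>x\<bar>) + 2 * (C * exp (K * \<bar>x\<bar>))"
      proof (intro add_mono)
        show "norm (f (of_real (- x))) \<le> C * exp (K * \<bar>x\<bar>)" using C[of "-x"] by simp
        have "norm (2 * f 0) \<le> 2 * (C * 1)" using C[of 0] by (simp add: norm_mult)
        also have "\<dots> \<le> 2 * (C * exp (K * \<bar>x\<bar>))" using e1 C0 by (intro mult_left_mono) auto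
        finally show "norm (2 * f 0) \<le> 2 * (C * exp (K * \<bar>x\<bar>))" .
      qed (rule C)
      also have "\<dots> = 4 * C * (1 * exp (K * \<bar>x\<bar>))" by simp
      also have "\<dots> \<le> (2 * M + 4 * C) * (x\<^sup>2 * exp (K * \<bar>x\<bar>))"
        using x1 M0 C0 by (intro mult_mono) auto
      finally show ?thesis .
    qed
  qed (use M0 C0 in simp)
qed

lemma abs_half_le_sinh: "(u::real)\<^sup>2 \<le> 4 * (sinh (u / 2))\<^sup>2"
proof -
  have le: "x \<le> sinh x" if "x \<ge> 0" for x :: real
  proof -
    have "(\<lambda>x. sinh x - x) 0 \<le> (\<lambda>x. sinh x - x) x"
      by (rule DERIV_nonneg_imp_nondecreasing[OF that])
         (auto intro!: exI derivative_eq_intros cosh_real_ge_1)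
    then show ?thesis by simp
  qed
  have "(\<bar>u\<bar> / 2)\<^sup>2 \<le> (sinh (\<bar>u\<bar> / 2))\<^sup>2" by (intro power_mono le) auto
  moreover have "(sinh (\<bar>u\<bar> / 2))\<^sup>2 = (sinh (u / 2))\<^sup>2" by (cases "u \<ge> 0") auto
  ultimately show ?thesis by (simp add: power_divide)
qed

text \<open>Exponential growth of the amplitude is paid for by finitely many of the \<open>n\<close> powers in the
  denominator of the model.\<close>

lemma exp_abs_le_cosh_power:
  assumes "K \<le> real k"
  shows "exp (K * \<bar>u\<bar>) \<le> 4 ^ k * (1 + (sinh (u / 2))\<^sup>2) ^ k"
proof -
  have "exp (K * \<bar>u\<bar>) \<le> exp (real k * \<bar>u\<bar>)" using assms by (simp add: mult_right_mono)
  also have "\<dots> = ((exp (\<bar>u\<bar> / 2))\<^sup>2) ^ k"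
  proof -
    have "(exp (\<bar>u\<bar> / 2))\<^sup>2 = exp \<bar>u\<bar>" using exp_double[of "\<bar>u\<bar> / 2"] by simp
    then show ?thesis by (simp only: exp_of_nat_mult)
  qed
  also have "\<dots> \<le> ((2 * cosh (u / 2))\<^sup>2) ^ k"
  proof (intro power_mono)
    have "exp (\<bar>u\<bar> / 2) \<le> 2 * cosh (\<bar>u\<bar> / 2)" by (simp add: cosh_field_def)
    also have "cosh (\<bar>u\<bar> / 2) = cosh (u / 2)" by (cases "u \<ge> 0") auto
    finally show "exp (\<bar>u\<bar> / 2) \<le> 2 * cosh (u / 2)" .
  qed auto
  also have "(2 * cosh (u / 2))\<^sup>2 = 4 * (1 + (sinh (u / 2))\<^sup>2)"
    by (simp add: power_mult_distrib cosh_square_eq)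
  also have "(4 * (1 + (sinh (u / 2))\<^sup>2)) ^ k = 4 ^ k * (1 + (sinh (u / 2))\<^sup>2) ^ k"
    by (rule power_mult_distrib)
  finally show ?thesis .
qed

text \<open>The part of the integrand on the line \<open>Im \<zeta> = \<pi> / 2\<close> that does not depend on \<open>n\<close>, divided by
  \<open>cosh (\<zeta> / 2)\<close>, which the model integral supplies. Here \<open>V\<close> is the value of \<open>v\<close> at
  \<open>\<zeta> + i \<pi> / 2\<close>.\<close>

definition darboux_amp :: "real \<Rightarrow> real \<Rightarrow> real \<Rightarrow> complex \<Rightarrow> complex" where
  "darboux_amp a b \<theta> \<zeta> =
     (let V = \<i> * of_real (cos (\<theta> / 2) / sin (\<theta> / 2)) * exp \<zeta>
      in V powr of_real a * (of_real ((cos (\<theta> / 2))\<^sup>2) + of_real ((sin (\<theta> / 2))\<^sup>2) * V) powr of_real (- (a + b))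
           * (2 / (exp (\<zeta> / 2) + exp (- (\<zeta> / 2)))))"

definition darboux_kappa :: "real \<Rightarrow> complex" where
  "darboux_kappa \<theta> = of_real (2 * sin \<theta>) * cis (pi / 2 - \<theta>)"

text \<open>On the line \<open>Im \<zeta> = \<pi> / 2\<close> the base of the power \<open>n + 1\<close> is
  \<open>v / ((v - 1) (c^2 + s^2 v)) = 1 / (cos \<theta> + i sin \<theta> cosh u)\<close>. By \<open>cosh u = 1 + 2 sinh(u/2)^2\<close>
  its reciprocal is \<open>exp(i \<theta>)\<close> times the model denominator.\<close>

lemma jintegrand_factorization:
  assumes \<theta>: "0 < \<theta>" "\<theta> < pi"
  shows "jintegrand a b \<theta> n (Complex u (pi / 2)) =
     cis (- (real (Suc n) * \<theta>)) *
       (of_real (cosh (u / 2)) / (1 + darboux_kappa \<theta> * of_real (sinh (u / 2)) ^ 2) ^ Suc n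
         * darboux_amp a b \<theta> (of_real u))"
proof -
  define s c where "s = sin (\<theta> / 2)" and "c = cos (\<theta> / 2)"
  have sc: "s > 0" "c > 0" using half_angle_pos[OF \<theta>] by (simp_all add: s_def c_def)
  define E where "E = exp u"
  define V where "V = \<i> * of_real (c / s) * of_real E"
  define w where "w = of_real (c\<^sup>2) + of_real (s\<^sup>2) * V"
  have E: "E > 0" by (simp add: E_def)
  have Vp: "jpoint \<theta> (Complex u (pi / 2)) = V"
    by (simp add: jpoint_def V_def E_def s_def c_def complex_eq_iff Re_exp Im_exp)
  have V0: "V \<noteq> 0" using sc E by (simp add: V_def)
  have "Im w = s\<^sup>2 * (c / s * E)" by (simp add: w_def V_def)
  then have w0: "w \<noteq> 0" using sc E by (auto simp: complex_eq_iff)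
  have V1: "V - 1 \<noteq> 0" by (auto simp: V_def complex_eq_iff)
  have sin_eq: "sin \<theta> = 2 * s * c" and cos_eq: "cos \<theta> = c\<^sup>2 - s\<^sup>2"
    using sin_double[of "\<theta> / 2"] cos_double[of "\<theta> / 2"] by (simp_all add: s_def c_def)
  let ?q = "1 + darboux_kappa \<theta> * of_real (sinh (u / 2)) ^ 2"
  have ck: "cis \<theta> * ?q = of_real (cos \<theta>) + \<i> * of_real (sin \<theta>) * of_real (cosh u)"
  proof -
    have k: "cis \<theta> * darboux_kappa \<theta> = 2 * \<i> * of_real (sin \<theta>)"
      by (simp add: darboux_kappa_def mult.left_commute[of "cis \<theta>"] cis_mult)
    have ch: "cosh u = 1 + 2 * (sinh (u / 2))\<^sup>2"
      using cosh_double[of "u / 2"] cosh_square_eq[of "u / 2"] by simp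
    have "cis \<theta> * ?q = cis \<theta> + (cis \<theta> * darboux_kappa \<theta>) * of_real ((sinh (u / 2))\<^sup>2)"
      by (simp add: algebra_simps)
    also have "\<dots> = of_real (cos \<theta>) + \<i> * of_real (sin \<theta>) * of_real (cosh u)"
      unfolding k ch by (simp add: complex_eq_iff algebra_simps)
    finally show ?thesis .
  qed
  have prod: "w * (V - 1) = V * (cis \<theta> * ?q)"
  proof -
    have ch: "complex_of_real (cosh u) = (of_real E + 1 / of_real E) / 2"
      by (simp add: cosh_field_def E_def exp_minus exp_of_real field_simps)
    have "(C\<^sup>2 + S\<^sup>2 * (\<i> * (C / S) * e)) * (\<i> * (C / S) * e - 1)
        = (\<i> * (C / S) * e) * ((C\<^sup>2 - S\<^sup>2) + \<i> * (2 * S * C) * ((e + 1 / e) / 2))"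
      if "S \<noteq> 0" "e \<noteq> 0" for C S e :: complex
    proof -
      have "(C\<^sup>2 + S\<^sup>2 * (\<i> * (C / S) * e)) = C\<^sup>2 + \<i> * (S * C * e)"
        using that by (simp add: power2_eq_square)
      moreover have "(C\<^sup>2 + \<i> * (S * C * e)) * (\<i> * (C / S) * e - 1)
          = \<i> * (C * C\<^sup>2 * e / S) - C\<^sup>2 - C\<^sup>2 * e\<^sup>2 - \<i> * (S * C * e)"
        using that by (simp add: power2_eq_square algebra_simps)
      moreover have "(\<i> * (C / S) * e) * ((C\<^sup>2 - S\<^sup>2) + \<i> * (2 * S * C) * ((e + 1 / e) / 2))
          = \<i> * (C * C\<^sup>2 * e / S) - C\<^sup>2 - C\<^sup>2 * e\<^sup>2 - \<i> * (S * C * e)"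
        using that by (simp add: power2_eq_square field_simps)
      ultimately show ?thesis by simp
    qed
    from this[of "of_real s" "of_real E" "of_real c"]
    have wV: "w * (V - 1) = V * ((of_real (c\<^sup>2 - s\<^sup>2)) + \<i> * of_real (2 * s * c) * ((of_real E + 1 / of_real E) / 2))"
      using sc E unfolding w_def V_def by simp
    show ?thesis unfolding ck sin_eq cos_eq ch wV ..
  qed
  have q0: "?q \<noteq> 0" using prod w0 V1 by auto
  have "V / (w * (V - 1)) = cis (- \<theta>) / ?q"
  proof -
    have "v / (v * (e * q)) = inverse e / q" if "v \<noteq> 0" for v e q :: complex
      using that by (simp add: divide_inverse)
    from this[OF V0, of "cis \<theta>" ?q] show ?thesis unfolding prod cis_inverse .
  qed
  then have ratio: "V ^ Suc n / (w ^ Suc n * (V - 1) ^ Suc n) = cis (- (real (Suc n) * \<theta>)) / ?q ^ Suc n"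
    by (simp only: power_divide[symmetric] power_mult_distrib[symmetric])
       (simp only: power_divide Complex.DeMoivre mult_minus_right)
  have p1: "V powr of_real (real n + a) = V ^ n * V powr of_real a"
    using V0 by (simp add: powr_add)
  have p2: "w powr of_real (- (real n + a + b + 1)) = w powr of_real (- (a + b)) / w ^ Suc n"
  proof -
    have "complex_of_real (- (real n + a + b + 1)) = of_real (- (a + b)) - of_nat (Suc n)" by simp
    then have "w powr of_real (- (real n + a + b + 1)) = w powr of_real (- (a + b)) / w powr of_nat (Suc n)"
      by (simp only: powr_diff)
    also have "w powr of_nat (Suc n) = w ^ Suc n" by (rule powr_nat') (use w0 in simp)
    finally show ?thesis .
  qed
  have am: "of_real (cosh (u / 2)) * darboux_amp a b \<theta> (of_real u) = V powr of_real a * w powr of_real (- (a + b))"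
  proof -
    have h: "exp (complex_of_real u / 2) + exp (- (complex_of_real u / 2)) = of_real (2 * cosh (u / 2))"
      by (simp add: cosh_field_def flip: exp_of_real)
    have cp: "cosh (u / 2) > 0" by (rule cosh_real_pos)
    show ?thesis
      unfolding darboux_amp_def Let_def h using cp
      by (simp add: V_def w_def E_def s_def c_def exp_of_real)
  qed
  have "jintegrand a b \<theta> n (Complex u (pi / 2))
      = V * (V ^ n * V powr of_real a * (w powr of_real (- (a + b)) / w ^ Suc n)) / (V - 1) ^ Suc n"
    unfolding jintegrand_def jgen_def Vp p1[symmetric] p2[symmetric] by (simp add: w_def s_def c_def)
  also have "\<dots> = (V ^ Suc n / (w ^ Suc n * (V - 1) ^ Suc n)) * (V powr of_real a * w powr of_real (- (a + b)))"
    by (simp add: mult_ac)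
  also have "\<dots> = cis (- (real (Suc n) * \<theta>)) / ?q ^ Suc n * (of_real (cosh (u / 2)) * darboux_amp a b \<theta> (of_real u))"
    unfolding ratio am ..
  finally show ?thesis by (simp add: mult_ac)
qed

lemma darboux_amp_properties:
  assumes \<theta>: "0 < \<theta>" "\<theta> < pi"
  shows "darboux_amp a b \<theta> holomorphic_on {z. - (pi / 2) < Im z \<and> Im z < pi / 2}"
    and "\<exists>C. \<forall>x. norm (darboux_amp a b \<theta> (of_real x)) \<le> C * exp ((\<bar>a\<bar> + \<bar>a + b\<bar>) * \<bar>x\<bar>)"
proof -
  define s c where "s = sin (\<theta> / 2)" and "c = cos (\<theta> / 2)"
  have sc: "s > 0" "c > 0" using half_angle_pos[OF \<theta>] by (simp_all add: s_def c_def)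
  let ?V = "\<lambda>\<zeta>. \<i> * complex_of_real (c / s) * exp \<zeta>"
  let ?w = "\<lambda>\<zeta>. of_real (c\<^sup>2) + of_real (s\<^sup>2) * ?V \<zeta>"
  let ?D = "\<lambda>\<zeta>::complex. exp (\<zeta> / 2) + exp (- (\<zeta> / 2))"
  have amp: "darboux_amp a b \<theta> = (\<lambda>\<zeta>. ?V \<zeta> powr of_real a * ?w \<zeta> powr of_real (- (a + b)) * (2 / ?D \<zeta>))"
    by (simp add: darboux_amp_def Let_def s_def c_def fun_eq_iff)
  show "darboux_amp a b \<theta> holomorphic_on {z. - (pi / 2) < Im z \<and> Im z < pi / 2}" (is "_ holomorphic_on ?S")
  proof -
    have Vim: "Im (?V z) > 0" if "z \<in> ?S" for z
      using that sc by (simp add: Re_exp cos_gt_zero_pi)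
    have V: "?V z \<notin> \<real>\<^sub>\<le>\<^sub>0" if "z \<in> ?S" for z
      using Vim[OF that] by (auto simp: complex_nonpos_Reals_iff simp del: Im_divide)
    have w: "?w z \<notin> \<real>\<^sub>\<le>\<^sub>0" if "z \<in> ?S" for z
    proof -
      have "Im (?w z) = s\<^sup>2 * Im (?V z)" by simp
      also have "\<dots> > 0" using Vim[OF that] sc by (intro mult_pos_pos) auto
      finally show ?thesis by (auto simp: complex_nonpos_Reals_iff)
    qed
    have D: "?D z \<noteq> 0" if "z \<in> ?S" for z
    proof -
      have "cos (Im z / 2) > 0" using that pi_gt_zero by (intro cos_gt_zero_pi) auto
      then have "Re (?D z) > 0" by (simp add: Re_exp) (intro add_pos_pos mult_pos_pos, auto)
      then show ?thesis by (metis zero_complex.sel(1) less_irrefl)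
    qed
    show ?thesis unfolding amp by (intro holomorphic_intros V w D) auto
  qed
  let ?p = "- (a + b)"
  let ?C = "(c / s) powr a * max (2 powr ?p) ((c\<^sup>2) powr ?p)"
  have "norm (darboux_amp a b \<theta> (of_real x)) \<le> ?C * exp ((\<bar>a\<bar> + \<bar>a + b\<bar>) * \<bar>x\<bar>)" for x
  proof -
    have nV: "norm (?V (of_real x)) = c / s * exp x"
      using sc by (simp add: norm_mult norm_divide exp_of_real)
    have "norm (?V (of_real x) powr of_real a) = (c / s * exp x) powr a"
      by (subst norm_powr_real_powr') (simp_all only: nV Re_complex_of_real Reals_of_real)
    also have "\<dots> = (c / s) powr a * exp (a * x)"
      using sc by (subst powr_mult) (auto simp: powr_def[of "exp x"])
    also have "\<dots> \<le> (c / s) powr a * exp (\<bar>a\<bar> * \<bar>x\<bar>)"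
      by (intro mult_left_mono) (auto simp: abs_mult[symmetric])
    finally have 1: "norm (?V (of_real x) powr of_real a) \<le> (c / s) powr a * exp (\<bar>a\<bar> * \<bar>x\<bar>)" .
    have lo: "c\<^sup>2 \<le> norm (?w (of_real x))"
    proof -
      have "Re (?w (of_real x)) = c\<^sup>2" by (simp add: Im_exp)
      then show ?thesis by (metis complex_Re_le_cmod)
    qed
    have up: "norm (?w (of_real x)) \<le> 2 * exp \<bar>x\<bar>"
    proof -
      have "norm (?w (of_real x)) \<le> norm (complex_of_real (c\<^sup>2)) + norm (of_real (s\<^sup>2) * ?V (of_real x))"
        by (rule norm_triangle_ineq)
      also have "\<dots> = c\<^sup>2 + s\<^sup>2 * (c / s * exp x)"
        by (simp only: norm_mult[of "of_real (s\<^sup>2)"] nV norm_of_real) simp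
      also have "\<dots> = c\<^sup>2 + s * c * exp x" using sc by (simp add: power2_eq_square)
      also have "\<dots> \<le> 1 * exp \<bar>x\<bar> + 1 * exp \<bar>x\<bar>"
      proof (intro add_mono)
        have "c\<^sup>2 \<le> 1" using sc by (simp add: c_def power_le_one)
        then show "c\<^sup>2 \<le> 1 * exp \<bar>x\<bar>" using one_le_exp_iff[of "\<bar>x\<bar>"] by linarith
        have "s * c \<le> 1" using sc by (simp add: s_def c_def mult_le_one)
        then show "s * c * exp x \<le> 1 * exp \<bar>x\<bar>" using sc by (intro mult_mono) auto
      qed
      finally show ?thesis by simp
    qed
    have nw: "norm (?w (of_real x) powr of_real ?p) = norm (?w (of_real x)) powr ?p"
      by (subst norm_powr_real_powr') auto
    have 2: "norm (?w (of_real x) powr of_real ?p) \<le> max (2 powr ?p) ((c\<^sup>2) powr ?p) * exp (\<bar>a + b\<bar> * \<bar>x\<bar>)"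
    proof (cases "?p \<ge> 0")
      case True
      then have "norm (?w (of_real x)) powr ?p \<le> (2 * exp \<bar>x\<bar>) powr ?p"
        using up by (intro powr_mono2) auto
      also have "\<dots> = 2 powr ?p * exp (?p * \<bar>x\<bar>)" by (simp add: powr_mult powr_def[of "exp \<bar>x\<bar>"])
      also have "\<dots> \<le> max (2 powr ?p) ((c\<^sup>2) powr ?p) * exp (\<bar>a + b\<bar> * \<bar>x\<bar>)"
        using True by (intro mult_mono) (auto simp: le_max_iff_disj)
      finally show ?thesis unfolding nw .
    next
      case False
      then have "norm (?w (of_real x)) powr ?p \<le> (c\<^sup>2) powr ?p * 1"
        using lo sc by (subst mult_1_right, intro powr_mono2') auto
      also have "\<dots> \<le> max (2 powr ?p) ((c\<^sup>2) powr ?p) * exp (\<bar>a + b\<bar> * \<bar>x\<bar>)"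
        by (intro mult_mono) (auto simp: le_max_iff_disj)
      finally show ?thesis unfolding nw .
    qed
    have 3: "norm (2 / ?D (of_real x)) \<le> 1"
    proof -
      have "?D (of_real x) = of_real (2 * cosh (x / 2))"
        by (simp add: cosh_field_def flip: exp_of_real)
      then show ?thesis using cosh_real_ge_1[of "x / 2"] by (simp add: norm_divide norm_mult)
    qed
    have "norm (darboux_amp a b \<theta> (of_real x)) =
        norm (?V (of_real x) powr of_real a) * norm (?w (of_real x) powr of_real ?p) * norm (2 / ?D (of_real x))"
      unfolding amp by (simp only: norm_mult)
    also have "\<dots> \<le> ((c / s) powr a * exp (\<bar>a\<bar> * \<bar>x\<bar>)) * (max (2 powr ?p) ((c\<^sup>2) powr ?p) * exp (\<bar>a + b\<bar> * \<bar>x\<bar>)) * 1"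
      by (intro mult_mono 1 2 3) (auto intro!: mult_nonneg_nonneg simp: le_max_iff_disj)
    also have "\<dots> = ?C * exp ((\<bar>a\<bar> + \<bar>a + b\<bar>) * \<bar>x\<bar>)"
      by (simp add: distrib_right exp_add)
    finally show ?thesis .
  qed
  then show "\<exists>C. \<forall>x. norm (darboux_amp a b \<theta> (of_real x)) \<le> C * exp ((\<bar>a\<bar> + \<bar>a + b\<bar>) * \<bar>x\<bar>)" by blast
qed

definition darboux_L :: "nat \<Rightarrow> real" where
  "darboux_L m = 2 * sqrt pi * (Gamma (real m + 1 / 2) / Gamma (real m + 1))"

text \<open>\<open>Re \<kappa>\<close> equals \<open>2 (sin \<theta>)^2\<close>. Its positivity keeps the model denominator away from \<open>0\<close>, and
  the square root with positive real part is the one that occurs in the limit of the model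
  integral.\<close>

lemma darboux_kappa_sqrt:
  assumes \<theta>: "0 < \<theta>" "\<theta> < pi"
  defines "w \<equiv> of_real (sqrt (2 * sin \<theta>)) * cis (pi / 4 - \<theta> / 2)"
  shows "w\<^sup>2 = darboux_kappa \<theta>" "Re w > 0" "Re (w\<^sup>2) > 0"
proof -
  have s: "sin \<theta> > 0" using \<theta> by (intro sin_gt_zero)
  have "cis (pi / 4 - \<theta> / 2) ^ 2 = cis (pi / 2 - \<theta>)"
    by (simp only: power2_eq_square cis_mult) (rule arg_cong[of _ _ cis], simp)
  then have "w\<^sup>2 = of_real ((sqrt (2 * sin \<theta>))\<^sup>2) * cis (pi / 2 - \<theta>)"
    unfolding w_def power_mult_distrib of_real_power by simp
  also have "(sqrt (2 * sin \<theta>))\<^sup>2 = 2 * sin \<theta>" using s by simp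
  finally show 1: "w\<^sup>2 = darboux_kappa \<theta>" by (simp only: darboux_kappa_def)
  have "cos (pi / 4 - \<theta> / 2) > 0" using \<theta> by (intro cos_gt_zero_pi) auto
  then show "Re w > 0" using s by (simp add: w_def)
  have "cos (pi / 2 - \<theta>) > 0" using \<theta> by (intro cos_gt_zero_pi) auto
  then show "Re (w\<^sup>2) > 0" unfolding 1 darboux_kappa_def using s by simp
qed

lemma real_model_integral:
  assumes "\<rho> > 0"
  shows "(\<lambda>u. cosh (u / 2) / (1 + \<rho> * (sinh (u / 2))\<^sup>2) ^ m) integrable_on {-U..U}"
    and "integral {-U..U} (\<lambda>u. cosh (u / 2) / (1 + \<rho> * (sinh (u / 2))\<^sup>2) ^ m) = Re (model_integral (of_real \<rho>) m U)"
proof -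
  let ?f = "\<lambda>u::real. complex_of_real (cosh (u / 2)) / (1 + of_real \<rho> * of_real (sinh (u / 2)) ^ 2) ^ m"
  have eq: "Re \<circ> ?f = (\<lambda>u. cosh (u / 2) / (1 + \<rho> * (sinh (u / 2))\<^sup>2) ^ m)"
  proof
    fix u
    have "?f u = of_real (cosh (u / 2) / (1 + \<rho> * (sinh (u / 2))\<^sup>2) ^ m)" by simp
    then show "(Re \<circ> ?f) u = cosh (u / 2) / (1 + \<rho> * (sinh (u / 2))\<^sup>2) ^ m" by (simp only: o_def Re_complex_of_real)
  qed
  have int: "?f integrable_on {-U..U}"
    by (intro integrable_continuous_interval continuous_on_model) (use assms in simp)
  show "(\<lambda>u. cosh (u / 2) / (1 + \<rho> * (sinh (u / 2))\<^sup>2) ^ m) integrable_on {-U..U}"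
    using integrable_linear[OF int bounded_linear_Re] unfolding eq .
  show "integral {-U..U} (\<lambda>u. cosh (u / 2) / (1 + \<rho> * (sinh (u / 2))\<^sup>2) ^ m) = Re (model_integral (of_real \<rho>) m U)"
    using integral_linear[OF int bounded_linear_Re] unfolding eq model_integral_def .
qed

text \<open>Since the model factor is even, the amplitude may be replaced by its even part; subtracting
  its value at \<open>0\<close> leaves a factor \<open>u\<^sup>2\<close>, which gains one power of \<open>n\<close>.\<close>

lemma darboux_truncated_estimate:
  assumes \<theta>: "0 < \<theta>" "\<theta> < pi"
  defines "\<rho> \<equiv> Re (darboux_kappa \<theta>)"
  shows "\<exists>C k. \<forall>n U. n > k \<longrightarrow> U \<ge> 0 \<longrightarrow>
     norm (integral {-U..U} (\<lambda>u. jintegrand a b \<theta> n (Complex u (pi / 2)))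
        - cis (- (real (Suc n) * \<theta>)) * (darboux_amp a b \<theta> 0 * model_integral (darboux_kappa \<theta>) (Suc n) U))
     \<le> C * (Re (model_integral (of_real \<rho>) (n - k) U) - Re (model_integral (of_real \<rho>) (Suc n - k) U))"
proof -
  let ?\<kappa> = "darboux_kappa \<theta>" and ?f = "darboux_amp a b \<theta>" and ?K = "\<bar>a\<bar> + \<bar>a + b\<bar>"
  have \<rho>: "\<rho> > 0" using darboux_kappa_sqrt[OF \<theta>] by (simp add: \<rho>_def)
  let ?S = "{z. - (pi / 2) < Im z \<and> Im z < pi / 2}"
  have S: "open ?S"
    using open_Int[OF open_halfspace_Im_gt[of "-(pi/2)"] open_halfspace_Im_lt[of "pi/2"]]
    by (simp add: Int_def)
  have SR: "complex_of_real x \<in> ?S" for x by simp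
  note hol = darboux_amp_properties(1)[OF \<theta>, of a b]
  obtain C0 where C0: "\<And>x. norm (?f (of_real x)) \<le> C0 * exp (?K * \<bar>x\<bar>)"
    using darboux_amp_properties(2)[OF \<theta>, of a b] by blast
  obtain C1 where C1: "C1 \<ge> 0"
    and bd: "\<And>x. norm (?f (of_real x) + ?f (of_real (- x)) - 2 * ?f 0) \<le> C1 * (x\<^sup>2 * exp (?K * \<bar>x\<bar>))"
    using symmetric_second_difference_bound[OF S SR hol _ C0] by auto
  \<comment> \<open>The amplitude grows like \<open>exp (K |u|)\<close>; \<open>k\<close> powers of the denominator compensate this.\<close>
  define k where "k = nat \<lceil>?K\<rceil>"
  have k: "?K \<le> real k" unfolding k_def by linarith
  define R where "R = max 1 (1 / \<rho>)"
  have R: "R \<ge> 1" "R * \<rho> \<ge> 1" using \<rho> by (auto simp: R_def max_def field_simps)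
  define C where "C = C1 * 4 * 4 ^ k * R ^ k / \<rho>"
  have contf: "continuous_on X (\<lambda>u. ?f (of_real u))" for X
    by (rule continuous_on_compose2[OF holomorphic_on_imp_continuous_on[OF hol]])
       (auto intro!: continuous_intros)
  have contfm: "continuous_on X (\<lambda>u. ?f (of_real (- u)))" for X
    by (rule continuous_on_compose2[OF holomorphic_on_imp_continuous_on[OF hol]])
       (auto intro!: continuous_intros)
  show ?thesis
  proof (intro exI[of _ "C / 2"] exI[of _ k] allI impI)
    fix n :: nat and U :: real assume n: "k < n" and U: "0 \<le> U"
    let ?\<phi> = "\<lambda>u. complex_of_real (cosh (u / 2)) / (1 + ?\<kappa> * of_real (sinh (u / 2)) ^ 2) ^ Suc n"
    let ?g = "\<lambda>m u. cosh (u / 2) / (1 + \<rho> * (sinh (u / 2))\<^sup>2) ^ m"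
    have cont\<phi>: "continuous_on X ?\<phi>" for X
      by (rule continuous_on_model) (use \<rho> in \<open>simp add: \<rho>_def\<close>)
    let ?J = "integral {-U..U} (\<lambda>u. ?\<phi> u * ?f (of_real u))"
    have i1: "(\<lambda>u. ?\<phi> u * ?f (of_real u)) integrable_on {-U..U}"
      by (intro integrable_continuous_interval continuous_on_mult cont\<phi> contf)
    have i2: "(\<lambda>u. ?\<phi> u * ?f (of_real (- u))) integrable_on {-U..U}"
      by (intro integrable_continuous_interval continuous_on_mult cont\<phi> contfm)
    have i3: "?\<phi> integrable_on {-U..U}"
      by (intro integrable_continuous_interval cont\<phi>)
    have refl: "integral {-U..U} (\<lambda>u. ?\<phi> u * ?f (of_real (- u))) = ?J"
    proof -
      have "((\<lambda>u. (\<lambda>u. ?\<phi> u * ?f (of_real u)) (- u)) has_integral ?J) {- U..- (- U)}"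
        by (subst has_integral_reflect_real) (rule integrable_integral[OF i1])
      then show ?thesis by (simp add: integral_unique)
    qed
    have "integral {-U..U} (\<lambda>u. ?\<phi> u * (?f (of_real u) + ?f (of_real (- u)) - 2 * ?f 0))
        = integral {-U..U} (\<lambda>u. (?\<phi> u * ?f (of_real u) + ?\<phi> u * ?f (of_real (- u))) - (2 * ?f 0) * ?\<phi> u)"
    proof -
      have "p * (x + y - 2 * z) = (p * x + p * y) - (2 * z) * p" for p x y z :: complex
        by (simp add: algebra_simps)
      then show ?thesis by (simp only:)
    qed
    also have "\<dots> = ?J + ?J - (2 * ?f 0) * integral {-U..U} ?\<phi>"
      by (simp only: integral_diff[OF integrable_add[OF i1 i2] integrable_on_mult_right[OF i3]]
            integral_add[OF i1 i2] integral_mult_right refl)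
    finally have half: "?J - ?f 0 * model_integral ?\<kappa> (Suc n) U
        = integral {-U..U} (\<lambda>u. ?\<phi> u * (?f (of_real u) + ?f (of_real (- u)) - 2 * ?f 0)) / 2"
      unfolding model_integral_def by simp
    have pt: "norm (?\<phi> u * (?f (of_real u) + ?f (of_real (- u)) - 2 * ?f 0)) \<le> C * (?g (n - k) u - ?g (Suc n - k) u)" for u
    proof -
      let ?S2 = "(sinh (u / 2))\<^sup>2" and ?Q = "1 + \<rho> * (sinh (u / 2))\<^sup>2"
      have Q: "?Q > 0" using \<rho> by (simp add: add_pos_nonneg)
      have "1 + ?S2 \<le> R * ?Q"
        using R mult_right_mono[OF R(2), of ?S2] by (simp add: algebra_simps)
      then have SQ: "(1 + ?S2) ^ k \<le> R ^ k * ?Q ^ k"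
        unfolding power_mult_distrib[symmetric] by (intro power_mono) auto
      have "norm (?f (of_real u) + ?f (of_real (- u)) - 2 * ?f 0) \<le> C1 * (u\<^sup>2 * exp (?K * \<bar>u\<bar>))"
        by (rule bd)
      also have "\<dots> \<le> C1 * ((4 * ?S2) * (4 ^ k * (R ^ k * ?Q ^ k)))"
      proof (intro mult_left_mono mult_mono C1 abs_half_le_sinh)
        have "exp (?K * \<bar>u\<bar>) \<le> 4 ^ k * (1 + ?S2) ^ k" by (rule exp_abs_le_cosh_power[OF k])
        also have "\<dots> \<le> 4 ^ k * (R ^ k * ?Q ^ k)" by (intro mult_left_mono SQ) auto
        finally show "exp (?K * \<bar>u\<bar>) \<le> 4 ^ k * (R ^ k * ?Q ^ k)" .
      qed auto
      finally have b1: "norm (?f (of_real u) + ?f (of_real (- u)) - 2 * ?f 0) \<le> C1 * ((4 * ?S2) * (4 ^ k * (R ^ k * ?Q ^ k)))" .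
      have b2: "norm (?\<phi> u) \<le> cosh (u / 2) / ?Q ^ Suc n"
        unfolding norm_divide norm_power using cosh_real_pos[of "u / 2"] Q \<rho> model_denominator(1)[of ?\<kappa> "sinh (u / 2)"]
        by (intro frac_le power_mono) (auto simp: \<rho>_def)
      have "norm (?\<phi> u * (?f (of_real u) + ?f (of_real (- u)) - 2 * ?f 0))
          \<le> cosh (u / 2) / ?Q ^ Suc n * (C1 * ((4 * ?S2) * (4 ^ k * (R ^ k * ?Q ^ k))))"
        unfolding norm_mult[of "?\<phi> u"] using Q cosh_real_pos[of "u / 2"] by (intro mult_mono b1 b2) auto
      also have "\<dots> = C * (cosh (u / 2) * (\<rho> * ?S2) * (?Q ^ k / ?Q ^ Suc n))"
        using \<rho> by (simp add: C_def del: power_Suc)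
      also have "?Q ^ k / ?Q ^ Suc n = 1 / ?Q ^ (Suc n - k)"
        using Q n by (simp add: power_diff del: power_Suc)
      \<comment> \<open>The factor \<open>sinh(u/2)^2\<close> that comes from \<open>u^2\<close> is \<open>(Q - 1) / \<rho>\<close>, and multiplication by
        \<open>Q - 1\<close> turns the bound into the difference of two consecutive model integrands.\<close>
      also have "cosh (u / 2) * (\<rho> * ?S2) * (1 / ?Q ^ (Suc n - k)) = cosh (u / 2) * (?Q - 1) * (1 / ?Q ^ (Suc n - k))"
        by simp
      also have "\<dots> = ?g (n - k) u - ?g (Suc n - k) u"
      proof -
        have G: "x * (q - 1) * (1 / (q * p)) = x / p - x / (q * p)" if "q \<noteq> 0" "p \<noteq> 0" for x q p :: real
          using that by (simp add: field_simps)
        have sn: "Suc n - k = Suc (n - k)" using n by simp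
        show ?thesis unfolding sn power_Suc using Q by (intro G) auto
      qed
      finally show ?thesis .
    qed
    have gi: "?g m integrable_on {-U..U}" for m by (rule real_model_integral(1)[OF \<rho>])
    have "norm (integral {-U..U} (\<lambda>u. ?\<phi> u * (?f (of_real u) + ?f (of_real (- u)) - 2 * ?f 0)))
        \<le> integral {-U..U} (\<lambda>u. C * (?g (n - k) u - ?g (Suc n - k) u))"
    proof (rule integral_norm_bound_integral)
      show "(\<lambda>u. ?\<phi> u * (?f (of_real u) + ?f (of_real (- u)) - 2 * ?f 0)) integrable_on {-U..U}"
        by (intro integrable_continuous_interval continuous_on_mult cont\<phi> continuous_on_diff continuous_on_add contf contfm continuous_on_const)
      show "(\<lambda>u. C * (?g (n - k) u - ?g (Suc n - k) u)) integrable_on {-U..U}"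
        by (intro integrable_on_mult_right integrable_diff gi)
    qed (rule pt)
    also have "\<dots> = C * (Re (model_integral (of_real \<rho>) (n - k) U) - Re (model_integral (of_real \<rho>) (Suc n - k) U))"
      by (simp only: integral_mult_right integral_diff[OF gi gi] real_model_integral(2)[OF \<rho>])
    finally have main: "norm (?J - ?f 0 * model_integral ?\<kappa> (Suc n) U)
        \<le> C / 2 * (Re (model_integral (of_real \<rho>) (n - k) U) - Re (model_integral (of_real \<rho>) (Suc n - k) U))"
      unfolding half by (simp add: norm_divide)
    have "integral {-U..U} (\<lambda>u. jintegrand a b \<theta> n (Complex u (pi / 2))) = cis (- (real (Suc n) * \<theta>)) * ?J"
      unfolding jintegrand_factorization[OF \<theta>] by (rule integral_mult_right)
    then have "norm (integral {-U..U} (\<lambda>u. jintegrand a b \<theta> n (Complex u (pi / 2)))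
        - cis (- (real (Suc n) * \<theta>)) * (?f 0 * model_integral ?\<kappa> (Suc n) U))
       = norm (?J - ?f 0 * model_integral ?\<kappa> (Suc n) U)"
      by (simp only: right_diff_distrib[symmetric] norm_mult norm_cis mult_1_left)
    with main show "norm (integral {-U..U} (\<lambda>u. jintegrand a b \<theta> n (Complex u (pi / 2)))
        - cis (- (real (Suc n) * \<theta>)) * (?f 0 * model_integral ?\<kappa> (Suc n) U))
       \<le> C / 2 * (Re (model_integral (of_real \<rho>) (n - k) U) - Re (model_integral (of_real \<rho>) (Suc n - k) U))"
      by simp
  qed
qed

lemma darboux_L_leading:
  "decays (- 3 / 2) (\<lambda>m. darboux_L m - 2 * sqrt pi * real m powr (- 1 / 2))"
proof -
  have "decays (- 3 / 2) (\<lambda>m. 2 * sqrt pi * (Gamma (real m + 1 / 2) / Gamma (real m + 1) - real m powr (- 1 / 2)))"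
    using Gamma_ratio_leading[of "1 / 2" 1] by (intro decays_cmult) simp
  then show ?thesis by (simp add: darboux_L_def algebra_simps)
qed

text \<open>Consecutive values have the same leading term, so the bound in \<open>darboux_truncated_estimate\<close>
  is one order smaller than the model integral itself.\<close>

lemma darboux_L_difference: "decays (- 3 / 2) (\<lambda>m. darboux_L m - darboux_L (Suc m))"
proof -
  have A: "decays (- 3 / 2) (\<lambda>m. 2 * sqrt pi * (Gamma (real m + 3 / 2) / Gamma (real m + 2) - real m powr (- 1 / 2)))"
    using Gamma_ratio_leading[of "3 / 2" 2] by (intro decays_cmult) simp
  have "decays (- 3 / 2) (\<lambda>m. darboux_L (Suc m) - 2 * sqrt pi * real m powr (- 1 / 2))"
    using A by (simp add: darboux_L_def algebra_simps)
  from decays_diff[OF darboux_L_leading this] show ?thesis by simp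
qed

lemma jacobi_P_model_leading:
  assumes a: "a > -1" and \<theta>: "0 < \<theta>" "\<theta> < pi"
  defines "w \<equiv> of_real (sqrt (2 * sin \<theta>)) * cis (pi / 4 - \<theta> / 2)"
  shows "decays (- 3 / 2) (\<lambda>n. jacobi_P a b n (cos \<theta>)
      - (- 1 / pi) * Im (cis (- (real (Suc n) * \<theta>)) * (darboux_amp a b \<theta> 0 * (of_real (darboux_L n) / w))))"
proof -
  let ?\<kappa> = "darboux_kappa \<theta>"
  define \<rho> where "\<rho> = Re ?\<kappa>"
  note wp = darboux_kappa_sqrt[OF \<theta>, folded w_def]
  have \<rho>: "\<rho> > 0" using wp by (simp add: \<rho>_def)
  obtain C k where est: "\<And>n U. n > k \<Longrightarrow> U \<ge> 0 \<Longrightarrow>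
     norm (integral {-U..U} (\<lambda>u. jintegrand a b \<theta> n (Complex u (pi / 2)))
        - cis (- (real (Suc n) * \<theta>)) * (darboux_amp a b \<theta> 0 * model_integral ?\<kappa> (Suc n) U))
     \<le> C * (Re (model_integral (of_real \<rho>) (n - k) U) - Re (model_integral (of_real \<rho>) (Suc n - k) U))"
    using darboux_truncated_estimate[OF \<theta>, of a b] unfolding \<rho>_def by blast
  have lim\<kappa>: "(model_integral ?\<kappa> (Suc n) \<longlongrightarrow> of_real (darboux_L n) / w) at_top" for n
    using model_integral_limit[OF wp(2,3), of n] unfolding wp(1) darboux_L_def .
  have lim\<rho>: "((\<lambda>U. Re (model_integral (of_real \<rho>) (Suc m) U)) \<longlongrightarrow> darboux_L m / sqrt \<rho>) at_top" for m
  proof -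
    have s: "(complex_of_real (sqrt \<rho>))\<^sup>2 = of_real \<rho>" using \<rho> by (simp flip: of_real_power)
    have "(model_integral (of_real \<rho>) (Suc m) \<longlongrightarrow> of_real (darboux_L m) / of_real (sqrt \<rho>)) at_top"
      using model_integral_limit[of "of_real (sqrt \<rho>)" m] \<rho> unfolding s darboux_L_def by simp
    then have "((\<lambda>U. Re (model_integral (of_real \<rho>) (Suc m) U)) \<longlongrightarrow> Re (of_real (darboux_L m / sqrt \<rho>))) at_top"
      by (intro tendsto_Re) simp
    then show ?thesis by simp
  qed
  let ?T = "\<lambda>n. Im (cis (- (real (Suc n) * \<theta>)) * (darboux_amp a b \<theta> 0 * (of_real (darboux_L n) / w)))"
  have bound: "\<bar>- pi * jacobi_P a b n (cos \<theta>) - ?T n\<bar>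
      \<le> C / sqrt \<rho> * (darboux_L (n - Suc k) - darboux_L (Suc (n - Suc k)))"
    if n: "n > k" "real n + b + 1 > 0" for n
  proof -
    have l1: "((\<lambda>U. \<bar>Im (integral {-U..U} (\<lambda>u. jintegrand a b \<theta> n (Complex u (pi / 2))))
        - Im (cis (- (real (Suc n) * \<theta>)) * (darboux_amp a b \<theta> 0 * model_integral ?\<kappa> (Suc n) U))\<bar>)
        \<longlongrightarrow> \<bar>- pi * jacobi_P a b n (cos \<theta>) - ?T n\<bar>) at_top"
      by (intro tendsto_intros jacobi_P_integral_limit[OF a n(2) \<theta>] lim\<kappa>)
    have sn: "n - k = Suc (n - Suc k)" "Suc n - k = Suc (Suc (n - Suc k))" using n by auto
    have l2: "((\<lambda>U. C * (Re (model_integral (of_real \<rho>) (n - k) U) - Re (model_integral (of_real \<rho>) (Suc n - k) U)))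
        \<longlongrightarrow> C * (darboux_L (n - Suc k) / sqrt \<rho> - darboux_L (Suc (n - Suc k)) / sqrt \<rho>)) at_top"
      unfolding sn by (intro tendsto_intros lim\<rho>)
    have "\<bar>- pi * jacobi_P a b n (cos \<theta>) - ?T n\<bar>
        \<le> C * (darboux_L (n - Suc k) / sqrt \<rho> - darboux_L (Suc (n - Suc k)) / sqrt \<rho>)"
    proof (rule tendsto_le[OF _ l2 l1], simp, rule eventually_mono[OF eventually_ge_at_top[of 0]])
      fix U :: real assume "0 \<le> U"
      from order.trans[OF abs_Im_le_cmod est[OF n(1) this]]
      show "\<bar>Im (integral {-U..U} (\<lambda>u. jintegrand a b \<theta> n (Complex u (pi / 2))))
        - Im (cis (- (real (Suc n) * \<theta>)) * (darboux_amp a b \<theta> 0 * model_integral ?\<kappa> (Suc n) U))\<bar>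
        \<le> C * (Re (model_integral (of_real \<rho>) (n - k) U) - Re (model_integral (of_real \<rho>) (Suc n - k) U))"
        by (simp only: minus_complex.sel)
    qed
    then show ?thesis by (simp add: diff_divide_distrib right_diff_distrib)
  qed
  have "decays (- 3 / 2) (\<lambda>n. C / sqrt \<rho> * (darboux_L (n - Suc k) - darboux_L (Suc (n - Suc k))))"
    by (intro decays_cmult decays_shift_down[where f = "\<lambda>m. darboux_L m - darboux_L (Suc m)"] darboux_L_difference)
  then have "decays (- 3 / 2) (\<lambda>n. - pi * jacobi_P a b n (cos \<theta>) - ?T n)"
  proof (rule decays_dominated)
    show "\<forall>\<^sub>F n in sequentially. norm (- pi * jacobi_P a b n (cos \<theta>) - ?T n)
        \<le> norm (C / sqrt \<rho> * (darboux_L (n - Suc k) - darboux_L (Suc (n - Suc k))))"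
      using eventually_gt_at_top[of k] eventually_gt_at_top[of "nat \<lceil>\<bar>b\<bar>\<rceil>"]
    proof eventually_elim
      case (elim n)
      then have "real n + b + 1 > 0" by linarith
      from bound[OF elim(1) this] show ?case unfolding real_norm_def by linarith
    qed
  qed
  then have "decays (- 3 / 2) (\<lambda>n. (- 1 / pi) * (- pi * jacobi_P a b n (cos \<theta>) - ?T n))"
    by (rule decays_cmult)
  then show ?thesis by (simp add: right_diff_distrib)
qed

lemma powr_of_real_cis:
  assumes "r > 0" "- pi < \<phi>" "\<phi> \<le> pi"
  shows "(of_real r * cis \<phi>) powr of_real p = of_real (r powr p) * cis (p * \<phi>)"
proof -
  have "Ln (of_real r * cis \<phi>) = of_real (ln r) + \<i> * of_real \<phi>"
    using assms by (simp add: cis_conv_exp Ln_times_of_real Ln_of_real)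
  then show ?thesis
    using assms
    by (simp add: powr_def exp_add distrib_left cis_conv_exp exp_of_real[symmetric] mult_ac)
qed

text \<open>Darboux's formula. The parameter \<open>b\<close> is an arbitrary real number: the moments of a truncated
  power with large exponent involve Jacobi polynomials whose second parameter is below \<open>-1\<close>.\<close>

theorem jacobi_P_darboux:
  assumes a: "a > -1" and \<theta>: "0 < \<theta>" "\<theta> < pi"
  shows "decays (- 3 / 2) (\<lambda>n. jacobi_P a b n (cos \<theta>)
     - sin (\<theta> / 2) powr (- a - 1 / 2) * cos (\<theta> / 2) powr (- b - 1 / 2) / sqrt pi
       * (real n powr (- 1 / 2) * cos ((real n + (a + b + 1) / 2) * \<theta> - pi * a / 2 - pi / 4)))"
proof -
  define s c where "s = sin (\<theta> / 2)" and "c = cos (\<theta> / 2)"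
  have sc: "s > 0" "c > 0" using half_angle_pos[OF \<theta>] by (simp_all add: s_def c_def)
  have s\<theta>: "sin \<theta> = 2 * s * c" using sin_double[of "\<theta> / 2"] by (simp add: s_def c_def)
  define D where "D = (c / s) powr a * c powr (- (a + b)) / sqrt (2 * sin \<theta>)"
  define ph where "ph n = - (real (Suc n) * \<theta>) + pi * a / 2 - (a + b) * \<theta> / 2 - pi / 4 + \<theta> / 2" for n
  have amp0: "darboux_amp a b \<theta> 0 = of_real ((c / s) powr a * c powr (- (a + b))) * cis (pi * a / 2 - (a + b) * \<theta> / 2)"
  proof -
    have "\<i> * complex_of_real (c / s) * exp 0 = of_real (c / s) * cis (pi / 2)" by simp
    then have V: "(\<i> * complex_of_real (c / s) * exp 0) powr of_real a = of_real ((c / s) powr a) * cis (a * (pi / 2))"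
      by (elim ssubst) (rule powr_of_real_cis, use sc pi_gt_zero in auto)
    have "of_real (c\<^sup>2) + of_real (s\<^sup>2) * (\<i> * complex_of_real (c / s) * exp 0) = of_real c * cis (\<theta> / 2)"
      using sc by (simp add: complex_eq_iff power2_eq_square s_def[symmetric] c_def[symmetric])
    then have w: "(of_real (c\<^sup>2) + of_real (s\<^sup>2) * (\<i> * complex_of_real (c / s) * exp 0)) powr of_real (- (a + b))
        = of_real (c powr (- (a + b))) * cis (- (a + b) * (\<theta> / 2))"
      by (elim ssubst) (rule powr_of_real_cis, use sc \<theta> in auto)
    have "darboux_amp a b \<theta> 0 = (of_real ((c / s) powr a) * cis (a * (pi / 2)))
        * (of_real (c powr (- (a + b))) * cis (- (a + b) * (\<theta> / 2))) * (2 / (1 + 1))"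
      unfolding darboux_amp_def Let_def V[symmetric] w[symmetric] by (simp add: s_def c_def)
    also have "\<dots> = of_real ((c / s) powr a * c powr (- (a + b))) * (cis (a * (pi / 2)) * cis (- (a + b) * (\<theta> / 2)))"
      by simp
    also have "cis (a * (pi / 2)) * cis (- (a + b) * (\<theta> / 2)) = cis (pi * a / 2 - (a + b) * \<theta> / 2)"
      unfolding cis_mult by (rule arg_cong[of _ _ cis]) (simp add: field_simps)
    finally show ?thesis .
  qed
  let ?w = "of_real (sqrt (2 * sin \<theta>)) * cis (pi / 4 - \<theta> / 2)"
  have T: "Im (cis (- (real (Suc n) * \<theta>)) * (darboux_amp a b \<theta> 0 * (of_real (darboux_L n) / ?w)))
      = D * darboux_L n * sin (ph n)" for n
  proof -
    have "cis (- (real (Suc n) * \<theta>)) * (darboux_amp a b \<theta> 0 * (of_real (darboux_L n) / ?w))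
        = of_real (D * darboux_L n) * (cis (- (real (Suc n) * \<theta>)) * cis (pi * a / 2 - (a + b) * \<theta> / 2) / cis (pi / 4 - \<theta> / 2))"
      unfolding amp0 D_def by simp
    also have "cis (- (real (Suc n) * \<theta>)) * cis (pi * a / 2 - (a + b) * \<theta> / 2) / cis (pi / 4 - \<theta> / 2) = cis (ph n)"
      by (simp only: cis_mult cis_divide) (simp add: ph_def algebra_simps)
    finally show ?thesis by simp
  qed
  have D2: "D * 2 * sqrt pi / pi = s powr (- a - 1 / 2) * c powr (- b - 1 / 2) / sqrt pi"
  proof -
    have sq: "sqrt (2 * sin \<theta>) = 2 * (s powr (1 / 2) * c powr (1 / 2))"
    proof -
      have "2 * sin \<theta> = 2\<^sup>2 * (s * c)" using s\<theta> by simp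
      then show ?thesis using sc by (simp add: real_sqrt_mult powr_half_sqrt)
    qed
    have p1: "(c / s) powr a = c powr a / s powr a" using sc by (simp add: powr_divide)
    have p2: "s powr (- a - 1 / 2) = 1 / (s powr a * s powr (1 / 2))"
      using sc by (simp add: powr_diff powr_minus_divide)
    have p3: "c powr (- b - 1 / 2) = c powr a * c powr (- (a + b)) / c powr (1 / 2)"
      using sc by (simp flip: powr_add powr_diff add: algebra_simps)
    have p4: "sqrt pi / pi = 1 / sqrt pi" by (simp add: real_div_sqrt real_sqrt_divide field_simps)
    have "D * 2 * sqrt pi / pi = (D * 2) * (sqrt pi / pi)" by simp
    then show ?thesis unfolding p4 unfolding D_def sq p1 p2 p3 by simp
  qed
  have shift: "- sin (ph n) = cos ((real n + (a + b + 1) / 2) * \<theta> - pi * a / 2 - pi / 4)" for n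
  proof -
    have "- ph n = pi / 2 + ((real n + (a + b + 1) / 2) * \<theta> - pi * a / 2 - pi / 4)"
      by (simp add: ph_def algebra_simps add_divide_distrib)
    then have "sin (- ph n) = cos ((real n + (a + b + 1) / 2) * \<theta> - pi * a / 2 - pi / 4)"
      by (simp only: sin_add sin_pi_half cos_pi_half mult_1 mult_zero_left add_0_right)
    then show ?thesis by simp
  qed
  have A: "decays (- 3 / 2) (\<lambda>n. jacobi_P a b n (cos \<theta>) - (- 1 / pi) * (D * darboux_L n * sin (ph n)))"
    using jacobi_P_model_leading[OF a \<theta>, of b] unfolding T .
  have B: "decays (- 3 / 2) (\<lambda>n. (- 1 / pi) * (D * darboux_L n * sin (ph n))
      - (- 1 / pi) * (D * (2 * sqrt pi * real n powr (- 1 / 2)) * sin (ph n)))"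
  proof -
    have "decays (0 + (- 3 / 2)) (\<lambda>n. (- 1 / pi * D * sin (ph n)) * (darboux_L n - 2 * sqrt pi * real n powr (- 1 / 2)))"
    proof (rule decays_mult[OF decays_bounded darboux_L_leading])
      show "norm (- 1 / pi * D * sin (ph n)) \<le> \<bar>- 1 / pi * D\<bar>" for n
        unfolding real_norm_def abs_mult[of "- 1 / pi * D"] by (rule mult_left_le) auto
    qed
    then show ?thesis by (simp add: algebra_simps)
  qed
  have "(- 1 / pi) * (D * (2 * sqrt pi * real n powr (- 1 / 2)) * sin (ph n))
      = s powr (- a - 1 / 2) * c powr (- b - 1 / 2) / sqrt pi
       * (real n powr (- 1 / 2) * cos ((real n + (a + b + 1) / 2) * \<theta> - pi * a / 2 - pi / 4))" for n
    unfolding shift[symmetric] D2[symmetric] by simp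
  then show ?thesis
    using decays_leading_trans[OF A B] by (simp add: s_def c_def)
qed

section \<open>Truncated powers\<close>

lemma truncated_power_pos: "y > 0 \<Longrightarrow> truncated_power s y = y powr s"
  by (simp add: truncated_power_def)

lemma truncated_power_mult:
  assumes "s > 0 \<or> y \<noteq> 0"
  shows "truncated_power s y = y * truncated_power (s - 1) y"
  using assms by (auto simp: truncated_power_def powr_diff)

lemma truncated_power_mult_power:
  assumes "x \<ge> 0" and that: "s > -1"
  shows "truncated_power s x * x ^ j = truncated_power (s + real j) x"
proof (cases "x = 0")
  case True
  then show ?thesis using that by (cases j) (auto simp: truncated_power_def)
next
  case False
  then have "x > 0" using assms by simp
  then show ?thesis
    by (simp add: truncated_power_pos powr_add powr_realpow)
qed

lemma truncated_power_measurable [measurable]: "truncated_power s \<in> borel_measurable borel"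
  unfolding truncated_power_def[abs_def] by measurable

lemma truncated_power_has_derivative:
  assumes s: "s > 1"
  shows "(truncated_power s has_real_derivative s * truncated_power (s - 1) y) (at y)"
proof -
  consider "y > 0" | "y < 0" | "y = 0" by linarith
  then show ?thesis
  proof cases
    case 1
    have "((\<lambda>y. y powr s) has_real_derivative s * y powr (s - 1)) (at y)"
      using 1 by (rule has_real_derivative_powr)
    then have "(truncated_power s has_real_derivative s * y powr (s - 1)) (at y)"
      by (rule has_field_derivative_transform_within_open[of _ _ _ "{0<..}"])
         (use 1 s in \<open>auto simp: truncated_power_def\<close>)
    then show ?thesis using 1 s by (simp add: truncated_power_def)
  next
    case 2
    have "((\<lambda>_. 0) has_real_derivative 0) (at y)" by simp
    then have "(truncated_power s has_real_derivative 0) (at y)"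
      by (rule has_field_derivative_transform_within_open[of _ _ _ "{..<0}"])
         (use 2 in \<open>auto simp: truncated_power_def\<close>)
    then show ?thesis using 2 by (simp add: truncated_power_def)
  next
    case 3
    have "((\<lambda>h. \<bar>h\<bar> powr (s - 1)) \<longlongrightarrow> \<bar>0\<bar> powr (s - 1)) (at (0::real))"
      using s by (intro tendsto_powr' tendsto_intros) auto
    then have lim: "((\<lambda>h. \<bar>h\<bar> powr (s - 1)) \<longlongrightarrow> 0) (at (0::real))" using s by simp
    have "((\<lambda>h. truncated_power s h / h) \<longlongrightarrow> 0) (at 0)"
    proof (rule Lim_null_comparison[OF _ lim], rule eventually_mono[OF eventually_neq_at_within[of 0]])
      fix h :: real assume h: "h \<noteq> 0"
      show "norm (truncated_power s h / h) \<le> \<bar>h\<bar> powr (s - 1)"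
      proof (cases "h > 0")
        case True
        then show ?thesis using s by (simp add: truncated_power_def powr_diff)
      next
        case False
        then have "truncated_power s h = 0" using h by (simp add: truncated_power_def)
        then show ?thesis by simp
      qed
    qed
    then show ?thesis
      using 3 s by (simp add: has_field_derivative_iff truncated_power_def)
  qed
qed

lemma continuous_on_truncated_power:
  assumes "s > 0"
  shows "continuous_on X (truncated_power s)"
proof -
  have "continuous_on UNIV (\<lambda>y. max 0 y powr s)"
    using assms by (intro continuous_on_powr' continuous_intros) auto
  also have "(\<lambda>y. max 0 y powr s) = truncated_power s"
    using assms by (auto simp: truncated_power_def fun_eq_iff max_def)
  finally show ?thesis by (rule continuous_on_subset) simp
qed

lemma truncated_power_integral:
  assumes \<xi>: "\<xi> < 1" and s: "s > -1" and a: "a > -1"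
  shows "set_integrable lborel {\<xi>..1} (\<lambda>x. truncated_power s (x - \<xi>) * (1 - x) powr a)"
    and "(LBINT x:{\<xi>..1}. truncated_power s (x - \<xi>) * (1 - x) powr a)
           = (1 - \<xi>) powr (s + a + 1) * Beta (s + 1) (a + 1)"
proof -
  have ae: "AE x in lborel. x \<noteq> \<xi>" by (rule AE_lborel_singleton)
  have eq: "AE x \<in> {\<xi>..1} in lborel. truncated_power s (x - \<xi>) * (1 - x) powr a = (x - \<xi>) powr s * (1 - x) powr a"
    using ae by eventually_elim (auto simp: truncated_power_def)
  show "set_integrable lborel {\<xi>..1} (\<lambda>x. truncated_power s (x - \<xi>) * (1 - x) powr a)"
    by (subst set_integrable_cong_AE[OF _ _ eq])
       (use powr_mult_powr_integral(1)[OF \<xi> s a] in auto)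
  show "(LBINT x:{\<xi>..1}. truncated_power s (x - \<xi>) * (1 - x) powr a)
           = (1 - \<xi>) powr (s + a + 1) * Beta (s + 1) (a + 1)"
    by (subst set_lebesgue_integral_cong_AE[OF _ _ _ eq])
       (use powr_mult_powr_integral(2)[OF \<xi> s a] in auto)
qed

lemma sing_fun_weight:
  assumes "-1 < \<xi>" "\<xi> < 1"
  shows "indicator {-1..1} x *\<^sub>R (sing_fun s \<xi> H x * of_real (jacobi_weight a b x))
    = indicator {\<xi>..1} x *\<^sub>R (of_real (truncated_power s (x - \<xi>) * (1 - x) powr a)
          * (H (of_real x) * of_real ((1 + x) powr b)))"
  using assms by (auto simp: sing_fun_def truncated_power_def jacobi_weight_def indicator_def mult_ac)

lemma sing_fun_weight_integrable:
  assumes \<xi>: "-1 < \<xi>" "\<xi> < 1" and s: "s > -1" and a: "a > -1"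
    and H: "continuous_on {\<xi>..1} (\<lambda>x. H (complex_of_real x))"
  shows "weight_integrable a b (sing_fun s \<xi> H)"
proof -
  have "set_integrable lborel {\<xi>..1} (\<lambda>x. complex_of_real (truncated_power s (x - \<xi>) * (1 - x) powr a))"
    using integrable_of_real[OF truncated_power_integral(1)[OF \<xi>(2) s a, unfolded set_integrable_def], where 'a = complex]
    unfolding set_integrable_def by (simp add: scaleR_conv_of_real)
  moreover have "continuous_on {\<xi>..1} (\<lambda>x. H (of_real x) * of_real ((1 + x) powr b))"
    using \<xi> by (intro continuous_intros H) auto
  ultimately have "set_integrable lborel {\<xi>..1} (\<lambda>x. complex_of_real (truncated_power s (x - \<xi>) * (1 - x) powr a)
      * (H (of_real x) * of_real ((1 + x) powr b)))"
    by (rule set_integrable_mult_continuous)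
  then show ?thesis
    unfolding weight_integrable_def set_integrable_def sing_fun_weight[OF \<xi>] .
qed

section \<open>Moments of a pure truncated power\<close>

lemma gbinomial_eq_Gamma:
  assumes "a > -1" "j \<le> k"
  shows "(real k + a) gchoose (k - j) = Gamma (real k + a + 1) / (Gamma (a + real j + 1) * fact (k - j))"
proof -
  have "a + real j + 1 > 0" using assms by simp
  then have "a + real j + 1 \<notin> \<int>\<^sub>\<le>\<^sub>0" using nonpos_Ints_nonpos[of "a + real j + 1"] by auto
  then have "pochhammer (a + real j + 1) (k - j) = Gamma (a + real j + 1 + real (k - j)) / Gamma (a + real j + 1)"
    by (rule pochhammer_Gamma)
  moreover have "(real k + a) gchoose (k - j) = pochhammer (a + real j + 1) (k - j) / fact (k - j)"
    using assms by (simp add: gbinomial_pochhammer' of_nat_diff algebra_simps)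
  ultimately show ?thesis using assms by (simp add: of_nat_diff algebra_simps)
qed

text \<open>Bateman's fractional integral. The Beta integral of a single power \<open>(1 - x) ^ (a + j)\<close> only
  shifts the lower parameter of the hypergeometric sum, so the result is again a Jacobi
  polynomial, with the same sum of parameters.\<close>

lemma jacobi_moment_pure_power:
  assumes \<xi>: "-1 < \<xi>" "\<xi> < 1" and s: "s > -1" and a: "a > -1"
  defines "A \<equiv> a + s + 1"
  shows "jacobi_moment a b (sing_fun s \<xi> (\<lambda>z. (1 + z) powr of_real (- b))) k =
     of_real (Gamma (s + 1) * (1 - \<xi>) powr A * (Gamma (real k + (a + 1)) / Gamma (real k + (A + 1)))
               * jacobi_P A (b - s - 1) k \<xi>)"
proof -
  let ?t = "\<lambda>x. truncated_power s (x - \<xi>)"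
  have A: "A > -1" using s a by (simp add: A_def)
  have int: "set_integrable lborel {\<xi>..1} (\<lambda>x. ?t x * (1 - x) powr (a + real j))" for j
    using truncated_power_integral(1)[OF \<xi>(2) s, of "a + real j"] a by simp
  have val: "(LBINT x:{\<xi>..1}. ?t x * (1 - x) powr (a + real j))
      = (1 - \<xi>) powr A * (1 - \<xi>) ^ j * (Gamma (s + 1) * Gamma (a + real j + 1) / Gamma (A + real j + 1))" for j
  proof -
    have "(1 - \<xi>) powr (s + (a + real j) + 1) = (1 - \<xi>) powr A * (1 - \<xi>) ^ j"
      using \<xi> by (simp add: A_def powr_realpow[symmetric] powr_add[symmetric] algebra_simps)
    then show ?thesis
      using truncated_power_integral(2)[OF \<xi>(2) s, of "a + real j"] a
      by (simp add: Beta_def A_def algebra_simps)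
  qed
  have "jacobi_moment a b (sing_fun s \<xi> (\<lambda>z. (1 + z) powr of_real (- b))) k
      = (LBINT x:{\<xi>..1}. complex_of_real (\<Sum>j\<le>k. jacobi_c a b k j / 2 ^ j * (?t x * (1 - x) powr (a + real j))))"
    unfolding jacobi_moment_def weight_integral_def set_lebesgue_integral_def
  proof (rule Bochner_Integration.integral_cong[OF refl])
    fix x :: real
    let ?f = "sing_fun s \<xi> (\<lambda>z. (1 + z) powr of_real (- b)) x"
    have "indicator {-1..1} x *\<^sub>R (?f * of_real (jacobi_P a b k x) * of_real (jacobi_weight a b x))
        = (indicator {-1..1} x *\<^sub>R (?f * of_real (jacobi_weight a b x))) * of_real (jacobi_P a b k x)"
      by simp
    also have "\<dots> = indicator {\<xi>..1} x *\<^sub>R (of_real (?t x * (1 - x) powr a)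
          * ((1 + of_real x) powr of_real (- b) * of_real ((1 + x) powr b)) * of_real (jacobi_P a b k x))"
      unfolding sing_fun_weight[OF \<xi>] by simp
    also have "\<dots> = indicator {\<xi>..1} x *\<^sub>R
        complex_of_real (\<Sum>j\<le>k. jacobi_c a b k j / 2 ^ j * (?t x * (1 - x) powr (a + real j)))"
    proof (cases "x \<in> {\<xi>..1}")
      case True
      have "(1 + complex_of_real x) powr of_real (- b) * of_real ((1 + x) powr b) = 1"
      proof -
        have "(1 + complex_of_real x) powr of_real (- b) = of_real ((1 + x) powr (- b))"
          using powr_of_real[of "1 + x" "- b"] True \<xi> by simp
        then show ?thesis
          using True \<xi> by (simp add: powr_minus flip: of_real_mult)
      qed
      moreover have "?t x * (1 - x) powr a * jacobi_P a b k x
          = (\<Sum>j\<le>k. jacobi_c a b k j / 2 ^ j * (?t x * (1 - x) powr (a + real j)))"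
      proof -
        have pw: "(1 - x) powr a * (1 - x) ^ j = (1 - x) powr (a + real j)" for j
        proof (cases "x = 1")
          case False
          then show ?thesis using True by (simp add: powr_add powr_realpow)
        qed simp
        show ?thesis
          unfolding jacobi_P_sum[OF a] pw[symmetric]
          by (simp add: sum_distrib_left power_divide mult_ac)
      qed
      ultimately show ?thesis using True by (simp flip: of_real_mult of_real_sum)
    qed simp
    finally show "indicator {-1..1} x *\<^sub>R (?f * of_real (jacobi_P a b k x) * of_real (jacobi_weight a b x))
        = indicator {\<xi>..1} x *\<^sub>R
        complex_of_real (\<Sum>j\<le>k. jacobi_c a b k j / 2 ^ j * (?t x * (1 - x) powr (a + real j)))" .
  qed
  also have "\<dots> = of_real (LBINT x:{\<xi>..1}. \<Sum>j\<le>k. jacobi_c a b k j / 2 ^ j * (?t x * (1 - x) powr (a + real j)))"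
    by (rule set_integral_complex_of_real)
  also have "(LBINT x:{\<xi>..1}. \<Sum>j\<le>k. jacobi_c a b k j / 2 ^ j * (?t x * (1 - x) powr (a + real j)))
      = (\<Sum>j\<le>k. LBINT x:{\<xi>..1}. jacobi_c a b k j / 2 ^ j * (?t x * (1 - x) powr (a + real j)))"
  proof -
    have "set_integrable lborel {\<xi>..1} (\<lambda>x. jacobi_c a b k j / 2 ^ j * (?t x * (1 - x) powr (a + real j)))" for j
      by (intro set_integrable_mult_right int)
    then show ?thesis
      unfolding set_lebesgue_integral_def set_integrable_def scaleR_sum_right
      by (intro Bochner_Integration.integral_sum) auto
  qed
  also have "\<dots> = (\<Sum>j\<le>k. Gamma (s + 1) * (1 - \<xi>) powr A * (Gamma (real k + (a + 1)) / Gamma (real k + (A + 1)))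
               * (jacobi_c A (b - s - 1) k j * ((1 - \<xi>) / 2) ^ j))"
  proof (rule sum.cong[OF refl])
    fix j assume "j \<in> {..k}"
    then have j: "j \<le> k" by simp
    have gp: "Gamma (a + real j + 1) > 0" "Gamma (A + real j + 1) > 0" "Gamma (real k + A + 1) > 0"
      using a A by (auto intro!: Gamma_real_pos)
    have q: "- (real k + A + (b - s - 1) + 1) = - (real k + a + b + 1)" by (simp add: A_def)
    have c1: "jacobi_c a b k j = Gamma (real k + a + 1) / (Gamma (a + real j + 1) * fact (k - j)) * ((- (real k + a + b + 1)) gchoose j)"
      unfolding jacobi_c_def gbinomial_eq_Gamma[OF a j] using j by simp
    have c2: "jacobi_c A (b - s - 1) k j = Gamma (real k + A + 1) / (Gamma (A + real j + 1) * fact (k - j)) * ((- (real k + a + b + 1)) gchoose j)"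
      unfolding jacobi_c_def gbinomial_eq_Gamma[OF A j] q using j by simp
    have alg: "X / (G1 * F) * C / t * (p * P * (S * G1 / G2)) = S * p * (X / Y) * (Y / (G2 * F) * C * (P / t))"
      if "G1 \<noteq> 0" "Y \<noteq> 0" for X G1 F C t p P S G2 Y :: real
      using that by (simp add: mult_ac)
    show "(LBINT x:{\<xi>..1}. jacobi_c a b k j / 2 ^ j * (?t x * (1 - x) powr (a + real j)))
      = Gamma (s + 1) * (1 - \<xi>) powr A * (Gamma (real k + (a + 1)) / Gamma (real k + (A + 1)))
               * (jacobi_c A (b - s - 1) k j * ((1 - \<xi>) / 2) ^ j)"
      unfolding set_integral_mult_right val c1 c2 power_divide add.assoc[symmetric]
      by (rule alg) (use gp in auto)
  qed
  also have "\<dots> = Gamma (s + 1) * (1 - \<xi>) powr A * (Gamma (real k + (a + 1)) / Gamma (real k + (A + 1)))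
               * jacobi_P A (b - s - 1) k \<xi>"
    unfolding jacobi_P_sum[OF A] by (simp only: sum_distrib_left)
  finally show ?thesis .
qed

section \<open>Moments of smooth functions\<close>

text \<open>Since \<open>P_0 = 1\<close>, the elementary bound \<open>2 |P_k| \<le> P_0^2 + P_k^2\<close> reduces the claim to
  boundedness of the norms.\<close>

lemma jacobi_moment_bounded:
  assumes a: "a > -1" and b: "b > -1" and F: "continuous_on {-1..1} F"
  shows "decays 0 (jacobi_moment a b F)"
proof -
  have "bounded (F ` {-1..1})"
    using F by (intro compact_imp_bounded compact_continuous_image) auto
  then obtain C where C: "\<And>x. x \<in> {-1..1} \<Longrightarrow> norm (F x) \<le> C"
    unfolding bounded_iff by blast
  have C0: "C \<ge> 0" using order.trans[OF norm_ge_zero C[of 0]] by simp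
  let ?P = "jacobi_poly a b"
  have bd: "norm (jacobi_moment a b F k) \<le> C / 2 * (jacobi_h a b 0 + jacobi_h a b k)" for k
  proof -
    let ?g = "smult (C / 2) (?P 0 * ?P 0 + ?P k * ?P k)"
    have "norm (jacobi_moment a b F k) \<le> (LBINT x:{-1..1}. poly ?g x * jacobi_weight a b x)"
      unfolding jacobi_moment_def
    proof (rule weight_integral_norm_le)
      show "weight_integrable a b (\<lambda>x. F x * of_real (jacobi_P a b k x))"
        by (intro weight_integrable_continuous a b continuous_intros F)
      show "set_integrable lborel {-1..1} (\<lambda>x. poly ?g x * jacobi_weight a b x)"
        by (rule jacobi_functional_integrable[OF a b])
      fix x :: real assume "x \<in> {-1..1}"
      then have "norm (F x * of_real (jacobi_P a b k x)) \<le> C * \<bar>jacobi_P a b k x\<bar>"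
        unfolding norm_mult norm_of_real by (intro mult_right_mono C) auto
      also have "\<dots> \<le> C * ((1 + (jacobi_P a b k x)\<^sup>2) / 2)"
        using sum_squares_bound[of 1 "\<bar>jacobi_P a b k x\<bar>"] by (intro mult_left_mono C0) auto
      also have "\<dots> = poly ?g x"
        by (simp add: poly_jacobi_poly[OF a] jacobi_P_0[OF a] power2_eq_square)
      finally show "norm (F x * of_real (jacobi_P a b k x)) \<le> poly ?g x" .
    qed
    also have "\<dots> = jacobi_functional a b ?g" by (simp only: jacobi_functional_def)
    also have "\<dots> = C / 2 * (jacobi_h a b 0 + jacobi_h a b k)"
      by (simp only: jacobi_functional_linear[OF a b] jacobi_functional_square[OF a b])
    finally show ?thesis .
  qed
  have "decays 0 (\<lambda>k. C / 2 * (jacobi_h a b 0 + jacobi_h a b k))"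
    by (intro decays_cmult decays_add decays_const decays_mono[OF decays_jacobi_h[OF a b]]) simp
  then show ?thesis
    by (rule decays_dominated) (use bd in \<open>auto intro!: always_eventually order.trans[OF _ abs_ge_self]\<close>)
qed

lemma decays_Suc_iff: "decays p (\<lambda>n. f (Suc n)) \<longleftrightarrow> decays p f"
proof
  assume "decays p (\<lambda>n. f (Suc n))"
  then have "decays p (\<lambda>n. f (Suc (n - 1)))" by (rule decays_shift_down)
  then show "decays p f"
    by (rule decays_cong, intro eventually_mono[OF eventually_gt_at_top[of 0]]) simp
next
  assume "decays p f"
  from decays_shift_up[OF this, of 1] show "decays p (\<lambda>n. f (Suc n))" by simp
qed

text \<open>One integration by parts for each derivative. The derivatives are given as a sequence \<open>D\<close>
  because the functions of interest have derivatives in closed form.\<close>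

lemma jacobi_moment_smooth:
  assumes "a > -1" "b > -1"
    and "\<And>j. j \<le> M \<Longrightarrow> continuous_on {-1..1} (D j)"
    and "\<And>j x. j < M \<Longrightarrow> x \<in> {-1<..<1} \<Longrightarrow> (D j has_vector_derivative D (Suc j) x) (at x)"
  shows "decays (- real M) (jacobi_moment a b (D 0))"
  using assms
proof (induction M arbitrary: a b D)
  case 0
  then show ?case using jacobi_moment_bounded by simp
next
  case (Suc M)
  have "decays (- real M) (jacobi_moment (a + 1) (b + 1) (D (Suc 0)))"
    by (rule Suc.IH[where D = "\<lambda>j. D (Suc j)"]) (use Suc.prems in auto)
  moreover have "decays (-1) (\<lambda>k. 1 / complex_of_real (2 * real (Suc k)))"
  proof (rule decaysI[of _ 1], rule eventually_mono[OF eventually_gt_at_top[of 0]])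
    fix k :: nat assume k: "0 < k"
    have "norm (1 / complex_of_real (2 * real (Suc k))) = 1 / (2 * real (Suc k))"
      by (simp only: norm_divide norm_one norm_of_real abs_of_nat abs_mult abs_numeral)
    also have "\<dots> \<le> 1 / real k" using k by (intro frac_le) auto
    finally show "norm (1 / complex_of_real (2 * real (Suc k))) \<le> 1 * real k powr (- 1)"
      using k by (simp add: powr_minus_divide)
  qed
  ultimately have "decays (- real M + - 1) (\<lambda>k. jacobi_moment (a + 1) (b + 1) (D (Suc 0)) k * (1 / of_real (2 * real (Suc k))))"
    by (rule decays_mult)
  moreover have "jacobi_moment a b (D 0) (Suc k) = jacobi_moment (a + 1) (b + 1) (D (Suc 0)) k * (1 / of_real (2 * real (Suc k)))" for k
    using jacobi_moment_Suc[of a b "D 0" "D (Suc 0)" k] Suc.prems by simp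
  ultimately have "decays (- real (Suc M)) (\<lambda>k. jacobi_moment a b (D 0) (Suc k))"
    by (simp add: algebra_simps)
  then show ?case by (simp only: decays_Suc_iff)
qed

section \<open>The derivatives of a truncated power times a holomorphic function\<close>

text \<open>The \<open>j\<close>-th derivative of \<open>(x - \<xi>)_+^s H(x)\<close> is \<open>(x - \<xi>)_+^(s-j)\<close> times a holomorphic
  function, and this recursion computes that function by the product rule.\<close>

fun sing_tower :: "real \<Rightarrow> real \<Rightarrow> (complex \<Rightarrow> complex) \<Rightarrow> nat \<Rightarrow> complex \<Rightarrow> complex" where
  "sing_tower s \<xi> H 0 = H"
| "sing_tower s \<xi> H (Suc j) = (\<lambda>z. of_real (s - real j) * sing_tower s \<xi> H j z
      + (z - of_real \<xi>) * deriv (sing_tower s \<xi> H j) z)"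

lemma sing_tower_holomorphic:
  assumes "open U" "H holomorphic_on U"
  shows "sing_tower s \<xi> H j holomorphic_on U"
  using assms by (induction j) (auto intro!: holomorphic_intros holomorphic_deriv)

lemma sing_fun_continuous:
  assumes s: "s > 0" and U: "open U" "H holomorphic_on U"
    and X: "\<And>x. x \<in> X \<Longrightarrow> x \<ge> \<xi> \<Longrightarrow> complex_of_real x \<in> U" and "closed X"
  shows "continuous_on X (sing_fun s \<xi> H)"
proof -
  have "continuous_on (X \<inter> {..\<xi>} \<union> X \<inter> {\<xi>..}) (\<lambda>x. if x \<le> \<xi> then 0 else of_real (truncated_power s (x - \<xi>)) * H (of_real x))"
  proof (rule continuous_on_cases)
    show "closed (X \<inter> {..\<xi>})" "closed (X \<inter> {\<xi>..})"
      using \<open>closed X\<close> by (auto intro!: closed_Int)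
    show "continuous_on (X \<inter> {\<xi>..}) (\<lambda>x. of_real (truncated_power s (x - \<xi>)) * H (of_real x))"
    proof (intro continuous_on_mult continuous_on_of_real)
      show "continuous_on (X \<inter> {\<xi>..}) (\<lambda>x. truncated_power s (x - \<xi>))"
        by (rule continuous_on_compose2[OF continuous_on_truncated_power[OF s, of UNIV]])
           (auto intro!: continuous_intros)
      show "continuous_on (X \<inter> {\<xi>..}) (\<lambda>x. H (of_real x))"
        by (rule continuous_on_compose2[OF holomorphic_on_imp_continuous_on[OF U(2)]])
           (use X in \<open>auto intro!: continuous_intros\<close>)
    qed
  qed (use s in \<open>auto simp: truncated_power_def\<close>)
  moreover have "X \<inter> {..\<xi>} \<union> X \<inter> {\<xi>..} = X" by auto
  moreover have "(\<lambda>x. if x \<le> \<xi> then 0 else of_real (truncated_power s (x - \<xi>)) * H (of_real x)) = sing_fun s \<xi> H"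
    using s by (auto simp: sing_fun_def truncated_power_def fun_eq_iff)
  ultimately show ?thesis by (simp only:)
qed

lemma sing_fun_has_derivative:
  assumes s: "s > 1" and U: "open U" "H holomorphic_on U" and x: "x \<ge> \<xi> \<Longrightarrow> complex_of_real x \<in> U"
  shows "(sing_fun s \<xi> H has_vector_derivative
     sing_fun (s - 1) \<xi> (\<lambda>z. of_real s * H z + (z - of_real \<xi>) * deriv H z) x) (at x)"
proof (cases "x < \<xi>")
  case True
  have "((\<lambda>_. 0) has_vector_derivative 0) (at x)" by simp
  then have "(sing_fun s \<xi> H has_vector_derivative 0) (at x)"
    by (rule has_vector_derivative_transform_within_open[of _ _ _ "{..<\<xi>}"])
       (use True in \<open>auto simp: sing_fun_def truncated_power_def\<close>)
  then show ?thesis using True by (simp add: sing_fun_def truncated_power_def)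
next
  case False
  then have xU: "of_real x \<in> U" using x by simp
  have "((\<lambda>x. truncated_power s (x - \<xi>)) has_real_derivative s * truncated_power (s - 1) (x - \<xi>) * 1) (at x)"
    by (rule DERIV_chain2[OF truncated_power_has_derivative[OF s]]) (auto intro!: derivative_eq_intros)
  then have "((\<lambda>x. complex_of_real (truncated_power s (x - \<xi>))) has_vector_derivative
      of_real (s * truncated_power (s - 1) (x - \<xi>))) (at x)"
    by (intro has_vector_derivative_of_real) simp
  moreover have "((\<lambda>x. H (of_real x)) has_vector_derivative deriv H (of_real x)) (at x)"
    using holomorphic_derivI[OF U(2,1) xU] by (rule has_vector_derivative_real_field)
  ultimately have "((\<lambda>x. of_real (truncated_power s (x - \<xi>)) * H (of_real x)) has_vector_derivative
      (of_real (truncated_power s (x - \<xi>)) * deriv H (of_real x)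
        + of_real (s * truncated_power (s - 1) (x - \<xi>)) * H (of_real x))) (at x)"
    by (rule has_vector_derivative_mult)
  moreover have "truncated_power s (x - \<xi>) = (x - \<xi>) * truncated_power (s - 1) (x - \<xi>)"
    using s by (intro truncated_power_mult) simp
  ultimately show ?thesis
    unfolding sing_fun_def[abs_def] by (simp add: algebra_simps)
qed

lemma sing_tower_derivative:
  assumes "open U" "H holomorphic_on U" "x \<ge> \<xi> \<Longrightarrow> complex_of_real x \<in> U" "s - real j > 1"
  shows "(sing_fun (s - real j) \<xi> (sing_tower s \<xi> H j) has_vector_derivative
     sing_fun (s - real (Suc j)) \<xi> (sing_tower s \<xi> H (Suc j)) x) (at x)"
  using sing_fun_has_derivative[OF assms(4,1) sing_tower_holomorphic[OF assms(1,2)] assms(3)]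
  by (simp add: algebra_simps)

lemma jacobi_moment_sing_fun_smooth:
  assumes \<xi>: "-1 < \<xi>" "\<xi> < 1" and ab: "a > -1" "b > -1" and U: "open U" "H holomorphic_on U"
    and X: "complex_of_real ` {\<xi>..1} \<subseteq> U" and s: "s > real M"
  shows "decays (- real M) (jacobi_moment a b (sing_fun s \<xi> H))"
proof -
  have "decays (- real M) (jacobi_moment a b ((\<lambda>j. sing_fun (s - real j) \<xi> (sing_tower s \<xi> H j)) 0))"
  proof (rule jacobi_moment_smooth[OF ab])
    fix j assume "j \<le> M"
    then show "continuous_on {-1..1} (sing_fun (s - real j) \<xi> (sing_tower s \<xi> H j))"
      using s X by (intro sing_fun_continuous[OF _ U(1) sing_tower_holomorphic[OF U]]) auto
  next
    fix j x assume "j < M" "x \<in> {-1<..<1::real}"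
    then show "(sing_fun (s - real j) \<xi> (sing_tower s \<xi> H j) has_vector_derivative
      sing_fun (s - real (Suc j)) \<xi> (sing_tower s \<xi> H (Suc j)) x) (at x)"
      using s X by (intro sing_tower_derivative[OF U]) auto
  qed
  then show ?thesis by simp
qed

section \<open>Asymptotics of the moments\<close>

text \<open>Phase and amplitude of Darboux's formula in the variable \<open>\<xi> = cos \<theta>\<close>.\<close>

definition jacobi_phase :: "real \<Rightarrow> real \<Rightarrow> real \<Rightarrow> nat \<Rightarrow> real" where
  "jacobi_phase a b \<xi> n = (real n + (a + b + 1) / 2) * arccos \<xi> - pi * a / 2 - pi / 4"

definition jacobi_amp :: "real \<Rightarrow> real \<Rightarrow> real \<Rightarrow> real" where
  "jacobi_amp a b \<xi> = sin (arccos \<xi> / 2) powr (- a - 1 / 2) * cos (arccos \<xi> / 2) powr (- b - 1 / 2) / sqrt pi"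

lemma decays_cos: "decays p (\<lambda>n. real n powr p * cos (g n))"
proof -
  have "decays (p + 0) (\<lambda>n. real n powr p * cos (g n))"
    by (intro decays_mult decays_powr decays_bounded[of _ 1]) simp
  then show ?thesis by simp
qed

lemma jacobi_P_leading:
  assumes a: "a > -1" and \<xi>: "-1 < \<xi>" "\<xi> < 1"
  shows "decays (- 3 / 2) (\<lambda>n. jacobi_P a b n \<xi> - jacobi_amp a b \<xi> * (real n powr (- 1 / 2) * cos (jacobi_phase a b \<xi> n)))"
    and "decays (- 1 / 2) (\<lambda>n. jacobi_P a b n \<xi>)"
proof -
  have "0 < arccos \<xi>" "arccos \<xi> < pi" "cos (arccos \<xi>) = \<xi>"
    using \<xi> arccos_lt_bounded[of \<xi>] by auto
  from jacobi_P_darboux[OF a this(1,2), of b] this(3)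
  show 1: "decays (- 3 / 2) (\<lambda>n. jacobi_P a b n \<xi> - jacobi_amp a b \<xi> * (real n powr (- 1 / 2) * cos (jacobi_phase a b \<xi> n)))"
    by (simp add: jacobi_amp_def jacobi_phase_def)
  show "decays (- 1 / 2) (\<lambda>n. jacobi_P a b n \<xi>)"
    by (rule decays_leading_imp[OF decays_cmult[OF decays_cos]]) (use 1 in simp)
qed

text \<open>Bateman's integral moves the parameters to \<open>a + s + 1\<close> and \<open>b - s - 1\<close>; their sum, and with
  it the frequency of the phase, is preserved.\<close>

definition moment_amp :: "real \<Rightarrow> real \<Rightarrow> real \<Rightarrow> real \<Rightarrow> real" where
  "moment_amp a b s \<xi> = Gamma (s + 1) * (1 - \<xi>) powr (a + s + 1) * jacobi_amp (a + s + 1) (b - s - 1) \<xi>"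

lemma jacobi_moment_pure_power_leading:
  assumes \<xi>: "-1 < \<xi>" "\<xi> < 1" and s: "s > -1" and a: "a > -1"
  shows "decays (- s - 5 / 2) (\<lambda>k. jacobi_moment a b (sing_fun s \<xi> (\<lambda>z. (1 + z) powr of_real (- b))) k
      - of_real (moment_amp a b s \<xi> * (real k powr (- s - 3 / 2) * cos (jacobi_phase (a + s + 1) (b - s - 1) \<xi> k))))"
    and "decays (- s - 3 / 2) (jacobi_moment a b (sing_fun s \<xi> (\<lambda>z. (1 + z) powr of_real (- b))))"
proof -
  let ?A = "a + s + 1" and ?B = "b - s - 1"
  let ?P = "\<lambda>k. jacobi_P ?A ?B k \<xi>"
  have A: "?A > -1" using s a by simp
  let ?g = "\<lambda>k. Gamma (real k + (a + 1)) / Gamma (real k + (?A + 1))"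
  let ?m = "\<lambda>k. jacobi_amp ?A ?B \<xi> * (real k powr (- 1 / 2) * cos (jacobi_phase ?A ?B \<xi> k))"
  let ?C = "Gamma (s + 1) * (1 - \<xi>) powr ?A"
  have e: "(a + 1) - (?A + 1) = - s - 1" by simp
  have lead: "decays ((- s - 1) + (- 1 / 2) - 1) (\<lambda>k. ?g k * ?P k - real k powr (- s - 1) * ?m k)"
  proof (rule decays_mult_leading)
    show "decays (- s - 1 - 1) (\<lambda>k. ?g k - real k powr (- s - 1))"
      using Gamma_ratio_leading[of "a + 1" "?A + 1"] unfolding e .
    show "decays (- 1 / 2 - 1) (\<lambda>k. ?P k - ?m k)"
      using jacobi_P_leading(1)[OF A \<xi>, of ?B] by simp
  qed (intro decays_powr decays_cmult decays_cos)+
  have ex: "(- s - 1) + (- 1 / 2) - 1 = - s - 5 / 2" by simp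
  have "decays (- s - 5 / 2) (\<lambda>k. ?C * (?g k * ?P k - real k powr (- s - 1) * ?m k))"
    using decays_cmult[OF lead] unfolding ex .
  moreover have "?C * (?g k * ?P k - real k powr (- s - 1) * ?m k)
      = ?C * ?g k * ?P k - moment_amp a b s \<xi> * (real k powr (- s - 3 / 2) * cos (jacobi_phase ?A ?B \<xi> k))" for k
  proof -
    have "real k powr (- s - 3 / 2) = real k powr (- s - 1) * real k powr (- 1 / 2)"
      unfolding powr_add[symmetric] by (rule arg_cong[of _ _ "\<lambda>t. real k powr t"]) simp
    then show ?thesis by (simp add: moment_amp_def right_diff_distrib mult_ac)
  qed
  ultimately have 1: "decays (- s - 5 / 2) (\<lambda>k. ?C * ?g k * ?P k
      - moment_amp a b s \<xi> * (real k powr (- s - 3 / 2) * cos (jacobi_phase ?A ?B \<xi> k)))"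
    by simp
  have 2: "decays (- s - 3 / 2) (\<lambda>k. ?C * ?g k * ?P k)"
  proof (rule decays_leading_imp[OF decays_cmult[OF decays_cos]])
    have e: "- s - 3 / 2 - 1 = - s - 5 / 2" by simp
    show "decays (- s - 3 / 2 - 1) (\<lambda>k. ?C * ?g k * ?P k
      - moment_amp a b s \<xi> * (real k powr (- s - 3 / 2) * cos (jacobi_phase ?A ?B \<xi> k)))"
      unfolding e by (rule 1)
  qed
  have m: "jacobi_moment a b (sing_fun s \<xi> (\<lambda>z. (1 + z) powr of_real (- b))) k = of_real (?C * ?g k * ?P k)" for k
    by (rule jacobi_moment_pure_power[OF \<xi> s a])
  show "decays (- s - 5 / 2) (\<lambda>k. jacobi_moment a b (sing_fun s \<xi> (\<lambda>z. (1 + z) powr of_real (- b))) k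
      - of_real (moment_amp a b s \<xi> * (real k powr (- s - 3 / 2) * cos (jacobi_phase ?A ?B \<xi> k))))"
    unfolding m of_real_diff[symmetric] decays_of_real by (rule 1)
  have "decays (- s - 3 / 2) (\<lambda>k. complex_of_real (?C * ?g k * ?P k))"
    unfolding decays_of_real by (rule 2)
  then show "decays (- s - 3 / 2) (jacobi_moment a b (sing_fun s \<xi> (\<lambda>z. (1 + z) powr of_real (- b))))"
    unfolding m[symmetric] .
qed

text \<open>A general factor is expanded in powers of \<open>x - \<xi>\<close> after splitting off \<open>(1 + x) ^ (-b)\<close>: each
  term is a pure truncated power of higher exponent and the Taylor remainder is smooth enough to
  be negligible.\<close>

lemma jacobi_moment_sing_fun_leading:
  assumes \<xi>: "-1 < \<xi>" "\<xi> < 1" and ab: "a > -1" "b > -1" and s: "s > -1"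
    and U: "open U" "H holomorphic_on U" and X: "complex_of_real ` {\<xi>..1} \<subseteq> U"
  shows "decays (- s - 5 / 2) (\<lambda>k. jacobi_moment a b (sing_fun s \<xi> H) k
      - of_real ((1 + \<xi>) powr b * moment_amp a b s \<xi>) * H (of_real \<xi>)
        * of_real (real k powr (- s - 3 / 2) * cos (jacobi_phase (a + s + 1) (b - s - 1) \<xi> k)))"
proof -
  define V where "V = U \<inter> {z. Re z > -1}"
  have V: "open V" unfolding V_def using U(1) open_halfspace_Re_gt[of "-1"] by (intro open_Int) auto
  have XV: "complex_of_real ` {\<xi>..1} \<subseteq> V" using X \<xi> by (auto simp: V_def)
  then have \<xi>V: "of_real \<xi> \<in> V" using \<xi> by auto
  have pos: "1 + z \<notin> \<real>\<^sub>\<le>\<^sub>0" if "z \<in> V" for z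
    using that by (auto simp: V_def complex_nonpos_Reals_iff)
  have w_hol: "(\<lambda>z. (1 + z) powr of_real c) holomorphic_on V" for c
    by (intro holomorphic_intros) (use pos in auto)
  have cancel: "(1 + z) powr of_real (- b) * (1 + z) powr of_real b = 1" if "z \<in> V" for z
  proof -
    have "1 + z \<noteq> 0" using pos[OF that] by auto
    then show ?thesis by (simp add: powr_minus)
  qed
  define G where "G = (\<lambda>z. H z * (1 + z) powr of_real b)"
  have G: "G holomorphic_on V"
    unfolding G_def using U(2) V_def by (intro holomorphic_intros w_hol holomorphic_on_subset[OF U(2)]) auto
  \<comment> \<open>\<open>M\<close> derivatives make the Taylor remainder negligible, and the order \<open>M + 2\<close> of the expansion
    provides them because the exponent \<open>s + M + 2\<close>
    exceeds \<open>M\<close> for every \<open>s > -1\<close>.\<close>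
  define M where "M = nat \<lceil>s + 5 / 2\<rceil>"
  have M: "real M \<ge> s + 5 / 2" unfolding M_def by linarith
  define N where "N = M + 2"
  obtain c g where g: "g holomorphic_on V"
    and eq: "\<And>z. z \<in> V \<Longrightarrow> G z = (\<Sum>j<N. c j * (z - of_real \<xi>) ^ j) + (z - of_real \<xi>) ^ N * g z"
    using holomorphic_taylor_remainder[OF V G \<xi>V, of N] by blast
  have c0: "c 0 = G (of_real \<xi>)"
    using eq[OF \<xi>V] by (simp add: N_def lessThan_Suc_eq_insert_0 sum.reindex zero_power)
  let ?w = "\<lambda>z. (1 + z) powr complex_of_real (- b)"
  let ?f = "\<lambda>j. sing_fun (s + real j) \<xi> ?w"
  let ?r = "sing_fun (s + real N) \<xi> (\<lambda>z. ?w z * g z)"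
  have r_hol: "(\<lambda>z. ?w z * g z) holomorphic_on V" by (intro holomorphic_intros w_hol g)
  have ptw: "sing_fun s \<xi> H x = (\<Sum>j<N. c j * ?f j x) + ?r x" if x: "x \<in> {-1..1}" for x
  proof (cases "x < \<xi>")
    case True
    then show ?thesis by (simp add: sing_fun_def truncated_power_def)
  next
    case False
    then have xV: "of_real x \<in> V" using x XV by auto
    have H: "H (of_real x) = ?w (of_real x) * G (of_real x)"
      using cancel[OF xV] by (simp add: G_def mult_ac)
    have tp: "of_real (truncated_power s (x - \<xi>)) * (of_real x - of_real \<xi>) ^ j
        = complex_of_real (truncated_power (s + real j) (x - \<xi>))" for j
      using truncated_power_mult_power[of "x - \<xi>" s j] False s
      by (simp flip: of_real_diff of_real_power of_real_mult)
    have "sing_fun s \<xi> H x = (\<Sum>j<N. c j * ((of_real (truncated_power s (x - \<xi>)) * (of_real x - of_real \<xi>) ^ j) * ?w (of_real x)))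
        + (of_real (truncated_power s (x - \<xi>)) * (of_real x - of_real \<xi>) ^ N) * (?w (of_real x) * g (of_real x))"
      unfolding sing_fun_def H eq[OF xV] by (simp only: distrib_left sum_distrib_left mult_ac)
    then show ?thesis unfolding tp sing_fun_def .
  qed
  have cont: "continuous_on {\<xi>..1} (\<lambda>x. h (complex_of_real x))" if "h holomorphic_on V" for h
    by (rule continuous_on_compose2[OF holomorphic_on_imp_continuous_on[OF that]])
       (use XV in \<open>auto intro!: continuous_intros\<close>)
  have fint: "weight_integrable a b (\<lambda>x. c j * (?f j x * of_real (jacobi_P a b k x)))" for j k
    by (intro weight_integrable_cmult weight_integrable_mult sing_fun_weight_integrable \<xi> ab cont w_hol
          continuous_on_of_real_jacobi_P) (use s in simp)
  have rint: "weight_integrable a b (\<lambda>x. ?r x * of_real (jacobi_P a b k x))" for k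
    by (intro weight_integrable_mult sing_fun_weight_integrable \<xi> ab cont r_hol
          continuous_on_of_real_jacobi_P) (use s in simp)
  have expand: "jacobi_moment a b (sing_fun s \<xi> H) k = (\<Sum>j<N. c j * jacobi_moment a b (?f j) k) + jacobi_moment a b ?r k" for k
  proof -
    have "jacobi_moment a b (sing_fun s \<xi> H) k = weight_integral a b
        (\<lambda>x. (\<Sum>j\<in>{..<N}. c j * (?f j x * of_real (jacobi_P a b k x))) + ?r x * of_real (jacobi_P a b k x))"
      unfolding jacobi_moment_def
      by (rule weight_integral_cong) (simp only: ptw distrib_right sum_distrib_right mult.assoc)
    also have "\<dots> = weight_integral a b (\<lambda>x. \<Sum>j\<in>{..<N}. c j * (?f j x * of_real (jacobi_P a b k x))) + jacobi_moment a b ?r k"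
      unfolding jacobi_moment_def
      by (rule weight_integral_add[OF weight_integral_sum(2) rint]) (use fint in auto)
    also have "weight_integral a b (\<lambda>x. \<Sum>j\<in>{..<N}. c j * (?f j x * of_real (jacobi_P a b k x)))
        = (\<Sum>j<N. c j * jacobi_moment a b (?f j) k)"
      unfolding jacobi_moment_def weight_integral_cmult[symmetric]
      by (rule weight_integral_sum(1)) (use fint in auto)
    finally show ?thesis .
  qed
  have small: "decays (- s - 5 / 2) (\<lambda>k. \<Sum>j\<in>{1..<N}. c j * jacobi_moment a b (?f j) k)"
  proof (rule decays_sum)
    fix j assume j: "j \<in> {1..<N}"
    have "decays (- (s + real j) - 3 / 2) (jacobi_moment a b (?f j))"
      by (rule jacobi_moment_pure_power_leading(2)[OF \<xi> _ ab(1)]) (use s in simp)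
    then have "decays (- s - 5 / 2) (jacobi_moment a b (?f j))"
      by (rule decays_mono) (use j in simp)
    then show "decays (- s - 5 / 2) (\<lambda>k. c j * jacobi_moment a b (?f j) k)" by (rule decays_cmult)
  qed simp
  have rem: "decays (- s - 5 / 2) (jacobi_moment a b ?r)"
  proof (rule decays_mono)
    show "decays (- real M) (jacobi_moment a b ?r)"
      by (rule jacobi_moment_sing_fun_smooth[OF \<xi> ab V r_hol XV]) (use s in \<open>simp add: N_def\<close>)
  qed (use M in simp)
  let ?main = "\<lambda>k. complex_of_real (moment_amp a b s \<xi> * (real k powr (- s - 3 / 2) * cos (jacobi_phase (a + s + 1) (b - s - 1) \<xi> k)))"
  have lead: "decays (- s - 5 / 2) (\<lambda>k. c 0 * (jacobi_moment a b (?f 0) k - ?main k))"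
    using jacobi_moment_pure_power_leading(1)[OF \<xi> s ab(1), of b] by (intro decays_cmult) simp
  have "decays (- s - 5 / 2) (\<lambda>k. c 0 * (jacobi_moment a b (?f 0) k - ?main k)
      + (\<Sum>j\<in>{1..<N}. c j * jacobi_moment a b (?f j) k) + jacobi_moment a b ?r k)"
    by (intro decays_add lead small rem)
  moreover have "(\<Sum>j<N. c j * jacobi_moment a b (?f j) k)
      = c 0 * jacobi_moment a b (?f 0) k + (\<Sum>j\<in>{1..<N}. c j * jacobi_moment a b (?f j) k)" for k
  proof -
    have "{..<N} = insert 0 {1..<N}" by (auto simp: N_def)
    then show ?thesis by simp
  qed
  moreover have "c 0 = H (of_real \<xi>) * of_real ((1 + \<xi>) powr b)"
    unfolding c0 G_def using powr_of_real[of "1 + \<xi>" b] \<xi> by simp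
  ultimately show ?thesis
    unfolding expand by (simp add: algebra_simps)
qed

lemma decays_jacobi_moment_sing_fun:
  assumes \<xi>: "-1 < \<xi>" "\<xi> < 1" and ab: "a > -1" "b > -1" and s: "s > -1"
    and U: "open U" "H holomorphic_on U" and X: "complex_of_real ` {\<xi>..1} \<subseteq> U"
  shows "decays (- s - 3 / 2) (jacobi_moment a b (sing_fun s \<xi> H))"
proof (rule decays_leading_imp)
  let ?c = "of_real ((1 + \<xi>) powr b * moment_amp a b s \<xi>) * H (of_real \<xi>)"
  show "decays (- s - 3 / 2) (\<lambda>k. ?c * of_real (real k powr (- s - 3 / 2) * cos (jacobi_phase (a + s + 1) (b - s - 1) \<xi> k)))"
    by (intro decays_cmult) (simp only: decays_of_real decays_cos)
  show "decays (- s - 3 / 2 - 1) (\<lambda>k. jacobi_moment a b (sing_fun s \<xi> H) k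
      - ?c * of_real (real k powr (- s - 3 / 2) * cos (jacobi_phase (a + s + 1) (b - s - 1) \<xi> k)))"
  proof -
    have e: "- s - 3 / 2 - 1 = - s - 5 / 2" by simp
    show ?thesis unfolding e by (rule jacobi_moment_sing_fun_leading[OF \<xi> ab s U X])
  qed
qed

section \<open>Asymptotics of the coefficients\<close>

text \<open>Half-angle formulas for \<open>\<xi> = cos \<theta>\<close>: \<open>sin (\<theta> / 2)^2 = (1 - \<xi>) / 2\<close> and
  \<open>cos (\<theta> / 2)^2 = (1 + \<xi>) / 2\<close>.\<close>

lemma amplitude_eq:
  assumes \<xi>: "-1 < \<xi>" "\<xi> < 1"
  shows "amplitude s \<xi> a b g = of_real ((1 + \<xi>) powr b * moment_amp a b s \<xi> / 2 powr (a + b)) * g (of_real \<xi>)"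
proof -
  define p q where "p = 1 - \<xi>" and "q = 1 + \<xi>"
  have pq: "p > 0" "q > 0" using \<xi> by (simp_all add: p_def q_def)
  have sn: "sin (arccos \<xi> / 2) = (p / 2) powr (1 / 2)"
  proof -
    have "cos (2 * (arccos \<xi> / 2)) = \<xi>" using \<xi> by simp
    then have "(sin (arccos \<xi> / 2))\<^sup>2 = p / 2" unfolding cos_double_sin by (simp add: p_def)
    moreover have "sin (arccos \<xi> / 2) \<ge> 0"
      using \<xi> arccos_bounded[of \<xi>] by (intro sin_ge_zero) auto
    ultimately show ?thesis using pq by (simp add: powr_half_sqrt real_sqrt_unique)
  qed
  have cs: "cos (arccos \<xi> / 2) = (q / 2) powr (1 / 2)"
  proof -
    have "cos (2 * (arccos \<xi> / 2)) = \<xi>" using \<xi> by simp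
    then have "(cos (arccos \<xi> / 2))\<^sup>2 = q / 2" unfolding cos_double_cos by (simp add: q_def)
    moreover have "cos (arccos \<xi> / 2) \<ge> 0"
      using \<xi> arccos_bounded[of \<xi>] by (intro cos_ge_zero) auto
    ultimately show ?thesis using pq by (simp add: powr_half_sqrt real_sqrt_unique)
  qed
  let ?A = "a + s + 1" and ?B = "b - s - 1"
  have "q powr b * (p powr ?A * ((p / 2) powr (1 / 2 * (- ?A - 1 / 2)) * (q / 2) powr (1 / 2 * (- ?B - 1 / 2)))) / 2 powr (a + b)
      = p powr ((s + a) / 2 + 1 / 4) * q powr ((s + b) / 2 + 1 / 4) / 2 powr ((a + b - 1) / 2)"
  proof -
    have p': "p powr ((s + a) / 2 + 1 / 4) = p powr ?A * p powr (1 / 2 * (- ?A - 1 / 2))"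
      unfolding powr_add[symmetric] by (rule arg_cong[of _ _ "\<lambda>t. p powr t"]) (simp add: field_simps)
    have q': "q powr ((s + b) / 2 + 1 / 4) = q powr b * q powr (1 / 2 * (- ?B - 1 / 2))"
      unfolding powr_add[symmetric] by (rule arg_cong[of _ _ "\<lambda>t. q powr t"]) (simp add: field_simps)
    have t': "2 powr ((a + b - 1) / 2) = 2 powr (a + b) * (2 powr (1 / 2 * (- ?A - 1 / 2)) * (2::real) powr (1 / 2 * (- ?B - 1 / 2)))"
      unfolding powr_add[symmetric] by (rule arg_cong[of _ _ "\<lambda>t. 2 powr t"]) (simp add: field_simps)
    show ?thesis unfolding p' q' t' using pq by (simp add: powr_divide mult_ac)
  qed
  then have "Gamma (s + 1) * (q powr b * (p powr ?A * ((p / 2) powr (1 / 2 * (- ?A - 1 / 2)) * (q / 2) powr (1 / 2 * (- ?B - 1 / 2)))) / 2 powr (a + b)) / sqrt pi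
      = Gamma (s + 1) * (p powr ((s + a) / 2 + 1 / 4) * q powr ((s + b) / 2 + 1 / 4) / 2 powr ((a + b - 1) / 2)) / sqrt pi"
    by simp
  then have "Gamma (s + 1) * p powr ((s + a) / 2 + 1 / 4) * q powr ((s + b) / 2 + 1 / 4) / (2 powr ((a + b - 1) / 2) * sqrt pi)
      = (1 + \<xi>) powr b * moment_amp a b s \<xi> / 2 powr (a + b)"
    unfolding moment_amp_def jacobi_amp_def sn cs powr_powr p_def[symmetric] q_def[symmetric]
    by (simp add: mult_ac)
  then show ?thesis unfolding amplitude_def p_def q_def by simp
qed

lemma jacobi_coeff_sing_fun_leading:
  assumes \<xi>: "-1 < \<xi>" "\<xi> < 1" and ab: "a > -1" "b > -1" and s: "s > -1"
    and U: "open U" "g holomorphic_on U" and X: "complex_of_real ` {\<xi>..1} \<subseteq> U"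
  shows "decays (- (s + 3 / 2)) (\<lambda>k. jacobi_coeff a b (sing_fun s \<xi> g) k - amplitude s \<xi> a b g *
     of_real (cos (real k * arccos \<xi> - phase s a b \<xi>) / real k powr (s + 1 / 2)))"
proof -
  let ?c = "of_real ((1 + \<xi>) powr b * moment_amp a b s \<xi>) * g (of_real \<xi>)"
  let ?ph = "jacobi_phase (a + s + 1) (b - s - 1) \<xi>"
  have ph: "?ph k = real k * arccos \<xi> - phase s a b \<xi>" for k
    by (simp add: jacobi_phase_def phase_def field_simps)
  have "decays ((- s - 3 / 2) + 1 - 1) (\<lambda>k. jacobi_moment a b (sing_fun s \<xi> g) k * of_real (1 / jacobi_h a b k)
      - ?c * of_real (real k powr (- s - 3 / 2) * cos (?ph k)) * of_real (real k / 2 powr (a + b)))"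
  proof (rule decays_mult_leading)
    show "decays (- s - 3 / 2) (\<lambda>k. ?c * of_real (real k powr (- s - 3 / 2) * cos (?ph k)))"
      by (intro decays_cmult) (simp only: decays_of_real decays_cos)
    show "decays (- s - 3 / 2 - 1) (\<lambda>k. jacobi_moment a b (sing_fun s \<xi> g) k
        - ?c * of_real (real k powr (- s - 3 / 2) * cos (?ph k)))"
    proof -
      have e: "- s - 3 / 2 - 1 = - s - 5 / 2" by simp
      show ?thesis unfolding e by (rule jacobi_moment_sing_fun_leading[OF \<xi> ab s U X])
    qed
    have "decays 1 (\<lambda>k. 1 / 2 powr (a + b) * real k)"
      by (intro decays_cmult decays_cong[OF decays_powr[of 1]]) simp
    then show "decays 1 (\<lambda>k. complex_of_real (real k / 2 powr (a + b)))"
      unfolding decays_of_real by simp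
    show "decays (1 - 1) (\<lambda>k. complex_of_real (1 / jacobi_h a b k) - of_real (real k / 2 powr (a + b)))"
      unfolding of_real_diff[symmetric] decays_of_real using jacobi_h_inverse_leading[OF ab] by simp
  qed
  then have D: "decays (- (s + 3 / 2)) (\<lambda>k. jacobi_moment a b (sing_fun s \<xi> g) k * of_real (1 / jacobi_h a b k)
      - ?c * of_real (real k powr (- s - 3 / 2) * cos (?ph k)) * of_real (real k / 2 powr (a + b)))"
    by (simp add: algebra_simps)
  show ?thesis
  proof (rule decays_cong[OF D], rule eventually_mono[OF eventually_gt_at_top[of 0]])
    fix k :: nat assume k: "0 < k"
    have "real k powr (- s - 3 / 2) * real k = 1 / real k powr (s + 1 / 2)"
    proof -
      have "real k powr (- s - 3 / 2) * real k powr 1 = real k powr (- (s + 1 / 2))"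
        unfolding powr_add[symmetric] by (rule arg_cong[of _ _ "\<lambda>t. real k powr t"]) simp
      also have "\<dots> = 1 / real k powr (s + 1 / 2)" by (rule powr_minus_divide)
      finally show ?thesis using k by simp
    qed
    then have "complex_of_real (real k powr (- s - 3 / 2) * real k * cos (?ph k))
        = of_real (cos (?ph k) / real k powr (s + 1 / 2))" by simp
    then have "?c * of_real (real k powr (- s - 3 / 2) * cos (?ph k)) * of_real (real k / 2 powr (a + b))
        = amplitude s \<xi> a b g * of_real (cos (?ph k) / real k powr (s + 1 / 2))"
      unfolding amplitude_eq[OF \<xi>] by (simp add: mult_ac)
    moreover have "jacobi_moment a b (sing_fun s \<xi> g) k * of_real (1 / jacobi_h a b k) = jacobi_coeff a b (sing_fun s \<xi> g) k"
      unfolding jacobi_coeff_eq_moment by simp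
    ultimately show "jacobi_coeff a b (sing_fun s \<xi> g) k - amplitude s \<xi> a b g *
        of_real (cos (real k * arccos \<xi> - phase s a b \<xi>) / real k powr (s + 1 / 2))
      = jacobi_moment a b (sing_fun s \<xi> g) k * of_real (1 / jacobi_h a b k)
      - ?c * of_real (real k powr (- s - 3 / 2) * cos (?ph k)) * of_real (real k / 2 powr (a + b))"
      unfolding ph by simp
  qed
qed

section \<open>The remainder of the projection\<close>

text \<open>By \<open>D 0 y - D 0 x = (y - x) \<integral> D 1 (x + t (y - x)) dt\<close> the difference quotient inherits all
  but one of the derivatives, also at \<open>y = x\<close>. This is the smooth counterpart of division by
  \<open>z - x\<close> for holomorphic functions.\<close>

lemma difference_quotient_tower:
  fixes D :: "nat \<Rightarrow> real \<Rightarrow> complex"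
  assumes x: "x \<in> {-1..1}"
    and cont: "\<And>j. j \<le> Suc M \<Longrightarrow> continuous_on {-1..1} (D j)"
    and der: "\<And>j y. j \<le> M \<Longrightarrow> y \<in> {-1..1} \<Longrightarrow> (D j has_vector_derivative D (Suc j) y) (at y)"
  defines "Q \<equiv> \<lambda>j y. integral {0..1} (\<lambda>t. of_real (t ^ j) * D (Suc j) (x + t * (y - x)))"
  shows "\<And>y. y \<in> {-1..1} \<Longrightarrow> D 0 y - D 0 x = of_real (y - x) * Q 0 y"
    and "\<And>j. j \<le> M \<Longrightarrow> continuous_on {-1..1} (Q j)"
    and "\<And>j y. j < M \<Longrightarrow> y \<in> {-1<..<1} \<Longrightarrow> (Q j has_vector_derivative Q (Suc j) y) (at y)"
proof -
  have seg: "x + t * (y - x) \<in> {-1..1}" if "y \<in> {-1..1}" "t \<in> {0..1}" for t y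
  proof -
    have "(1 - t) *\<^sub>R x + t *\<^sub>R y \<in> {-1..1}"
      by (rule convexD[OF convex_real_interval(5)]) (use x that in auto)
    then show ?thesis by (simp add: algebra_simps)
  qed
  have contp: "continuous_on ({-1..1} \<times> {0..1}) (\<lambda>(y, t). of_real (t ^ i) * D j (x + t * (y - x)))"
    if "j \<le> Suc M" for i j
    unfolding case_prod_unfold
  proof (intro continuous_on_mult)
    show "continuous_on ({-1..1} \<times> {0..1}) (\<lambda>p. D j (x + snd p * (fst p - x)))"
      by (rule continuous_on_compose2[OF cont[OF that]]) (use seg in \<open>auto intro!: continuous_intros\<close>)
  qed (intro continuous_intros)
  show "D 0 y - D 0 x = of_real (y - x) * Q 0 y" if y: "y \<in> {-1..1}" for y
  proof -
    have "((\<lambda>t. D 0 (x + t * (y - x))) has_vector_derivative ((y - x) *\<^sub>R D (Suc 0) (x + t * (y - x)))) (at t within {0..1})"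
      if t: "t \<in> {0..1}" for t
    proof -
      have "((\<lambda>t. x + t * (y - x)) has_vector_derivative (y - x)) (at t within {0..1})"
        by (auto intro!: derivative_eq_intros simp flip: has_real_derivative_iff_has_vector_derivative)
      moreover have "(D 0 has_vector_derivative D (Suc 0) (x + t * (y - x)))
          (at (x + t * (y - x)) within (\<lambda>t. x + t * (y - x)) ` {0..1})"
        by (rule has_vector_derivative_at_within[OF der]) (use seg[OF y t] in auto)
      ultimately show ?thesis
        using vector_diff_chain_within by (fastforce simp: o_def)
    qed
    then have "((\<lambda>t. (y - x) *\<^sub>R D (Suc 0) (x + t * (y - x))) has_integral
        (D 0 (x + 1 * (y - x)) - D 0 (x + 0 * (y - x)))) {0..1}"
      by (intro fundamental_theorem_of_calculus) auto
    then show ?thesis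
      by (simp add: Q_def integral_unique[symmetric] scaleR_conv_of_real flip: integral_mult_right)
  qed
  show "continuous_on {-1..1} (Q j)" if "j \<le> M" for j
    unfolding Q_def
    using integral_continuous_on_param[of "{-1..1}" 0 1 "\<lambda>y t. of_real (t ^ j) * D (Suc j) (x + t * (y - x))"]
      contp[of "Suc j" j] that by simp
  show "(Q j has_vector_derivative Q (Suc j) y) (at y)" if j: "j < M" and y: "y \<in> {-1<..<1}" for j y
  proof -
    have "((\<lambda>y. integral (cbox 0 1) (\<lambda>t. of_real (t ^ j) * D (Suc j) (x + t * (y - x)))) has_vector_derivative
        integral (cbox 0 1) (\<lambda>t. of_real (t ^ Suc j) * D (Suc (Suc j)) (x + t * (y - x)))) (at y within {-1..1})"
    proof (rule leibniz_rule_vector_derivative)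
      fix z t :: real assume z: "z \<in> {-1..1}" and t: "t \<in> cbox 0 1"
      have "((\<lambda>z. x + t * (z - x)) has_vector_derivative t) (at z within {-1..1})"
        by (auto intro!: derivative_eq_intros simp flip: has_real_derivative_iff_has_vector_derivative)
      moreover have "(D (Suc j) has_vector_derivative D (Suc (Suc j)) (x + t * (z - x)))
          (at (x + t * (z - x)) within (\<lambda>z. x + t * (z - x)) ` {-1..1})"
        by (rule has_vector_derivative_at_within[OF der]) (use seg[OF z, of t] t j in auto)
      ultimately have "((\<lambda>z. D (Suc j) (x + t * (z - x))) has_vector_derivative (t *\<^sub>R D (Suc (Suc j)) (x + t * (z - x)))) (at z within {-1..1})"
        using vector_diff_chain_within by (fastforce simp: o_def)
      then have "((\<lambda>z. of_real (t ^ j) * D (Suc j) (x + t * (z - x))) has_vector_derivative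
          of_real (t ^ j) * (t *\<^sub>R D (Suc (Suc j)) (x + t * (z - x)))) (at z within {-1..1})"
        by (rule has_vector_derivative_mult_right)
      then show "((\<lambda>z. of_real (t ^ j) * D (Suc j) (x + t * (z - x))) has_vector_derivative
          of_real (t ^ Suc j) * D (Suc (Suc j)) (x + t * (z - x))) (at z within {-1..1})"
        by (simp add: scaleR_conv_of_real mult_ac)
    next
      fix z :: real assume z: "z \<in> {-1..1}"
      have "continuous_on {0..1} (\<lambda>t. of_real (t ^ j) * D (Suc j) (x + t * (z - x)))"
      proof (intro continuous_on_mult)
        show "continuous_on {0..1} (\<lambda>t. D (Suc j) (x + t * (z - x)))"
          by (rule continuous_on_compose2[OF cont[of "Suc j"]]) (use j seg[OF z] in \<open>auto intro!: continuous_intros\<close>)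
      qed (intro continuous_intros)
      then show "(\<lambda>t. of_real (t ^ j) * D (Suc j) (x + t * (z - x))) integrable_on cbox 0 1"
        unfolding cbox_interval by (rule integrable_continuous_interval)
    next
      show "continuous_on ({-1..1} \<times> cbox 0 1) (\<lambda>(z, t). of_real (t ^ Suc j) * D (Suc (Suc j)) (x + t * (z - x)))"
        using contp[of "Suc (Suc j)" "Suc j"] j by simp
    qed (use y in auto)
    then have "(Q j has_vector_derivative Q (Suc j) y) (at y within {-1..1})" by (simp add: Q_def)
    then show ?thesis using y at_within_Icc_at[of "-1" y 1] by simp
  qed
qed

text \<open>To the left of \<open>\<xi>\<close> the function is \<open>0\<close>, and dividing it by \<open>y - x\<close> only divides the
  holomorphic factor, whose relevant arguments lie to the right of \<open>\<xi>\<close>.\<close>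

lemma sing_fun_quotient_left:
  assumes \<xi>: "-1 < \<xi>" "\<xi> < 1" and ab: "a > -1" "b > -1" and s: "s > 0"
    and U: "open U" "g holomorphic_on U" and X: "complex_of_real ` {-1..1} \<subseteq> U"
    and x: "x < \<xi>"
  shows "\<exists>q. weight_integrable a b q \<and>
      (\<forall>y\<in>{-1..1}. sing_fun s \<xi> g y - sing_fun s \<xi> g x = of_real (y - x) * q y) \<and>
      decays (- s - 3 / 2) (jacobi_moment a b q)"
proof -
  let ?G = "\<lambda>z. g z / (z - of_real x)" and ?V = "U - {of_real x}"
  have V: "open ?V" using U(1) by (rule open_delete)
  have G: "?G holomorphic_on ?V"
    by (intro holomorphic_intros holomorphic_on_subset[OF U(2)]) auto
  have XV: "complex_of_real ` {\<xi>..1} \<subseteq> ?V" using X \<xi> x by force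
  have cont: "continuous_on {\<xi>..1} (\<lambda>y. ?G (complex_of_real y))"
    by (rule continuous_on_compose2[OF holomorphic_on_imp_continuous_on[OF G]])
       (use XV in \<open>auto intro!: continuous_intros\<close>)
  show ?thesis
  proof (intro exI[of _ "sing_fun s \<xi> ?G"] conjI ballI)
    show "weight_integrable a b (sing_fun s \<xi> ?G)"
      using s by (intro sing_fun_weight_integrable \<xi> ab cont) auto
    show "decays (- s - 3 / 2) (jacobi_moment a b (sing_fun s \<xi> ?G))"
      using s by (intro decays_jacobi_moment_sing_fun[OF \<xi> ab _ V G XV]) simp
    fix y :: real
    show "sing_fun s \<xi> g y - sing_fun s \<xi> g x = of_real (y - x) * sing_fun s \<xi> ?G y"
      using x by (cases "y = x") (auto simp: sing_fun_def truncated_power_def)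
  qed
qed

text \<open>To the right of \<open>\<xi>\<close> the value \<open>f(x)\<close> is subtracted also where \<open>f\<close> vanishes, so the quotient
  is no longer a truncated power times a smooth function. Multiplying \<open>f\<close> by a polynomial that is
  \<open>0\<close> at \<open>x\<close> and equals \<open>1\<close> to high order at \<open>\<xi>\<close> separates the singular part, whose quotient is
  again a truncated power times a holomorphic function, from a part that is as smooth as required.\<close>

lemma sing_fun_quotient_right:
  assumes \<xi>: "-1 < \<xi>" "\<xi> < 1" and ab: "a > -1" "b > -1" and s: "s > 0"
    and U: "open U" "g holomorphic_on U" and X: "complex_of_real ` {-1..1} \<subseteq> U"
    and x: "\<xi> < x" "x \<le> 1"
  shows "\<exists>q. weight_integrable a b q \<and>
      (\<forall>y\<in>{-1..1}. sing_fun s \<xi> g y - sing_fun s \<xi> g x = of_real (y - x) * q y) \<and>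
      decays (- s - 3 / 2) (jacobi_moment a b q)"
proof -
  \<comment> \<open>\<open>M\<close> derivatives of the quotient suffice for the required decay; \<open>s + N\<close> leaves room for the
    one that is lost in the quotient.\<close>
  define M where "M = nat \<lceil>s + 3 / 2\<rceil>"
  have M: "real M \<ge> s + 3 / 2" unfolding M_def by linarith
  define N where "N = M + 2"
  have X\<xi>: "complex_of_real ` {\<xi>..1} \<subseteq> U" using X \<xi> by auto
  have xi: "x \<in> {-1..1}" using x \<xi> by auto
  have d: "complex_of_real (x - \<xi>) \<noteq> 0" using x by simp
  \<comment> \<open>\<open>K\<close> vanishes at \<open>x\<close>, so \<open>G = K / (z - x)\<close> is holomorphic, and \<open>F\<close> is the factor of the
    complementary part, which carries the exponent \<open>s + N\<close>.\<close>
  define K where "K = (\<lambda>z. (1 - ((z - of_real \<xi>) / of_real (x - \<xi>)) ^ N) * g z)"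
  have K: "K holomorphic_on U" unfolding K_def using d by (intro holomorphic_intros U(2)) auto
  have Kx: "K (of_real x) = 0" using d by (simp add: K_def)
  define G where "G = (\<lambda>z. if z = of_real x then deriv K (of_real x) else (K z - K (of_real x)) / (z - of_real x))"
  have G: "G holomorphic_on U" unfolding G_def by (rule pole_lemma_open[OF K U(1)])
  have KG: "K z = (z - of_real x) * G z" for z by (simp add: G_def Kx)
  define F where "F = (\<lambda>z. g z / of_real ((x - \<xi>) ^ N))"
  have F: "F holomorphic_on U" unfolding F_def using x by (intro holomorphic_intros U(2)) auto
  define D where "D = (\<lambda>j. sing_fun (s + real N - real j) \<xi> (sing_tower (s + real N) \<xi> F j))"
  define Q where "Q = (\<lambda>j y. integral {0..1} (\<lambda>t. of_real (t ^ j) * D (Suc j) (x + t * (y - x))))"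
  have split: "sing_fun s \<xi> g y = of_real (y - x) * sing_fun s \<xi> G y + D 0 y" for y
  proof (cases "y < \<xi>")
    case True
    then show ?thesis by (simp add: D_def sing_fun_def truncated_power_def)
  next
    case False
    have "truncated_power (s + real N) (y - \<xi>) = truncated_power s (y - \<xi>) * (y - \<xi>) ^ N"
      using truncated_power_mult_power[of "y - \<xi>" s N] False s by simp
    then have "D 0 y = of_real (truncated_power s (y - \<xi>)) * ((of_real (y - \<xi>) / of_real (x - \<xi>)) ^ N * g (of_real y))"
      by (simp add: D_def sing_fun_def F_def power_divide)
    moreover have "of_real (y - x) * sing_fun s \<xi> G y = of_real (truncated_power s (y - \<xi>)) * K (of_real y)"
      unfolding KG sing_fun_def by simp
    ultimately show ?thesis by (simp add: K_def sing_fun_def algebra_simps)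
  qed
  have contD: "continuous_on {-1..1} (D j)" if "j \<le> Suc M" for j
    unfolding D_def
    by (rule sing_fun_continuous[OF _ U(1) sing_tower_holomorphic[OF U(1) F]])
       (use that X s in \<open>auto simp: N_def\<close>)
  have derD: "(D j has_vector_derivative D (Suc j) y) (at y)" if "j \<le> M" "y \<in> {-1..1}" for j y
    unfolding D_def
    by (rule sing_tower_derivative[OF U(1) F]) (use that X s in \<open>auto simp: N_def\<close>)
  have Q1: "D 0 y - D 0 x = of_real (y - x) * Q 0 y" if "y \<in> {-1..1}" for y
    unfolding Q_def by (rule difference_quotient_tower(1)[where D = D and M = M, OF xi contD derD that])
  have Q2: "continuous_on {-1..1} (Q j)" if "j \<le> M" for j
    unfolding Q_def by (rule difference_quotient_tower(2)[where D = D and M = M, OF xi contD derD that])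
  have Q3: "(Q j has_vector_derivative Q (Suc j) y) (at y)" if "j < M" "y \<in> {-1<..<1}" for j y
    unfolding Q_def by (rule difference_quotient_tower(3)[where D = D and M = M, OF xi contD derD that])
  have contG: "continuous_on {\<xi>..1} (\<lambda>y. G (complex_of_real y))"
    by (rule continuous_on_compose2[OF holomorphic_on_imp_continuous_on[OF G]])
       (use X\<xi> in \<open>auto intro!: continuous_intros\<close>)
  have i1: "weight_integrable a b (sing_fun s \<xi> G)"
    using s by (intro sing_fun_weight_integrable \<xi> ab contG) auto
  have i2: "weight_integrable a b (Q 0)"
    by (intro weight_integrable_continuous ab Q2) simp_all
  have m1: "decays (- s - 3 / 2) (jacobi_moment a b (sing_fun s \<xi> G))"
    using s by (intro decays_jacobi_moment_sing_fun[OF \<xi> ab _ U(1) G X\<xi>]) simp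
  have m2: "decays (- s - 3 / 2) (jacobi_moment a b (Q 0))"
    by (rule decays_mono[OF jacobi_moment_smooth[OF ab, of M Q]]) (use Q2 Q3 M in auto)
  have "jacobi_moment a b (\<lambda>y. sing_fun s \<xi> G y + Q 0 y)
      = (\<lambda>k. jacobi_moment a b (sing_fun s \<xi> G) k + jacobi_moment a b (Q 0) k)"
    unfolding jacobi_moment_def distrib_right
    by (intro ext weight_integral_add weight_integrable_mult i1 i2 continuous_on_of_real_jacobi_P ab)
  then have "decays (- s - 3 / 2) (jacobi_moment a b (\<lambda>y. sing_fun s \<xi> G y + Q 0 y))"
    using decays_add[OF m1 m2] by (simp only:)
  moreover have "sing_fun s \<xi> g y - sing_fun s \<xi> g x = of_real (y - x) * (sing_fun s \<xi> G y + Q 0 y)"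
    if "y \<in> {-1..1}" for y
    unfolding split[of y] split[of x] using Q1[OF that] Q1[OF xi] by (simp add: algebra_simps)
  ultimately show ?thesis
    by (intro exI[of _ "\<lambda>y. sing_fun s \<xi> G y + Q 0 y"]) (auto intro!: weight_integrable_add i1 i2)
qed

text \<open>The exponents of the polynomial, of the moments of the quotient and of the
  Christoffel--Darboux factor add.\<close>

lemma jacobi_remainder_decays:
  assumes ab: "a > -1" "b > -1" and f: "weight_integrable a b f" and q: "weight_integrable a b q"
    and quot: "\<And>y. y \<in> {-1..1} \<Longrightarrow> f y - c = of_real (y - x) * q y"
    and P: "decays p (\<lambda>n. jacobi_P a b n x)" and m: "decays r (jacobi_moment a b q)"
  shows "decays (1 + (p + r)) (\<lambda>n. c - jacobi_proj a b f n x)"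
proof -
  have P': "decays p (\<lambda>n. complex_of_real (jacobi_P a b n x))" unfolding decays_of_real by (rule P)
  have "decays (1 + (p + r)) (\<lambda>n. complex_of_real (jacobi_cd_factor a b n) *
    (of_real (jacobi_P a b (n + 1) x) * jacobi_moment a b q n
      - of_real (jacobi_P a b n x) * jacobi_moment a b q (n + 1)))"
    by (intro decays_mult decays_diff P' m decays_shift_up[OF P'] decays_shift_up[OF m])
       (simp only: decays_of_real decays_jacobi_cd_factor[OF ab])
  moreover have "c - jacobi_proj a b f n x = of_real (jacobi_cd_factor a b n) *
    (of_real (jacobi_P a b (Suc n) x) * jacobi_moment a b q n
      - of_real (jacobi_P a b n x) * jacobi_moment a b q (Suc n))" for n
    by (rule jacobi_remainder_via_quotient[OF ab f q quot])
  ultimately show ?thesis by simp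
qed

lemma jacobi_remainder_off_singularity:
  assumes \<xi>: "-1 < \<xi>" "\<xi> < 1" and ab: "a > -1" "b > -1" and s: "s > 0"
    and U: "open U" "g holomorphic_on U" and X: "complex_of_real ` {-1..1} \<subseteq> U"
    and x: "x \<in> {-1..1}" "x \<noteq> \<xi>" and P: "decays p (\<lambda>n. jacobi_P a b n x)"
  shows "decays (p - s - 1 / 2) (\<lambda>n. sing_fun s \<xi> g x - jacobi_proj a b (sing_fun s \<xi> g) n x)"
proof -
  have cont: "continuous_on {\<xi>..1} (\<lambda>y. g (complex_of_real y))"
    by (rule continuous_on_compose2[OF holomorphic_on_imp_continuous_on[OF U(2)]])
       (use X \<xi> in \<open>auto intro!: continuous_intros\<close>)
  have f: "weight_integrable a b (sing_fun s \<xi> g)"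
    using s by (intro sing_fun_weight_integrable \<xi> ab cont) auto
  obtain q where q: "weight_integrable a b q"
    "\<And>y. y \<in> {-1..1} \<Longrightarrow> sing_fun s \<xi> g y - sing_fun s \<xi> g x = of_real (y - x) * q y"
    "decays (- s - 3 / 2) (jacobi_moment a b q)"
    using sing_fun_quotient_left[OF \<xi> ab s U X, of x] sing_fun_quotient_right[OF \<xi> ab s U X, of x] x
    by (cases "x < \<xi>") auto
  have "decays (1 + (p + (- s - 3 / 2))) (\<lambda>n. sing_fun s \<xi> g x - jacobi_proj a b (sing_fun s \<xi> g) n x)"
    by (rule jacobi_remainder_decays[OF ab f q(1,2) P q(3)])
  moreover have "1 + (p + (- s - 3 / 2)) = p - s - 1 / 2" by simp
  ultimately show ?thesis by simp
qed

text \<open>Replacing \<open>(n + 1) powr p\<close> by \<open>n powr p\<close> costs one order, so an index shift affects the main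
  term only through its phase.\<close>

lemma decays_leading_shift:
  fixes C :: "'a::real_normed_field"
  assumes "p < 0" "decays (p - 1) (\<lambda>n. f n - C * of_real (real n powr p * cos (g n)))"
  shows "decays (p - 1) (\<lambda>n. f (n + 1) - C * of_real (real n powr p * cos (g (n + 1))))"
proof -
  have "(\<lambda>n. norm (real (n + 1) powr p - real n powr p)) \<in> O(\<lambda>n. real n powr (p - 1))"
    using assms(1) unfolding of_nat_add of_nat_1 real_norm_def by real_asymp
  then have "decays (p - 1) (\<lambda>n. real (n + 1) powr p - real n powr p)" by (simp add: decays_def)
  then have "decays ((p - 1) + 0) (\<lambda>n. (real (n + 1) powr p - real n powr p) * cos (g (n + 1)))"
    by (intro decays_mult decays_bounded[of _ 1]) simp_all
  then have "decays (p - 1) (\<lambda>n. C * of_real ((real (n + 1) powr p - real n powr p) * cos (g (n + 1))))"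
    by (intro decays_cmult) (simp only: decays_of_real add_0_right)
  from decays_add[OF decays_shift_up[OF assms(2), of 1] this]
  show ?thesis by (simp add: algebra_simps)
qed

text \<open>At the singularity the quotient is a truncated power of exponent \<open>s - 1\<close>. If \<open>s\<close> is an even
  integer, then the phase of its moments differs from the phase of the polynomials by a multiple
  of \<open>\<pi>\<close>, and the leading terms cancel in the Christoffel--Darboux difference.\<close>

lemma jacobi_remainder_at_singularity:
  assumes \<xi>: "-1 < \<xi>" "\<xi> < 1" and ab: "a > -1" "b > -1" and s: "s > 0"
    and U: "open U" "g holomorphic_on U" and X: "complex_of_real ` {-1..1} \<subseteq> U"
  shows "decays (- s) (\<lambda>n. sing_fun s \<xi> g \<xi> - jacobi_proj a b (sing_fun s \<xi> g) n \<xi>)"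
    and "(\<exists>j::int. s = 2 * of_int j) \<Longrightarrow>
      decays (- s - 1) (\<lambda>n. sing_fun s \<xi> g \<xi> - jacobi_proj a b (sing_fun s \<xi> g) n \<xi>)"
proof -
  have X\<xi>: "complex_of_real ` {\<xi>..1} \<subseteq> U" using X \<xi> by auto
  have cont: "continuous_on {\<xi>..1} (\<lambda>y. g (complex_of_real y))"
    by (rule continuous_on_compose2[OF holomorphic_on_imp_continuous_on[OF U(2)]])
       (use X\<xi> in \<open>auto intro!: continuous_intros\<close>)
  let ?f = "sing_fun s \<xi> g" and ?q = "sing_fun (s - 1) \<xi> g"
  have s1: "s - 1 > -1" using s by simp
  have f: "weight_integrable a b ?f" and q: "weight_integrable a b ?q"
    using s by (auto intro!: sing_fun_weight_integrable \<xi> ab cont)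
  have quot: "?f y - ?f \<xi> = of_real (y - \<xi>) * ?q y" for y
    using truncated_power_mult[of s "y - \<xi>"] s by (simp add: sing_fun_def truncated_power_def[of s 0])
  have "decays (1 + (- 1 / 2 + (- (s - 1) - 3 / 2))) (\<lambda>n. ?f \<xi> - jacobi_proj a b ?f n \<xi>)"
    by (rule jacobi_remainder_decays[OF ab f q quot jacobi_P_leading(2)[OF ab(1) \<xi>]
          decays_jacobi_moment_sing_fun[OF \<xi> ab s1 U X\<xi>]])
  moreover have "1 + (- 1 / 2 + (- (s - 1) - 3 / 2)) = - s" by simp
  ultimately show "decays (- s) (\<lambda>n. ?f \<xi> - jacobi_proj a b ?f n \<xi>)" by (simp only:)
  assume "\<exists>j::int. s = 2 * of_int j"
  then obtain j :: int where j: "s = 2 * of_int j" by blast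
  let ?u = "\<lambda>n. cos (jacobi_phase a b \<xi> n)"
  have ph: "cos (jacobi_phase (a + (s - 1) + 1) (b - (s - 1) - 1) \<xi> n) = cos (of_int j * pi) * ?u n" for n
  proof -
    have "jacobi_phase (a + (s - 1) + 1) (b - (s - 1) - 1) \<xi> n = jacobi_phase a b \<xi> n - of_int j * pi"
      by (simp add: jacobi_phase_def j field_simps)
    then show ?thesis by (simp add: cos_diff sin_zero_iff_int2)
  qed
  let ?P = "\<lambda>n. complex_of_real (jacobi_P a b n \<xi>)" and ?I = "jacobi_moment a b ?q"
  let ?A = "complex_of_real (jacobi_amp a b \<xi>)"
  let ?B = "of_real ((1 + \<xi>) powr b * moment_amp a b (s - 1) \<xi>) * g (of_real \<xi>) * of_real (cos (of_int j * pi))"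
  have P: "decays (- 1 / 2 - 1) (\<lambda>n. ?P n - ?A * of_real (real n powr (- 1 / 2) * ?u n))"
  proof -
    have e: "- 1 / 2 - 1 = - 3 / (2::real)" by simp
    show ?thesis
      unfolding of_real_mult[symmetric] of_real_diff[symmetric] decays_of_real e
      by (rule jacobi_P_leading(1)[OF ab(1) \<xi>])
  qed
  have I: "decays (- s - 1 / 2 - 1) (\<lambda>n. ?I n - ?B * of_real (real n powr (- s - 1 / 2) * ?u n))"
  proof -
    have e: "- (s - 1) - 5 / 2 = - s - 1 / 2 - 1" "- (s - 1) - 3 / 2 = - s - 1 / 2" by simp_all
    have "decays (- s - 1 / 2 - 1) (\<lambda>n. ?I n - of_real ((1 + \<xi>) powr b * moment_amp a b (s - 1) \<xi>) * g (of_real \<xi>)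
        * of_real (real n powr (- s - 1 / 2) * (cos (of_int j * pi) * ?u n)))"
      using jacobi_moment_sing_fun_leading[OF \<xi> ab s1 U X\<xi>] unfolding e ph .
    then show ?thesis by (simp add: mult_ac)
  qed
  have dP: "decays (- 1 / 2) (\<lambda>n. ?A * of_real (real n powr (- 1 / 2) * cos (h n)))" for h
    by (intro decays_cmult) (simp only: decays_of_real decays_cos)
  have dI: "decays (- s - 1 / 2) (\<lambda>n. ?B * of_real (real n powr (- s - 1 / 2) * cos (h n)))" for h
    by (intro decays_cmult) (simp only: decays_of_real decays_cos)
  have P': "decays (- 1 / 2 - 1) (\<lambda>n. ?P (n + 1) - ?A * of_real (real n powr (- 1 / 2) * ?u (n + 1)))"
    by (rule decays_leading_shift[OF _ P]) simp
  have I': "decays (- s - 1 / 2 - 1) (\<lambda>n. ?I (n + 1) - ?B * of_real (real n powr (- s - 1 / 2) * ?u (n + 1)))"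
    by (rule decays_leading_shift[OF _ I]) (use s in simp)
  have "decays (- 1 / 2 + (- s - 1 / 2) - 1) (\<lambda>n. ?P (n + 1) * ?I n - ?P n * ?I (n + 1))"
    using decays_diff[OF decays_mult_leading[OF dP P' dI I] decays_mult_leading[OF dP P dI I']]
    by (simp add: mult_ac)
  moreover have "decays 1 (\<lambda>n. complex_of_real (jacobi_cd_factor a b n))"
    by (simp only: decays_of_real decays_jacobi_cd_factor[OF ab])
  ultimately have "decays (1 + (- 1 / 2 + (- s - 1 / 2) - 1)) (\<lambda>n. complex_of_real (jacobi_cd_factor a b n) *
      (?P (n + 1) * ?I n - ?P n * ?I (n + 1)))"
    by (intro decays_mult)
  moreover have "1 + (- 1 / 2 + (- s - 1 / 2) - 1) = - s - 1" by simp
  moreover have "?f \<xi> - jacobi_proj a b ?f n \<xi> = of_real (jacobi_cd_factor a b n) *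
      (?P (Suc n) * ?I n - ?P n * ?I (Suc n))" for n
    by (rule jacobi_remainder_via_quotient[OF ab f q quot])
  ultimately show "decays (- s - 1) (\<lambda>n. ?f \<xi> - jacobi_proj a b ?f n \<xi>)"
    by (simp only: Suc_eq_plus1)
qed

section \<open>Differentiating the remainder\<close>

text \<open>Differentiation commutes with projection up to a shift of the parameters, because moments,
  norms and polynomials shift by matching factors.\<close>

lemma jacobi_proj_has_derivative:
  assumes ab: "a > -1" "b > -1" and F: "continuous_on {-1..1} F" "continuous_on {-1..1} F'"
    and D: "\<And>x. x \<in> {-1<..<1} \<Longrightarrow> (F has_vector_derivative F' x) (at x)"
  shows "(jacobi_proj a b F (Suc n) has_vector_derivative jacobi_proj (a + 1) (b + 1) F' n x) (at x)"
proof -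
  have coeff: "jacobi_coeff a b F (Suc k) * of_real ((real k + a + b + 2) / 2) = jacobi_coeff (a + 1) (b + 1) F' k" for k
  proof -
    define h where "h = complex_of_real (jacobi_h (a + 1) (b + 1) k)"
    define m where "m = jacobi_moment (a + 1) (b + 1) F' k"
    define r where "r = complex_of_real (real k + a + b + 2)"
    define N where "N = complex_of_real (real (Suc k))"
    have r: "r \<noteq> 0" using ab unfolding r_def of_real_eq_0_iff by simp
    have N: "N \<noteq> 0" by (simp only: N_def of_real_eq_0_iff of_nat_neq_0 not_False_eq_True)
    have h: "h \<noteq> 0" using jacobi_h_pos[of "a + 1" "b + 1" k] ab by (simp add: h_def)
    have hh: "complex_of_real (jacobi_h a b (Suc k)) = r / (4 * N) * h"
      unfolding jacobi_h_Suc[OF ab] r_def N_def h_def by (simp only: of_real_mult of_real_divide of_real_numeral)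
    have mm: "jacobi_moment a b F (Suc k) = m / (2 * N)"
      using jacobi_moment_Suc[OF ab F D, of k] unfolding m_def N_def by (simp only: of_real_mult of_real_numeral)
    have rr: "complex_of_real ((real k + a + b + 2) / 2) = r / 2"
      unfolding r_def by (simp only: of_real_divide of_real_numeral)
    have "m / (2 * N) / (r / (4 * N) * h) * (r / 2) = m / h"
      using r N h by (simp add: field_simps)
    then show ?thesis
      unfolding jacobi_coeff_eq_moment mm hh rr m_def h_def .
  qed
  have eq: "jacobi_proj a b F (Suc n) = (\<lambda>x. jacobi_coeff a b F 0 * of_real (jacobi_P a b 0 x)
      + (\<Sum>k\<le>n. jacobi_coeff a b F (Suc k) * of_real (jacobi_P a b (Suc k) x)))"
    by (simp add: jacobi_proj_def fun_eq_iff atLeast0AtMost sum.atMost_Suc_shift del: sum.atMost_Suc)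
  have "((\<lambda>x. jacobi_coeff a b F 0 * of_real (jacobi_P a b 0 x)
      + (\<Sum>k\<le>n. jacobi_coeff a b F (Suc k) * of_real (jacobi_P a b (Suc k) x))) has_vector_derivative
      (0 + (\<Sum>k\<le>n. jacobi_coeff a b F (Suc k) * (of_real ((real k + a + b + 2) / 2) * of_real (jacobi_P (a + 1) (b + 1) k x))))) (at x)"
    unfolding jacobi_P_0[OF ab(1)]
    by (intro has_vector_derivative_add has_vector_derivative_sum has_vector_derivative_mult_right
        jacobi_P_has_vector_derivative ab has_vector_derivative_const)
  also have "0 + (\<Sum>k\<le>n. jacobi_coeff a b F (Suc k) * (of_real ((real k + a + b + 2) / 2) * of_real (jacobi_P (a + 1) (b + 1) k x)))
      = jacobi_proj (a + 1) (b + 1) F' n x"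
    unfolding jacobi_proj_def mult.assoc[symmetric] coeff by (simp add: atLeast0AtMost)
  finally show ?thesis unfolding eq .
qed

text \<open>Derivatives are two-sided at \<open>-1\<close> and \<open>1\<close>, hence the open set \<open>V\<close>. Each differentiation
  lowers the degree of the projection by one, hence \<open>M \<le> n\<close>.\<close>

lemma jacobi_remainder_derivative:
  assumes ab: "a > -1" "b > -1" and V: "open V" "{-1..1} \<subseteq> V"
    and cont: "\<And>j. j \<le> M \<Longrightarrow> continuous_on {-1..1} (D j)"
    and der: "\<And>j x. j < M \<Longrightarrow> x \<in> V \<Longrightarrow> (D j has_vector_derivative D (Suc j) x) (at x)"
    and M: "M \<le> n"
  shows "m \<le> M \<Longrightarrow> x \<in> V \<Longrightarrow> jacobi_remainder a b (D 0) m n x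
    = D m x - jacobi_proj (a + real m) (b + real m) (D m) (n - m) x"
  unfolding jacobi_remainder_def nth_vector_derivative_def
proof (induction m arbitrary: x)
  case 0
  then show ?case by simp
next
  case (Suc m)
  let ?T = "\<lambda>h t. vector_derivative h (at t)"
  let ?h = "\<lambda>x. D 0 x - jacobi_proj a b (D 0) n x"
  obtain k where k: "n - m = Suc k" "n - Suc m = k" using Suc.prems M by (cases "n - m") auto
  have a': "a + real m > -1" "b + real m > -1" using ab by auto
  have "((\<lambda>x. D m x - jacobi_proj (a + real m) (b + real m) (D m) (Suc k) x) has_vector_derivative
      (D (Suc m) x - jacobi_proj (a + real m + 1) (b + real m + 1) (D (Suc m)) k x)) (at x)"
  proof (intro has_vector_derivative_diff jacobi_proj_has_derivative a' cont der)
    show "y \<in> V" if "y \<in> {-1<..<1}" for y using that V by auto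
  qed (use Suc.prems in auto)
  then have "((?T ^^ m) ?h has_vector_derivative
      (D (Suc m) x - jacobi_proj (a + real m + 1) (b + real m + 1) (D (Suc m)) k x)) (at x)"
  proof (rule has_vector_derivative_transform_within_open[OF _ V(1)])
    show "x \<in> V" using Suc.prems by simp
    show "D m y - jacobi_proj (a + real m) (b + real m) (D m) (Suc k) y = (?T ^^ m) ?h y" if "y \<in> V" for y
      using Suc.IH[OF _ that] Suc.prems k by simp
  qed
  then show ?case
    using k by (simp add: vector_derivative_at add.assoc add.commute[of 1])
qed

lemma decays_imp_bigo:
  fixes f :: "nat \<Rightarrow> complex"
  assumes "decays p f"
  shows "f \<in> O(\<lambda>n. complex_of_real (real n powr p))"
proof -
  obtain C where "eventually (\<lambda>n. norm (f n) \<le> C * real n powr p) sequentially"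
    using decaysE[OF assms] by blast
  then show ?thesis by (intro bigoI[of _ C]) simp
qed

theorem theorem3p4:
  fixes \<alpha> \<beta> \<xi> \<sigma> :: real and g :: "complex \<Rightarrow> complex"
  assumes "\<alpha> > -1" and "\<beta> > -1"
    and "-1 < \<xi>" and "\<xi> < 1"
    and "g analytic_on (complex_of_real ` {-1..1})"
  shows
    "(\<sigma> > -1 \<longrightarrow>
        (\<lambda>k. jacobi_coeff \<alpha> \<beta> (sing_fun \<sigma> \<xi> g) k
              - amplitude \<sigma> \<xi> \<alpha> \<beta> g *
                complex_of_real (cos (real k * arccos \<xi> - phase \<sigma> \<alpha> \<beta> \<xi>)
                                 / real k powr (\<sigma> + 1 / 2)))
          \<in> O(\<lambda>k. complex_of_real (1 / real k powr (\<sigma> + 3 / 2))))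
     \<and>
     (\<forall>m::nat.
        \<sigma> > 0 \<and> \<not> (\<exists>j::int. \<sigma> = 2 * real_of_int j) \<and>
        real m < min \<sigma> (min ((\<sigma> + 1 / 2 - \<beta>) / 2) ((\<sigma> + 1 / 2 - \<alpha>) / 2)) \<longrightarrow>
        (\<lambda>n. jacobi_remainder \<alpha> \<beta> (sing_fun \<sigma> \<xi> g) m n (-1))
          \<in> O(\<lambda>n. complex_of_real (real n powr (2 * real m + \<beta> - \<sigma> - 1 / 2))) \<and>
        (\<lambda>n. jacobi_remainder \<alpha> \<beta> (sing_fun \<sigma> \<xi> g) m n 1)
          \<in> O(\<lambda>n. complex_of_real (real n powr (2 * real m + \<alpha> - \<sigma> - 1 / 2))) \<and>
        (\<forall>x \<in> {-1<..<\<xi>} \<union> {\<xi><..<1}.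
          (\<lambda>n. jacobi_remainder \<alpha> \<beta> (sing_fun \<sigma> \<xi> g) m n x)
            \<in> O(\<lambda>n. complex_of_real (real n powr (real m - \<sigma> - 1)))) \<and>
        (if \<exists>j::int. \<bar>real m - \<sigma>\<bar> = 2 * real_of_int j
         then (\<lambda>n. jacobi_remainder \<alpha> \<beta> (sing_fun \<sigma> \<xi> g) m n \<xi>)
                \<in> O(\<lambda>n. complex_of_real (real n powr (real m - \<sigma> - 1)))
         else (\<lambda>n. jacobi_remainder \<alpha> \<beta> (sing_fun \<sigma> \<xi> g) m n \<xi>)
                \<in> O(\<lambda>n. complex_of_real (real n powr (real m - \<sigma>)))))"
proof -
  note ab = assms(1,2) and \<xi> = assms(3,4)
  obtain U where U: "open U" "complex_of_real ` {-1..1} \<subseteq> U" "g holomorphic_on U"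
    using assms(5) analytic_on_holomorphic by blast
  have U\<xi>: "complex_of_real ` {\<xi>..1} \<subseteq> U" using U(2) \<xi> by auto
  show ?thesis
  proof (intro conjI allI impI)
    assume "\<sigma> > -1"
    from decays_imp_bigo[OF jacobi_coeff_sing_fun_leading[OF \<xi> ab this U(1,3) U\<xi>]]
    show "(\<lambda>k. jacobi_coeff \<alpha> \<beta> (sing_fun \<sigma> \<xi> g) k
              - amplitude \<sigma> \<xi> \<alpha> \<beta> g *
                complex_of_real (cos (real k * arccos \<xi> - phase \<sigma> \<alpha> \<beta> \<xi>)
                                 / real k powr (\<sigma> + 1 / 2)))
          \<in> O(\<lambda>k. complex_of_real (1 / real k powr (\<sigma> + 3 / 2)))"
      unfolding powr_minus_divide .
  next
    fix m :: nat
    assume "\<sigma> > 0 \<and> \<not> (\<exists>j::int. \<sigma> = 2 * real_of_int j) \<and>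
        real m < min \<sigma> (min ((\<sigma> + 1 / 2 - \<beta>) / 2) ((\<sigma> + 1 / 2 - \<alpha>) / 2))"
    then have m: "real m < \<sigma>" by simp
    define s where "s = \<sigma> - real m"
    define G where "G = sing_tower \<sigma> \<xi> g m"
    define D where "D = (\<lambda>j. sing_fun (\<sigma> - real j) \<xi> (sing_tower \<sigma> \<xi> g j))"
    have s: "s > 0" using m by (simp add: s_def)
    have G: "G holomorphic_on U" unfolding G_def by (rule sing_tower_holomorphic[OF U(1,3)])
    define V where "V = {x. complex_of_real x \<in> U}"
    have "open (complex_of_real -` U)" by (rule open_vimage[OF U(1)]) (intro continuous_intros)
    then have V: "open V" "{-1..1} \<subseteq> V" using U(2) by (auto simp: V_def vimage_def)
    have rem: "jacobi_remainder \<alpha> \<beta> (sing_fun \<sigma> \<xi> g) m n x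
        = sing_fun s \<xi> G x - jacobi_proj (\<alpha> + real m) (\<beta> + real m) (sing_fun s \<xi> G) (n - m) x"
      if "n \<ge> m" "x \<in> {-1..1}" for n x
    proof -
      have "jacobi_remainder \<alpha> \<beta> (D 0) m n x = D m x - jacobi_proj (\<alpha> + real m) (\<beta> + real m) (D m) (n - m) x"
      proof (rule jacobi_remainder_derivative[OF ab V, of m])
        fix j assume "j \<le> m"
        then show "continuous_on {-1..1} (D j)"
          unfolding D_def using m U(2)
          by (intro sing_fun_continuous[OF _ U(1) sing_tower_holomorphic[OF U(1,3)]]) auto
      next
        fix j y assume "j < m" "y \<in> V"
        then show "(D j has_vector_derivative D (Suc j) y) (at y)"
          unfolding D_def using m by (intro sing_tower_derivative[OF U(1,3)]) (auto simp: V_def)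
      qed (use that V in auto)
      then show ?thesis by (simp add: D_def s_def G_def)
    qed
    have ab': "\<alpha> + real m > -1" "\<beta> + real m > -1" using ab by auto
    have transfer: "(\<lambda>n. jacobi_remainder \<alpha> \<beta> (sing_fun \<sigma> \<xi> g) m n x) \<in> O(\<lambda>n. complex_of_real (real n powr q))"
      if x: "x \<in> {-1..1}" and "decays p (\<lambda>n. sing_fun s \<xi> G x - jacobi_proj (\<alpha> + real m) (\<beta> + real m) (sing_fun s \<xi> G) n x)"
        and "p = q" for x p q
    proof -
      have "decays q (\<lambda>n. sing_fun s \<xi> G x - jacobi_proj (\<alpha> + real m) (\<beta> + real m) (sing_fun s \<xi> G) (n - m) x)"
        using decays_shift_down[OF that(2), of m] that(3) by simp
      then have "decays q (\<lambda>n. jacobi_remainder \<alpha> \<beta> (sing_fun \<sigma> \<xi> g) m n x)"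
        by (rule decays_cong, intro eventually_mono[OF eventually_ge_at_top[of m]]) (rule rem[OF _ x])
      then show ?thesis by (rule decays_imp_bigo)
    qed
    note off = jacobi_remainder_off_singularity[OF \<xi> ab' s U(1) G U(2)]
    note at = jacobi_remainder_at_singularity[OF \<xi> ab' s U(1) G U(2)]
    show "(\<lambda>n. jacobi_remainder \<alpha> \<beta> (sing_fun \<sigma> \<xi> g) m n (-1))
          \<in> O(\<lambda>n. complex_of_real (real n powr (2 * real m + \<beta> - \<sigma> - 1 / 2)))"
      by (rule transfer[OF _ off[OF _ _ decays_jacobi_P_at_minus_1[OF ab']]]) (use \<xi> in \<open>auto simp: s_def\<close>)
    show "(\<lambda>n. jacobi_remainder \<alpha> \<beta> (sing_fun \<sigma> \<xi> g) m n 1)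
          \<in> O(\<lambda>n. complex_of_real (real n powr (2 * real m + \<alpha> - \<sigma> - 1 / 2)))"
      by (rule transfer[OF _ off[OF _ _ decays_jacobi_P_at_1[OF ab'(1)]]]) (use \<xi> in \<open>auto simp: s_def\<close>)
    show "\<forall>x \<in> {-1<..<\<xi>} \<union> {\<xi><..<1}.
          (\<lambda>n. jacobi_remainder \<alpha> \<beta> (sing_fun \<sigma> \<xi> g) m n x)
            \<in> O(\<lambda>n. complex_of_real (real n powr (real m - \<sigma> - 1)))"
    proof
      fix x assume x: "x \<in> {-1<..<\<xi>} \<union> {\<xi><..<1}"
      then have x': "-1 < x" "x < 1" "x \<noteq> \<xi>" using \<xi> by auto
      show "(\<lambda>n. jacobi_remainder \<alpha> \<beta> (sing_fun \<sigma> \<xi> g) m n x)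
            \<in> O(\<lambda>n. complex_of_real (real n powr (real m - \<sigma> - 1)))"
        by (rule transfer[OF _ off[OF _ _ jacobi_P_leading(2)[OF ab'(1) x'(1,2)]]]) (use x' in \<open>auto simp: s_def\<close>)
    qed
    show "if \<exists>j::int. \<bar>real m - \<sigma>\<bar> = 2 * real_of_int j
         then (\<lambda>n. jacobi_remainder \<alpha> \<beta> (sing_fun \<sigma> \<xi> g) m n \<xi>)
                \<in> O(\<lambda>n. complex_of_real (real n powr (real m - \<sigma> - 1)))
         else (\<lambda>n. jacobi_remainder \<alpha> \<beta> (sing_fun \<sigma> \<xi> g) m n \<xi>)
                \<in> O(\<lambda>n. complex_of_real (real n powr (real m - \<sigma>)))"
    proof (cases "\<exists>j::int. \<bar>real m - \<sigma>\<bar> = 2 * real_of_int j")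
      case True
      then have "\<exists>j::int. s = 2 * of_int j" using m by (simp add: s_def)
      from transfer[OF _ at(2)[OF this], of "real m - \<sigma> - 1"] show ?thesis
        using True \<xi> by (simp add: s_def)
    next
      case False
      from transfer[OF _ at(1), of "real m - \<sigma>"] show ?thesis
        using False \<xi> by (simp add: s_def)
    qed
  qed
qed

end
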